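(* Let $M\geq2$, let $\mathsf{A}=(A_1,\ldots,A_M)\in M_d(\mathbb{R})^M$ be irreducible, let $s>0$, and let $\mu\in\mathcal{M}_\sigma$ be the unique equilibrium state of $(\mathsf{A},s)$. Then $\mu$ is a Bernoulli measure if and only if for every $B_1,B_2\in\mathcal{S}(\mathsf{A})$ we have $\rho(B_1B_2)=\rho(B_1)\rho(B_2)$.
   Context: $\Sigma_M:=\{1,\ldots,M\}^{\mathbb{N}}$ with the product topology; $\sigma$ is the shift $\sigma[(x_n)_{n=1}^\infty]=(x_{n+1})_{n=1}^\infty$; $\mathcal{M}_\sigma$ is the set of $\sigma$-invariant Borel probability measures on $\Sigma_M$; $h(\nu)$ is the metric entropy of $\nu\in\mathcal{M}_\sigma$. $M_d(\mathbb{R})$ is the set of real $d\times d$ matrices, $\|\cdot\|$ is the operator norm induced by the Euclidean norm, and $\rho$ denotes spectral radius. The top Lyapunov exponent is $\Lambda(\mathsf{A},\nu):=\lim_{n\to\infty}\frac1n\int_{\Sigma_M}\log\|A_{x_n}\cdots A_{x_1}\|\,d\nu(x)\in[-\infty,\infty)$ (with $\log 0=-\infty$). An equilibrium state of $(\mathsf{A},s)$ is a measure $\mu\in\mathcal{M}_\sigma$ attaining $\sup_{\nu\in\mathcal{M}_\sigma}\bigl(h(\nu)+s\Lambda(\mathsf{A},\nu)\bigr)$. $\mathsf{A}$ is irreducible if there is no linear subspace $U\subset\mathbb{R}^d$ with $0<\dim U<d$ and $A_iU\subseteq U$ for all $i$. It is known (Feng–Käenmäki) that if $d\geq2$ and $\mathsf{A}$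 is irreducible then $(\mathsf{A},s)$ has exactly one equilibrium state. $\mathcal{S}(\mathsf{A})$ is the semigroup generated by $A_1,\ldots,A_M$. A Bernoulli measure on $\Sigma_M$ is a measure of the form $p^{\mathbb{N}}$ with $p$ a probability measure on $\{1,\ldots,M\}$ (not necessarily of full support). *)

theory Defs
  imports "HOL-Probability.Probability"
begin

section \<open>The one-sided full shift\<close>

text \<open>Sequences are indexed from \<open>0\<close>, so \<open>x 0\<close> is the first symbol. The topology on
  \<^typ>\<open>nat \<Rightarrow> nat\<close> is the product topology.\<close>

definition full_shift :: "nat \<Rightarrow> (nat \<Rightarrow> nat) set" where
  "full_shift M = {x. \<forall>n. x n \<in> {1..M}}"

definition shift :: "(nat \<Rightarrow> nat) \<Rightarrow> (nat \<Rightarrow> nat)" where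
  "shift x = (\<lambda>n. x (Suc n))"

definition shift_borel :: "nat \<Rightarrow> (nat \<Rightarrow> nat) measure" where
  "shift_borel M = restrict_space borel (full_shift M)"

definition invariant_measures :: "nat \<Rightarrow> (nat \<Rightarrow> nat) measure set" where
  "invariant_measures M =
     {\<nu>. prob_space \<nu> \<and> sets \<nu> = sets (shift_borel M) \<and> distr \<nu> (shift_borel M) shift = \<nu>}"

definition bernoulli_measure :: "nat \<Rightarrow> (nat \<Rightarrow> nat) measure \<Rightarrow> bool" where
  "bernoulli_measure M \<mu> \<longleftrightarrow>
     (\<exists>p. prob_space p \<and> sets p = Pow {1..M} \<and> \<mu> = (\<Pi>\<^sub>M n\<in>UNIV. p))"

text \<open>Product measures live on the product \<open>\<sigma>\<close>-algebra, which is the Borel one.\<close>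

lemma space_shift_borel: "space (shift_borel M) = full_shift M"
  by (simp add: shift_borel_def space_restrict_space)

lemma sets_shift_borel:
  "sets (shift_borel M) = sets (\<Pi>\<^sub>M n\<in>(UNIV::nat set). count_space {1..M})"
proof -
  have sp: "full_shift M = space (\<Pi>\<^sub>M n\<in>(UNIV::nat set). count_space {1..M})"
    by (auto simp: full_shift_def space_PiM PiE_def)
  have borel_PiM: "sets borel = sets (\<Pi>\<^sub>M n\<in>(UNIV::nat set). (borel :: nat measure))"
    by (rule sets_PiM_equal_borel [symmetric])
  show ?thesis
  proof
    have "(\<lambda>x. x) \<in> measurable (\<Pi>\<^sub>M n\<in>(UNIV::nat set). count_space {1..M})
             (\<Pi>\<^sub>M n\<in>(UNIV::nat set). (borel :: nat measure))"
      by (rule measurable_PiM_single')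
        (auto intro: measurable_compose [OF measurable_component_singleton])
    then have "(\<lambda>x. x) \<in> measurable (\<Pi>\<^sub>M n\<in>(UNIV::nat set). count_space {1..M}) borel"
      using measurable_cong_sets [OF refl borel_PiM] by blast
    then have *: "(\<lambda>x. x) \<in> measurable (\<Pi>\<^sub>M n\<in>(UNIV::nat set). count_space {1..M}) (shift_borel M)"
      unfolding shift_borel_def by (intro measurable_restrict_space2) (auto simp: sp)
    show "sets (shift_borel M) \<subseteq> sets (\<Pi>\<^sub>M n\<in>(UNIV::nat set). count_space {1..M})"
    proof
      fix B assume B: "B \<in> sets (shift_borel M)"
      then have "B \<subseteq> space (\<Pi>\<^sub>M n\<in>(UNIV::nat set). count_space {1..M})"
        using sets.sets_into_space [OF B] by (simp add: space_shift_borel sp)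
      then show "B \<in> sets (\<Pi>\<^sub>M n\<in>(UNIV::nat set). count_space {1..M})"
        using measurable_sets [OF * B] by (simp add: Int_absorb2)
    qed
  next
    have comp: "(\<lambda>x. x n) \<in> measurable (shift_borel M) (count_space {1..M})" for n
    proof (rule measurableI)
      fix B :: "nat set" assume B: "B \<in> sets (count_space {1..M})"
      have "(\<lambda>x. x n) \<in> measurable borel (borel :: nat measure)"
        by (intro borel_measurable_continuous_onI continuous_on_product_coordinates)
      moreover have "B \<in> sets (borel :: nat measure)"
        by (rule borel_open [OF discrete_topology_class.open_discrete])
      ultimately have "(\<lambda>x::nat \<Rightarrow> nat. x n) -` B \<in> sets borel"
        by (metis Int_UNIV_right measurable_sets space_borel)
      then show "(\<lambda>x. x n) -` B \<inter> space (shift_borel M) \<in> sets (shift_borel M)"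
        by (auto simp: shift_borel_def space_restrict_space sets_restrict_space Int_commute)
    qed (auto simp: space_shift_borel full_shift_def)
    have *: "(\<lambda>x. x) \<in> measurable (shift_borel M) (\<Pi>\<^sub>M n\<in>(UNIV::nat set). count_space {1..M})"
      by (rule measurable_PiM_single')
        (use comp in \<open>auto simp: space_shift_borel full_shift_def\<close>)
    show "sets (\<Pi>\<^sub>M n\<in>(UNIV::nat set). count_space {1..M}) \<subseteq> sets (shift_borel M)"
    proof
      fix B assume B: "B \<in> sets (\<Pi>\<^sub>M n\<in>(UNIV::nat set). count_space {1..M})"
      then have "B \<subseteq> space (shift_borel M)"
        using sets.sets_into_space [OF B] by (simp add: space_shift_borel sp)
      then show "B \<in> sets (shift_borel M)"
        using measurable_sets [OF * B] by (simp add: Int_absorb2)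
    qed
  qed
qed


section \<open>Metric entropy\<close>

definition finite_partitions :: "nat \<Rightarrow> (nat \<Rightarrow> nat) set set set" where
  "finite_partitions M =
     {P. finite P \<and> P \<subseteq> sets (shift_borel M) \<and> partition_on (full_shift M) P}"

definition partition_entropy :: "(nat \<Rightarrow> nat) measure \<Rightarrow> (nat \<Rightarrow> nat) set set \<Rightarrow> real" where
  "partition_entropy \<nu> P = (\<Sum>B\<in>P. - measure \<nu> B * ln (measure \<nu> B))"

text \<open>The common refinement of \<open>\<sigma>\<^sup>-\<^sup>i P\<close> for \<open>i < n\<close>; the function \<open>f\<close> selects a cell of \<open>P\<close> at
  each time.\<close>

definition iterated_join :: "nat \<Rightarrow> (nat \<Rightarrow> nat) set set \<Rightarrow> nat \<Rightarrow> (nat \<Rightarrow> nat) set set" where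
  "iterated_join M P n =
     (\<lambda>f. {x \<in> full_shift M. \<forall>i<n. (shift ^^ i) x \<in> f i}) ` ({..<n} \<rightarrow>\<^sub>E P) - {{}}"

definition metric_entropy :: "nat \<Rightarrow> (nat \<Rightarrow> nat) measure \<Rightarrow> ereal" where
  "metric_entropy M \<nu> =
     (SUP P\<in>finite_partitions M.
        ereal (lim (\<lambda>n. partition_entropy \<nu> (iterated_join M P n) / real n)))"


section \<open>The top Lyapunov exponent and equilibrium states\<close>

definition ln_ereal :: "real \<Rightarrow> ereal" where
  "ln_ereal t = (if t = 0 then -\<infinity> else ereal (ln t))"

text \<open>Lebesgue integral of an extended real function, as the integral of the positive part minus
  that of the negative part; it is only used for functions bounded above, where the first term is
  finite.\<close>

definition ereal_integral :: "'a measure \<Rightarrow> ('a \<Rightarrow> ereal) \<Rightarrow> ereal" where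
  "ereal_integral \<nu> f =
     enn2ereal (\<integral>\<^sup>+ x. e2ennreal (f x) \<partial>\<nu>) - enn2ereal (\<integral>\<^sup>+ x. e2ennreal (- f x) \<partial>\<nu>)"

definition matrix_norm :: "real^'d^'d \<Rightarrow> real" where
  "matrix_norm B = onorm (\<lambda>v. B *v v)"

primrec cocycle :: "(nat \<Rightarrow> real^'d^'d) \<Rightarrow> (nat \<Rightarrow> nat) \<Rightarrow> nat \<Rightarrow> real^'d^'d" where
  "cocycle A x 0 = mat 1"
| "cocycle A x (Suc n) = A (x n) ** cocycle A x n"

definition lyapunov_exponent :: "(nat \<Rightarrow> real^'d^'d) \<Rightarrow> (nat \<Rightarrow> nat) measure \<Rightarrow> ereal" where
  "lyapunov_exponent A \<nu> =
     lim (\<lambda>n. ereal (1 / real n) * ereal_integral \<nu> (\<lambda>x. ln_ereal (matrix_norm (cocycle A x n))))"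

definition equilibrium_states ::
    "nat \<Rightarrow> (nat \<Rightarrow> real^'d^'d) \<Rightarrow> real \<Rightarrow> (nat \<Rightarrow> nat) measure set" where
  "equilibrium_states M A s =
     {\<mu> \<in> invariant_measures M.
        metric_entropy M \<mu> + ereal s * lyapunov_exponent A \<mu> =
        (SUP \<nu>\<in>invariant_measures M. metric_entropy M \<nu> + ereal s * lyapunov_exponent A \<nu>)}"


section \<open>Matrix tuples\<close>

text \<open>A tuple of \<open>M\<close> matrices is a function of which only the values on \<open>{1..M}\<close> matter.\<close>

definition irreducible_tuple :: "nat \<Rightarrow> (nat \<Rightarrow> real^'d^'d) \<Rightarrow> bool" where
  "irreducible_tuple M A \<longleftrightarrow>
     \<not> (\<exists>U :: (real^'d) set. subspace U \<and> 0 < dim U \<and> dim U < CARD('d) \<and>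
          (\<forall>i\<in>{1..M}. (\<lambda>v. A i *v v) ` U \<subseteq> U))"

inductive_set matrix_semigroup :: "nat \<Rightarrow> (nat \<Rightarrow> real^'d^'d) \<Rightarrow> (real^'d^'d) set"
  for M :: nat and A :: "nat \<Rightarrow> real^'d^'d" where
  generator: "i \<in> {1..M} \<Longrightarrow> A i \<in> matrix_semigroup M A"
| product: "B \<in> matrix_semigroup M A \<Longrightarrow> C \<in> matrix_semigroup M A \<Longrightarrow> B ** C \<in> matrix_semigroup M A"

definition complex_eigenvalues :: "real^'d^'d \<Rightarrow> complex set" where
  "complex_eigenvalues B =
     {z. \<exists>v :: complex^'d. v \<noteq> 0 \<and> map_matrix complex_of_real B *v v = z *s v}"

definition spectral_radius :: "real^'d^'d \<Rightarrow> real" where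
  "spectral_radius B = Max (cmod ` complex_eigenvalues B)"

end

theory Submission
  imports Defs "Jordan_Normal_Form.Spectral_Radius" "HOL-Real_Asymp.Real_Asymp"
begin

text \<open>
  Write \<open>A\<^sub>w\<close> for the product of the matrices along a finite word \<open>w\<close>, \<open>[w]\<close> for the cylinder of
  \<open>w\<close> and \<open>Z\<^sub>n\<close> for the sum of \<open>\<parallel>A\<^sub>w\<parallel>\<^sup>s\<close> over all words of length \<open>n\<close>.

  The bridge between equilibrium states and matrices is a one-sided Gibbs bound. If
  \<open>Z\<^sub>n \<le> C R\<^sup>n\<close> for all \<open>n\<close>, then every invariant measure \<open>m\<close> with
  \<open>m[w] \<le> K \<parallel>A\<^sub>w\<parallel>\<^sup>s R\<^sup>-\<^sup>|\<^sup>w\<^sup>|\<close> is an equilibrium state (\<open>gibbs_imp_equilibrium_state\<close>). Indeed, Gibbs'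
  inequality against the weights \<open>\<parallel>A\<^sub>w\<parallel>\<^sup>s / (C R\<^sup>n)\<close> bounds \<open>h(\<nu>) + s \<Lambda>(A,\<nu>)\<close> by \<open>ln R\<close> for every
  invariant \<open>\<nu>\<close>, and taking logarithms in the bound on \<open>m[w]\<close> shows that \<open>m\<close> reaches this value. Since
  the equilibrium state is assumed to be unique, a measure with a Gibbs bound must be \<open>\<mu>\<close>, so each
  direction of the theorem comes down to exhibiting a suitable measure of this kind.

  If the spectral radius is multiplicative, the candidate is the Bernoulli measure with
  weights proportional to \<open>\<rho>(A\<^sub>i)\<^sup>s\<close>. Both bounds that it needs follow once \<open>\<parallel>B\<parallel> \<le> K \<rho>(B)\<close> is known on the
  semigroup (\<open>matrix_norm_le_spectral_radius\<close>). By irreducibility the trace form is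
  nondegenerate on the linear span of the semigroup (\<open>trace_form_nondegenerate\<close>), so \<open>\<parallel>B\<parallel>\<close> is
  controlled by finitely many numbers \<open>|tr(XB)| \<le> d \<rho>(XB) = d \<rho>(X) \<rho>(B)\<close> with \<open>X\<close> in the semigroup.

  For the converse, irreducibility gives quasi-multiplicativity: for a finite set \<open>F\<close> of words,
  the sum over \<open>k\<close> in \<open>F\<close> of \<open>\<parallel>B A\<^sub>k C\<parallel>\<close> is at least \<open>\<delta> \<parallel>B\<parallel> \<parallel>C\<parallel>\<close>. Hence \<open>Z\<^sub>n\<close> is comparable with \<open>R\<^sup>n\<close>, and a limit
  of averages of the weights \<open>\<parallel>A\<^sub>w\<parallel>\<^sup>s / Z\<^sub>n\<close> is an invariant measure with
  \<open>a \<parallel>A\<^sub>w\<parallel>\<^sup>s \<le> m[w] R\<^sup>|\<^sup>w\<^sup>| \<le> K \<parallel>A\<^sub>w\<parallel>\<^sup>s\<close> (\<open>gibbs_measure_exists\<close>). So \<open>m = \<mu>\<close>, and if \<open>\<mu>\<close> is Bernoulli then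
  \<open>\<mu>[w\<^sup>n] = \<mu>[w]\<^sup>n\<close>. Letting \<open>n\<close> tend to infinity yields \<open>\<rho>(A\<^sub>w)\<^sup>s = \<mu>[w] R\<^sup>|\<^sup>w\<^sup>|\<close>, whose right-hand side is
  multiplicative in \<open>w\<close>.\<close>

section \<open>Eigenvalues, trace and powers of a real matrix\<close>

text \<open>Matrices with numbered rows and matrices indexed by a finite type share the names and symbols
  below; from here on these refer to the latter.\<close>

hide_const (open) Spectral_Radius.spectral_radius Matrix.mat Matrix.vec Matrix.row Matrix.col
  VectorSpace.subspace
hide_fact (open) Spectral_Radius.spectral_radius_def Matrix.vec_eq_iff Matrix.mat_def VectorSpace.subspace_def
no_notation Matrix.vec_index (infixl \<open>$\<close> 100)
no_notation Matrix.scalar_prod (infix \<open>\<bullet>\<close> 70)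

text \<open>Matrices over the finite type \<open>'d\<close> are transported to matrices with numbered rows and columns, for
  which triangularization and growth of powers are known. Any numbering of \<open>'d\<close> will do.\<close>

definition index_of :: "nat \<Rightarrow> 'd::finite" where
  "index_of = (SOME e. bij_betw e {0..<CARD('d)} UNIV)"

lemma bij_index_of: "bij_betw (index_of :: nat \<Rightarrow> 'd::finite) {0..<CARD('d)} UNIV"
  unfolding index_of_def
  using someI_ex [OF ex_bij_betw_nat_finite [OF finite_class.finite_UNIV]] .

lemma index_of_surj:
  obtains i where "i < CARD('d)" "index_of i = (a :: 'd::finite)"
  using bij_index_of [where 'd = 'd] unfolding bij_betw_def by (metis UNIV_I atLeastLessThan_iff imageE)

lemma sum_index_of: "(\<Sum>i<CARD('d). f (index_of i :: 'd::finite)) = (\<Sum>a\<in>UNIV. f a)"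
  using sum.reindex_bij_betw [OF bij_index_of, of f] by (simp add: atLeast0LessThan)

definition complex_mat :: "real^'d^'d \<Rightarrow> complex mat" where
  "complex_mat B = Matrix.mat CARD('d) CARD('d)
     (\<lambda>(i, j). complex_of_real (B $ index_of i $ index_of j))"

lemma complex_mat_carrier [simp]: "complex_mat (B :: real^'d^'d) \<in> carrier_mat CARD('d) CARD('d)"
  by (simp add: complex_mat_def)

lemma complex_mat_dim [simp]:
  "dim_row (complex_mat (B :: real^'d^'d)) = CARD('d)" "dim_col (complex_mat B) = CARD('d)"
  by (simp_all add: complex_mat_def)

lemma complex_mat_index:
  "i < CARD('d) \<Longrightarrow> j < CARD('d) \<Longrightarrow>
    complex_mat (B :: real^'d^'d) $$ (i, j) = complex_of_real (B $ index_of i $ index_of j)"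
  by (simp add: complex_mat_def)

lemma complex_mat_mult: "complex_mat (B ** C) = complex_mat B * complex_mat (C :: real^'d^'d)"
proof (rule eq_matI)
  fix i j assume "i < dim_row (complex_mat B * complex_mat C)" "j < dim_col (complex_mat B * complex_mat C)"
  then have ij: "i < CARD('d)" "j < CARD('d)" by auto
  have "(complex_mat B * complex_mat C) $$ (i, j)
      = (\<Sum>k<CARD('d). complex_of_real (B $ index_of i $ index_of k)
           * complex_of_real (C $ index_of k $ index_of j))"
    using ij by (simp add: Matrix.scalar_prod_def complex_mat_index atLeast0LessThan)
  also have "\<dots> = (\<Sum>k\<in>UNIV. complex_of_real (B $ index_of i $ k) * complex_of_real (C $ k $ index_of j))"
    by (rule sum_index_of [where f = "\<lambda>k. complex_of_real (B $ index_of i $ k) * complex_of_real (C $ k $ index_of j)"])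
  also have "\<dots> = complex_mat (B ** C) $$ (i, j)"
    using ij by (simp add: complex_mat_index matrix_matrix_mult_def)
  finally show "complex_mat (B ** C) $$ (i, j) = (complex_mat B * complex_mat C) $$ (i, j)" ..
qed auto

lemma complex_mat_mult_vec:
  assumes "v = Matrix.vec CARD('d) (\<lambda>i. u $ index_of i)"
  shows "complex_mat (B :: real^'d^'d) *\<^sub>v v
    = Matrix.vec CARD('d) (\<lambda>i. (map_matrix complex_of_real B *v u) $ index_of i)"
proof (rule eq_vecI)
  fix i assume "i < dim_vec (Matrix.vec CARD('d) (\<lambda>i. (map_matrix complex_of_real B *v u) $ index_of i))"
  then have i: "i < CARD('d)" by simp
  have "Matrix.vec_index (complex_mat B *\<^sub>v v) i
      = (\<Sum>k<CARD('d). complex_of_real (B $ index_of i $ index_of k) * u $ index_of k)"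
    using i by (simp add: assms Matrix.scalar_prod_def complex_mat_index atLeast0LessThan)
  also have "\<dots> = (\<Sum>k\<in>UNIV. complex_of_real (B $ index_of i $ k) * u $ k)"
    by (rule sum_index_of [where f = "\<lambda>k. complex_of_real (B $ index_of i $ k) * u $ k"])
  finally show "Matrix.vec_index (complex_mat B *\<^sub>v v) i
      = Matrix.vec_index (Matrix.vec CARD('d) (\<lambda>i. (map_matrix complex_of_real B *v u) $ index_of i)) i"
    using i by (simp add: matrix_vector_mult_def map_matrix_def)
qed simp

lemma eigenvalue_complex_mat:
  "eigenvalue (complex_mat (B :: real^'d^'d)) z \<longleftrightarrow> z \<in> complex_eigenvalues B"
proof
  assume "eigenvalue (complex_mat B) z"
  then obtain v where v: "v \<in> carrier_vec CARD('d)" "v \<noteq> 0\<^sub>v CARD('d)"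
      "complex_mat B *\<^sub>v v = z \<cdot>\<^sub>v v"
    by (auto simp: eigenvalue_def eigenvector_def)
  define u :: "complex^'d" where
    "u = (\<chi> a. Matrix.vec_index v (inv_into {0..<CARD('d)} index_of a))"
  have ui: "u $ index_of i = Matrix.vec_index v i" if "i < CARD('d)" for i
    using that bij_betw_inv_into_left [OF bij_index_of [where 'd = 'd], of i] by (simp add: u_def)
  have vu: "v = Matrix.vec CARD('d) (\<lambda>i. u $ index_of i)"
    using v(1) by (intro eq_vecI) (auto simp: ui)
  have "u \<noteq> 0"
    using v(1,2) by (auto simp: vu)
  moreover have "map_matrix complex_of_real B *v u = z *s u"
  proof -
    have "(map_matrix complex_of_real B *v u) $ a = (z *s u) $ a" for a
    proof -
      obtain i where i: "i < CARD('d)" "index_of i = a"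
        by (rule index_of_surj)
      have "Matrix.vec_index (complex_mat B *\<^sub>v v) i = Matrix.vec_index (z \<cdot>\<^sub>v v) i"
        by (simp add: v)
      then show ?thesis
        unfolding complex_mat_mult_vec [OF vu] using i v(1) by (simp add: ui [symmetric])
    qed
    then show ?thesis by (simp add: vec_eq_iff)
  qed
  ultimately show "z \<in> complex_eigenvalues B"
    by (auto simp: complex_eigenvalues_def)
next
  assume "z \<in> complex_eigenvalues B"
  then obtain u :: "complex^'d" where u: "u \<noteq> 0" "map_matrix complex_of_real B *v u = z *s u"
    by (auto simp: complex_eigenvalues_def)
  define v where "v = Matrix.vec CARD('d) (\<lambda>i. u $ index_of i)"
  have "v \<noteq> 0\<^sub>v CARD('d)"
  proof
    assume v0: "v = 0\<^sub>v CARD('d)"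
    have "u $ a = 0" for a
    proof -
      obtain i where i: "i < CARD('d)" "index_of i = a"
        by (rule index_of_surj)
      then have "u $ a = Matrix.vec_index v i" by (simp add: v_def)
      then show ?thesis using v0 i by simp
    qed
    with u show False by (simp add: vec_eq_iff)
  qed
  moreover have "complex_mat B *\<^sub>v v = z \<cdot>\<^sub>v v"
    unfolding complex_mat_mult_vec [OF v_def] u(2) by (auto simp: v_def)
  ultimately show "eigenvalue (complex_mat B) z"
    unfolding eigenvalue_def eigenvector_def by (intro exI [of _ v]) (simp add: v_def)
qed

lemma spectrum_complex_mat: "spectrum (complex_mat B) = complex_eigenvalues B"
  by (auto simp: spectrum_def eigenvalue_complex_mat)

lemma spectral_radius_complex_mat:
  "Spectral_Radius.spectral_radius (complex_mat B) = spectral_radius B"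
  by (simp add: Spectral_Radius.spectral_radius_def Defs.spectral_radius_def spectrum_complex_mat)

lemma eigenvalues_finite_nonempty:
  "finite (complex_eigenvalues (B :: real^'d^'d))" "complex_eigenvalues B \<noteq> {}"
  using card_finite_spectrum(1) [OF complex_mat_carrier, of B]
    spectrum_non_empty [OF complex_mat_carrier, of B]
  by (simp_all add: spectrum_complex_mat)

lemma spectral_radius_attained: "\<exists>z\<in>complex_eigenvalues B. cmod z = spectral_radius B"
proof -
  have "spectral_radius B \<in> cmod ` complex_eigenvalues B"
    unfolding Defs.spectral_radius_def using eigenvalues_finite_nonempty [of B] by (intro Max_in) auto
  then show ?thesis by auto
qed

lemma cmod_le_spectral_radius: "z \<in> complex_eigenvalues B \<Longrightarrow> cmod z \<le> spectral_radius B"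
  using eigenvalues_finite_nonempty [of B] by (auto simp: Defs.spectral_radius_def)

lemma spectral_radius_nonneg: "0 \<le> spectral_radius B"
  using spectral_radius_attained [of B] by (metis norm_ge_zero)

text \<open>The reason why similar matrices have equal traces.\<close>

lemma sum_diag_commute:
  fixes P Q :: "'a::comm_ring_1 mat"
  assumes "P \<in> carrier_mat n n" "Q \<in> carrier_mat n n"
  shows "(\<Sum>i<n. (P * Q) $$ (i, i)) = (\<Sum>i<n. (Q * P) $$ (i, i))"
proof -
  have "(\<Sum>i<n. (P * Q) $$ (i, i)) = (\<Sum>i<n. \<Sum>j<n. P $$ (i, j) * Q $$ (j, i))"
    using assms by (intro sum.cong) (auto simp: Matrix.scalar_prod_def atLeast0LessThan)
  also have "\<dots> = (\<Sum>j<n. \<Sum>i<n. Q $$ (j, i) * P $$ (i, j))"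
    by (subst sum.swap) (simp add: mult.commute)
  also have "\<dots> = (\<Sum>i<n. (Q * P) $$ (i, i))"
    using assms by (intro sum.cong) (auto simp: Matrix.scalar_prod_def atLeast0LessThan)
  finally show ?thesis .
qed

text \<open>Triangularize: the diagonal of an upper triangular matrix similar to \<open>B\<close> lists the eigenvalues,
  and its sum is the trace.\<close>

lemma trace_eigenvalues:
  fixes B :: "real^'d^'d"
  obtains ev :: "nat \<Rightarrow> complex" where
    "\<And>i. i < CARD('d) \<Longrightarrow> ev i \<in> complex_eigenvalues B"
    "complex_of_real (trace B) = (\<Sum>i<CARD('d). ev i)"
    "complex_eigenvalues B \<subseteq> ev ` {..<CARD('d)}"
proof -
  let ?n = "CARD('d)" and ?A = "complex_mat B"
  obtain es where es: "char_poly ?A = (\<Prod>a\<leftarrow>es. [:- a, 1:])"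
    using char_poly_factorized [OF complex_mat_carrier] by blast
  obtain T where T: "T \<in> carrier_mat ?n ?n" "upper_triangular T" "similar_mat ?A T"
    using schur_decomposition_exists [OF complex_mat_carrier es] by blast
  obtain P Q where PQ: "similar_mat_wit ?A T P Q"
    using T(3) by (auto simp: similar_mat_def)
  note w = similar_mat_witD2 [OF complex_mat_carrier PQ]
  have "complex_of_real (trace B) = (\<Sum>i<?n. ?A $$ (i, i))"
    using sum_index_of [where f = "\<lambda>a. complex_of_real (B $ a $ a)"]
    by (simp add: trace_def complex_mat_index)
  also have "\<dots> = (\<Sum>i<?n. (P * (T * Q)) $$ (i, i))"
    using w by (simp add: assoc_mult_mat [of P ?n ?n T ?n Q ?n])
  also have "\<dots> = (\<Sum>i<?n. ((T * Q) * P) $$ (i, i))"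
    using w by (intro sum_diag_commute) auto
  also have "(T * Q) * P = T"
    using w by (simp add: assoc_mult_mat [of T ?n ?n Q ?n P ?n])
  finally have tr: "complex_of_real (trace B) = (\<Sum>i<?n. T $$ (i, i))" .
  have "T $$ (i, i) \<in> complex_eigenvalues B" if "i < ?n" for i
  proof -
    have "T $$ (i, i) \<in> set (diag_mat T)"
      using that T(1) unfolding diag_mat_def by auto
    then have "poly (char_poly T) (T $$ (i, i)) = 0"
      unfolding char_poly_upper_triangular [OF T(1,2)] poly_prod_list prod_list_zero_iff
      by (force simp: image_iff)
    then have "eigenvalue ?A (T $$ (i, i))"
      by (simp add: eigenvalue_root_char_poly [OF complex_mat_carrier] char_poly_similar [OF T(3)])
    then show ?thesis by (simp add: eigenvalue_complex_mat)
  qed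
  moreover have "complex_eigenvalues B \<subseteq> (\<lambda>i. T $$ (i, i)) ` {..<?n}"
  proof
    fix z assume "z \<in> complex_eigenvalues B"
    then have "poly (char_poly T) z = 0"
      by (simp add: eigenvalue_complex_mat [symmetric] eigenvalue_root_char_poly [OF complex_mat_carrier]
          char_poly_similar [OF T(3)])
    then have "z \<in> set (diag_mat T)"
      unfolding char_poly_upper_triangular [OF T(1,2)] poly_prod_list prod_list_zero_iff
      by (auto simp: image_iff)
    then show "z \<in> (\<lambda>i. T $$ (i, i)) ` {..<?n}"
      using T(1) by (auto simp: diag_mat_def)
  qed
  ultimately show thesis using tr by (intro that) auto
qed

lemma abs_trace_le: "\<bar>trace (B :: real^'d^'d)\<bar> \<le> real CARD('d) * spectral_radius B"
proof -
  obtain ev :: "nat \<Rightarrow> complex" where l: "\<And>i. i < CARD('d) \<Longrightarrow> ev i \<in> complex_eigenvalues B"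
    "complex_of_real (trace B) = (\<Sum>i<CARD('d). ev i)"
    using trace_eigenvalues by blast
  have "\<bar>trace B\<bar> = cmod (\<Sum>i<CARD('d). ev i)"
    using l(2) by (metis norm_of_real real_norm_def)
  also have "\<dots> \<le> (\<Sum>i<CARD('d). spectral_radius B)"
    using l(1) by (intro sum_norm_le) (auto simp: cmod_le_spectral_radius)
  finally show ?thesis by simp
qed

text \<open>The recursion multiplies on the right, as does the power of numbered matrices.\<close>

primrec matrix_power :: "real^'d^'d \<Rightarrow> nat \<Rightarrow> real^'d^'d" where
  "matrix_power B 0 = mat 1"
| "matrix_power B (Suc n) = matrix_power B n ** B"

lemma matrix_norm_nonneg: "0 \<le> matrix_norm B"
  unfolding matrix_norm_def by (rule onorm_pos_le) (rule matrix_vector_mul_bounded_linear)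

lemma matrix_norm_eq_0_iff: "matrix_norm B = 0 \<longleftrightarrow> B = 0"
  unfolding matrix_norm_def onorm_eq_0 [OF matrix_vector_mul_bounded_linear]
  by (auto simp: matrix_eq)

lemma matrix_norm_mult_le: "matrix_norm (B ** C) \<le> matrix_norm B * matrix_norm C"
proof -
  have "(\<lambda>v. (B ** C) *v v) = (\<lambda>v. B *v v) \<circ> (\<lambda>v. C *v v)"
    by (auto simp: matrix_vector_mul_assoc)
  then show ?thesis
    unfolding matrix_norm_def using onorm_compose [of "\<lambda>v. B *v v" "\<lambda>v. C *v v"]
    by (simp add: matrix_vector_mul_bounded_linear)
qed

lemma norm_mult_le_matrix_norm: "norm (B *v v) \<le> matrix_norm B * norm v"
  unfolding matrix_norm_def by (rule onorm) (rule matrix_vector_mul_bounded_linear)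

lemma matrix_norm_le_entries:
  assumes "\<And>i j. \<bar>B $ i $ j\<bar> \<le> c"
  shows "matrix_norm (B :: real^'d^'d) \<le> real CARD('d) * real CARD('d) * c"
  unfolding matrix_norm_def by (rule onorm_le_matrix_component [OF assms])

lemma matrix_norm_mat1: "matrix_norm (mat 1 :: real^'d^'d) = 1"
  by (simp add: matrix_norm_def onorm_id [unfolded id_def])

lemma complex_mat_power: "complex_mat (matrix_power B n) = complex_mat B ^\<^sub>m n"
proof (induction n)
  case 0
  have "complex_mat (mat 1 :: real^'d^'d) = 1\<^sub>m CARD('d)"
  proof (rule eq_matI)
    fix i j assume "i < dim_row (1\<^sub>m CARD('d) :: complex mat)" "j < dim_col (1\<^sub>m CARD('d) :: complex mat)"
    then have ij: "i < CARD('d)" "j < CARD('d)" by auto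
    then have "(index_of i :: 'd) = index_of j \<longleftrightarrow> i = j"
      using bij_index_of [where 'd = 'd] by (auto simp: bij_betw_def inj_on_def)
    then show "complex_mat (mat 1 :: real^'d^'d) $$ (i, j) = 1\<^sub>m CARD('d) $$ (i, j)"
      using ij by (simp add: complex_mat_index mat_def)
  qed auto
  then show ?case by simp
qed (simp add: complex_mat_mult)

text \<open>The factor \<open>2\<close> is the price for a real norm: a complex eigenvector is split into its real and imaginary
  parts, neither of which is longer than the vector.\<close>

lemma spectral_radius_power_le:
  fixes B :: "real^'d^'d"
  shows "spectral_radius B ^ n \<le> 2 * matrix_norm (matrix_power B n)"
proof -
  let ?C = "map_matrix complex_of_real"
  have mult: "?C (X ** Y) = ?C X ** ?C Y" for X Y :: "real^'d^'d"
    by (simp add: vec_eq_iff map_matrix_def matrix_matrix_mult_def)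
  obtain z where z: "z \<in> complex_eigenvalues B" "cmod z = spectral_radius B"
    using spectral_radius_attained by blast
  then obtain v :: "complex^'d" where v: "v \<noteq> 0" "?C B *v v = z *s v"
    by (auto simp: complex_eigenvalues_def)
  have pow: "?C (matrix_power B n) *v v = z ^ n *s v" for n
  proof (induction n)
    case 0
    have "?C (mat 1) = (mat 1 :: complex^'d^'d)"
      by (simp add: map_matrix_def mat_def if_distrib cong: if_cong)
    then show ?case by simp
  next
    case (Suc n)
    have "?C (matrix_power B (Suc n)) *v v = ?C (matrix_power B n) *v (z *s v)"
      by (simp add: mult matrix_vector_mul_assoc [symmetric] v)
    also have "\<dots> = z *s (?C (matrix_power B n) *v v)"
      by (simp add: vec_eq_iff matrix_vector_mult_def vector_scalar_mult_def sum_distrib_left mult_ac)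
    finally show ?case by (simp add: Suc)
  qed
  define x :: "real^'d" where "x = (\<chi> a. Re (v $ a))"
  define y :: "real^'d" where "y = (\<chi> a. Im (v $ a))"
  have re: "Re ((?C X *v v) $ a) = (X *v x) $ a" and im: "Im ((?C X *v v) $ a) = (X *v y) $ a"
    for X :: "real^'d^'d" and a
    by (simp_all add: matrix_vector_mult_def map_matrix_def x_def y_def)
  have norm_x: "norm x \<le> norm v"
    unfolding norm_vec_def by (intro L2_set_mono) (auto simp: x_def abs_Re_le_cmod)
  have norm_y: "norm y \<le> norm v"
    unfolding norm_vec_def by (intro L2_set_mono) (auto simp: y_def abs_Im_le_cmod)
  let ?X = "matrix_power B n"
  have "cmod z ^ n * norm v = norm (?C ?X *v v)"
    by (simp add: pow norm_vec_def norm_mult norm_power L2_set_right_distrib)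
  also have "\<dots> \<le> norm (?X *v x) + norm (?X *v y)"
  proof -
    have "norm (?C ?X *v v) \<le> L2_set (\<lambda>a. \<bar>(?X *v x) $ a\<bar> + \<bar>(?X *v y) $ a\<bar>) UNIV"
      unfolding norm_vec_def
      by (intro L2_set_mono norm_ge_zero) (metis cmod_le re im)
    also have "\<dots> \<le> L2_set (\<lambda>a. \<bar>(?X *v x) $ a\<bar>) UNIV + L2_set (\<lambda>a. \<bar>(?X *v y) $ a\<bar>) UNIV"
      by (rule L2_set_triangle_ineq)
    finally show ?thesis by (simp add: norm_vec_def)
  qed
  also have "\<dots> \<le> matrix_norm ?X * norm x + matrix_norm ?X * norm y"
    by (intro add_mono norm_mult_le_matrix_norm)
  also have "\<dots> \<le> matrix_norm ?X * norm v + matrix_norm ?X * norm v"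
    by (intro add_mono mult_left_mono norm_x norm_y matrix_norm_nonneg)
  finally have "cmod z ^ n * norm v \<le> (2 * matrix_norm ?X) * norm v" by (simp add: algebra_simps)
  then show ?thesis using v z by (simp add: mult_le_cancel_right)
qed

lemma matrix_power_scaleR: "matrix_power (c *\<^sub>R B) n = c ^ n *\<^sub>R matrix_power B n"
  by (induction n) (simp_all add: scalar_matrix_assoc matrix_scalar_ac)

lemma complex_eigenvalues_scaleR:
  assumes "c \<noteq> 0"
  shows "complex_eigenvalues (c *\<^sub>R (B :: real^'d^'d)) = (\<lambda>z. complex_of_real c * z) ` complex_eigenvalues B"
proof -
  have *: "map_matrix complex_of_real (c *\<^sub>R B) *v v = complex_of_real c *s (map_matrix complex_of_real B *v v)" for v c and B :: "real^'d^'d"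
    by (simp add: vec_eq_iff matrix_vector_mult_def map_matrix_def vector_scalar_mult_def sum_distrib_left mult_ac)
  have sub: "complex_of_real c * z \<in> complex_eigenvalues (c *\<^sub>R B)" if "z \<in> complex_eigenvalues B" for z c and B :: "real^'d^'d"
    using that unfolding complex_eigenvalues_def by (auto simp: * vector_smult_assoc)
  show ?thesis
  proof (intro equalityI subsetI)
    fix z assume "z \<in> complex_eigenvalues (c *\<^sub>R B)"
    then have "complex_of_real (inverse c) * z \<in> complex_eigenvalues (inverse c *\<^sub>R (c *\<^sub>R B))" by (rule sub)
    then show "z \<in> (\<lambda>z. complex_of_real c * z) ` complex_eigenvalues B"
      using assms by (intro image_eqI [of _ _ "complex_of_real (inverse c) * z"]) auto
  qed (auto intro: sub)
qed

lemma spectral_radius_scaleR: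
  assumes "c > 0"
  shows "spectral_radius (c *\<^sub>R B) = c * spectral_radius B"
proof -
  have "spectral_radius (c *\<^sub>R B) = Max ((\<lambda>r. c * r) ` cmod ` complex_eigenvalues B)"
    using assms unfolding Defs.spectral_radius_def complex_eigenvalues_scaleR [OF less_imp_neq [OF assms, symmetric]]
    by (simp add: image_image norm_mult)
  also have "\<dots> = c * Max (cmod ` complex_eigenvalues B)"
    using assms eigenvalues_finite_nonempty [of B]
    by (intro mono_Max_commute [symmetric]) (auto intro!: monoI)
  finally show ?thesis by (simp add: Defs.spectral_radius_def)
qed

text \<open>The upper half of the spectral radius formula. After scaling by \<open>1/r\<close> the spectral radius is below \<open>1\<close>,
  and the entries of the powers stay bounded.\<close>

lemma matrix_power_norm_le:
  fixes B :: "real^'d^'d"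
  assumes "spectral_radius B < r"
  shows "\<exists>C>0. \<forall>n. matrix_norm (matrix_power B n) \<le> C * r ^ n"
proof -
  have r: "r > 0" using assms spectral_radius_nonneg [of B] by linarith
  let ?B = "inverse r *\<^sub>R B"
  have "Spectral_Radius.spectral_radius (complex_mat ?B) < 1"
    using assms r by (simp add: spectral_radius_complex_mat spectral_radius_scaleR field_simps)
  then obtain c where c: "\<And>k. norm_bound (complex_mat ?B ^\<^sub>m k) c"
    using spectral_radius_jnf_norm_bound_less_1_upper_triangular [OF complex_mat_carrier] by blast
  have ent: "\<bar>matrix_power ?B k $ a $ b\<bar> \<le> c" for k a b
  proof -
    obtain i where i: "i < CARD('d)" "index_of i = a"
      by (rule index_of_surj)
    obtain j where j: "j < CARD('d)" "index_of j = b"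
      by (rule index_of_surj)
    have "norm (complex_mat (matrix_power ?B k) $$ (i, j)) \<le> c"
      using c [of k] i j unfolding norm_bound_def complex_mat_power [symmetric] by auto
    then show ?thesis using i j by (simp add: complex_mat_index)
  qed
  define C where "C = real CARD('d) * real CARD('d) * c + 1"
  have bnd: "matrix_norm (matrix_power ?B k) \<le> C" for k
    using matrix_norm_le_entries [of "matrix_power ?B k" c] ent by (force simp: C_def)
  have C: "C > 0" using bnd [of 0] by (simp add: matrix_norm_mat1)
  have "matrix_norm (matrix_power B n) \<le> C * r ^ n" for n
  proof -
    have "matrix_norm (matrix_power ?B n) = inverse r ^ n * matrix_norm (matrix_power B n)"
      using r onorm_scaleR [OF matrix_vector_mul_bounded_linear, of "inverse r ^ n" "matrix_power B n"]
      by (simp add: matrix_power_scaleR matrix_norm_def scaleR_matrix_vector_assoc)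
    then have "matrix_norm (matrix_power B n) = r ^ n * matrix_norm (matrix_power ?B n)"
      using r by (simp add: field_simps power_inverse)
    also have "\<dots> \<le> r ^ n * C"
      using r bnd by (intro mult_left_mono) auto
    finally show ?thesis by (simp add: mult.commute)
  qed
  with C show ?thesis by blast
qed

section \<open>The trace form of an irreducible matrix semigroup\<close>

lemma matrix_mult_add_left: "(X + Y) ** B = X ** B + Y ** (B :: real^'d^'d)"
  and matrix_mult_add_right: "B ** (X + Y) = B ** X + B ** (Y :: real^'d^'d)"
  by (simp_all add: vec_eq_iff matrix_matrix_mult_def distrib_left distrib_right sum.distrib)

lemma matrix_mult_scaleR_left: "(c *\<^sub>R X) ** B = c *\<^sub>R (X ** (B :: real^'d^'d))"
  and matrix_mult_scaleR_right: "B ** (c *\<^sub>R X) = c *\<^sub>R (B ** (X :: real^'d^'d))"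
  by (simp_all add: vec_eq_iff matrix_matrix_mult_def sum_distrib_left mult_ac)

lemma matrix_vector_mult_scaleR_right: "B *v (c *\<^sub>R v) = c *\<^sub>R (B *v (v :: real^'d))"
  by (simp add: vec_eq_iff matrix_vector_mult_def sum_distrib_left mult_ac)

lemma trace_scaleR: "trace (c *\<^sub>R B) = c * trace (B :: real^'d^'d)"
  by (simp add: trace_def sum_distrib_left)

text \<open>The eigenvalues of an idempotent are \<open>0\<close> or \<open>1\<close>, so a vanishing trace leaves only the eigenvalue \<open>0\<close>. Then
  the powers of \<open>E\<close>, all equal to \<open>E\<close>, tend to \<open>0\<close>.\<close>

lemma idempotent_trace_eq_0:
  fixes E :: "real^'d^'d"
  assumes idem: "E ** E = E" and tr: "trace E = 0"
  shows "E = 0"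
proof -
  have ev: "z = 0 \<or> z = 1" if z: "z \<in> complex_eigenvalues E" for z
  proof -
    let ?C = "map_matrix complex_of_real"
    obtain v :: "complex^'d" where v: "v \<noteq> 0" "?C E *v v = z *s v"
      using z by (auto simp: complex_eigenvalues_def)
    have "?C E ** ?C E = ?C (E ** E)"
      by (simp add: vec_eq_iff map_matrix_def matrix_matrix_mult_def)
    then have "?C E *v (?C E *v v) = ?C E *v v"
      by (simp add: matrix_vector_mul_assoc idem)
    moreover have "?C E *v (z *s v) = z *s (?C E *v v)"
      by (simp add: vec_eq_iff matrix_vector_mult_def vector_scalar_mult_def sum_distrib_left mult_ac)
    ultimately have "z *s (z *s v) = z *s v"
      by (simp add: v)
    then have "z * z * v $ a = z * v $ a" for a
      by (metis mult.assoc vector_smult_component)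
    moreover obtain a where "v $ a \<noteq> 0" using v(1) by (auto simp: vec_eq_iff)
    ultimately show ?thesis by (metis mult_cancel_right mult_cancel_right1)
  qed
  obtain e :: "nat \<Rightarrow> complex" where e: "\<And>i. i < CARD('d) \<Longrightarrow> e i \<in> complex_eigenvalues E"
    "complex_of_real (trace E) = (\<Sum>i<CARD('d). e i)" "complex_eigenvalues E \<subseteq> e ` {..<CARD('d)}"
    using trace_eigenvalues by blast
  have "(\<Sum>i<CARD('d). Re (e i)) = 0"
    using e(2) tr by (metis Re_sum of_real_0 zero_complex.sel(1))
  moreover have "Re (e i) \<ge> 0" if "i < CARD('d)" for i
    using ev [OF e(1) [OF that]] by auto
  ultimately have "Re (e i) = 0" if "i < CARD('d)" for i
    using that by (subst (asm) sum_nonneg_eq_0_iff) auto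
  then have "z = 0" if "z \<in> complex_eigenvalues E" for z
    using that e(3) ev by force
  then have "spectral_radius E = 0"
    using spectral_radius_attained [of E] by force
  then obtain C where C: "\<And>n. matrix_norm (matrix_power E n) \<le> C * (1/2) ^ n"
    using matrix_power_norm_le [of E "1/2"] by auto
  have pow: "matrix_power E (Suc n) = E" for n
    by (induction n) (simp_all add: idem)
  have "(\<lambda>n. C * (1/2) ^ Suc n) \<longlonglongrightarrow> C * 0"
    by (intro tendsto_mult tendsto_const LIMSEQ_Suc LIMSEQ_power_zero) auto
  then have "matrix_norm E \<le> C * 0"
    by (rule LIMSEQ_le_const) (use C [of "Suc _"] in \<open>auto simp only: pow\<close>)
  then show ?thesis
    using matrix_norm_nonneg [of E] matrix_norm_eq_0_iff [of E] by simp
qed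

lemma irreducible_invariant_subspace:
  assumes "irreducible_tuple M A" "subspace U" "\<And>i u. i \<in> {1..M} \<Longrightarrow> u \<in> U \<Longrightarrow> A i *v u \<in> U"
    and "u \<in> U" "u \<noteq> 0"
  shows "U = (UNIV :: (real^'d) set)"
proof -
  have "dim U > 0"
    using assms(4,5) by (metis dim_eq_0 gr0I singletonD subsetD)
  moreover have "\<forall>i\<in>{1..M}. (\<lambda>v. A i *v v) ` U \<subseteq> U"
    using assms(3) by auto
  ultimately have "\<not> dim U < CARD('d)"
    using assms(1,2) unfolding irreducible_tuple_def by blast
  moreover have "dim U \<le> CARD('d)"
    using dim_subset_UNIV [of U] by simp
  ultimately have "dim U = DIM(real^'d)" by simp
  then have "span U = UNIV" by (simp only: dim_eq_full)
  then show ?thesis using assms(2) real_vector.span_eq_iff [of U] by simp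
qed

text \<open>The common kernel of the matrices is an invariant subspace.\<close>

lemma irreducible_common_kernel:
  assumes "irreducible_tuple M A" "i \<in> {1..M}" "A i \<noteq> 0" "u \<noteq> (0 :: real^'d)"
  obtains j where "j \<in> {1..M}" "A j *v u \<noteq> 0"
proof -
  have "\<not> (\<forall>j\<in>{1..M}. A j *v u = 0)"
  proof
    assume 0: "\<forall>j\<in>{1..M}. A j *v u = 0"
    have "{v. \<forall>j\<in>{1..M}. A j *v v = 0} = UNIV"
      using 0 assms(4) by (intro irreducible_invariant_subspace [OF assms(1), where u = u])
        (auto simp: subspace_def matrix_vector_right_distrib matrix_vector_mult_scaleR_right)
    then have "v \<in> {v. \<forall>j\<in>{1..M}. A j *v v = 0}" for v by (metis UNIV_I)
    then have "A i *v v = 0" for v using assms(2) by blast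
    then have "A i = 0" by (intro matrix_eq [THEN iffD2]) simp
    then show False using assms(3) by simp
  qed
  then show thesis using that by blast
qed

text \<open>The vectors \<open>Y u\<close> with \<open>Y\<close> in \<open>V\<close> form a nonzero invariant subspace, hence the whole space.\<close>

lemma matrix_vector_mult_span_transitive:
  fixes V :: "(real^'d^'d) set"
  assumes irr: "irreducible_tuple M A" and V: "subspace V"
    and closed: "\<And>i X. i \<in> {1..M} \<Longrightarrow> X \<in> V \<Longrightarrow> A i ** X \<in> V"
    and X: "X \<in> V" "X *v u \<noteq> 0"
  shows "\<exists>Y\<in>V. Y *v u = v"
proof -
  have "(\<lambda>Y. Y *v u) ` V = UNIV"
  proof (rule irreducible_invariant_subspace [OF irr _ _ _ X(2)])
    have "linear (\<lambda>Y. Y *v u)"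
      by (intro linearI) (simp_all add: matrix_vector_mult_add_rdistrib scaleR_matrix_vector_assoc)
    then show "subspace ((\<lambda>Y. Y *v u) ` V)"
      using V by (rule linear_subspace_image)
    fix i w assume "i \<in> {1..M}" "w \<in> (\<lambda>Y. Y *v u) ` V"
    then show "A i *v w \<in> (\<lambda>Y. Y *v u) ` V"
      using closed by (auto simp: matrix_vector_mul_assoc)
  qed (use X in auto)
  then show ?thesis by (metis UNIV_I imageE)
qed

lemma matrix_mult_span_closed:
  fixes S :: "(real^'d^'d) set"
  assumes S: "\<And>X Y. X \<in> S \<Longrightarrow> Y \<in> S \<Longrightarrow> X ** Y \<in> S" and "X \<in> span S" "Y \<in> span S"
  shows "X ** Y \<in> span S"
proof -
  have 1: "X ** Y \<in> span S" if "X \<in> S" for X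
    using assms(3)
  proof (induction rule: span_induct_alt)
    case (step c x y)
    then show ?case using S that
      by (simp add: matrix_mult_add_right matrix_mult_scaleR_right span_add span_scale span_base)
  qed (simp add: span_zero)
  show ?thesis
    using assms(2)
  proof (induction rule: span_induct_alt)
    case (step c x y)
    then show ?case using 1
      by (simp add: matrix_mult_add_left matrix_mult_scaleR_left span_add span_scale)
  qed (simp add: span_zero)
qed

lemma linear_matrix_mult_left:
  fixes B :: "real^'d^'d"
  shows "linear (\<lambda>X :: real^'d^'d. X ** B)"
  by (intro linearI) (simp_all only: matrix_mult_add_left matrix_mult_scaleR_left)

text \<open>If \<open>B\<close> is orthogonal to the algebra \<open>V\<close> under the trace form, then all elements of the left ideal \<open>V B\<close>
  have trace zero. A nonzero left ideal, however, contains a nonzero idempotent: it can be built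
  from an element whose kernel has the largest dimension. This contradicts
  \<open>idempotent_trace_eq_0\<close>.\<close>

lemma trace_form_nondegenerate:
  fixes M :: nat and A :: "nat \<Rightarrow> real^'d^'d"
  defines "V \<equiv> span (matrix_semigroup M A)"
  assumes irr: "irreducible_tuple M A" and nz: "i \<in> {1..M}" "A i \<noteq> 0"
    and "B \<in> V" and tr: "\<And>X. X \<in> V \<Longrightarrow> trace (X ** B) = 0"
  shows "B = 0"
proof (rule ccontr)
  assume "B \<noteq> 0"
  have gen: "A j \<in> V" if "j \<in> {1..M}" for j
    using that by (simp add: V_def span_base matrix_semigroup.generator)
  have mult: "X ** Y \<in> V" if "X \<in> V" "Y \<in> V" for X Y
    using that unfolding V_def by (intro matrix_mult_span_closed) (auto intro: matrix_semigroup.product)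
  have trans: "\<exists>Y\<in>V. Y *v u = v" if u: "u \<noteq> 0" for u v
  proof -
    obtain j where "j \<in> {1..M}" "A j *v u \<noteq> 0"
      by (rule irreducible_common_kernel [OF irr nz u])
    then show ?thesis
      using gen mult by (intro matrix_vector_mult_span_transitive [OF irr, where X = "A j"])
        (auto simp: V_def)
  qed
  define L where "L = (\<lambda>X. X ** B) ` V"
  have L: "subspace L"
    unfolding L_def V_def by (intro linear_subspace_image linear_matrix_mult_left) simp
  have LV: "X ** T \<in> L" if "X \<in> V" "T \<in> L" for X T
    using that mult by (auto simp: L_def matrix_mul_assoc)
  have L_sub: "T \<in> V" if "T \<in> L" for T
    using that mult \<open>B \<in> V\<close> by (auto simp: L_def)
  obtain v where v: "B *v v \<noteq> 0" using \<open>B \<noteq> 0\<close> by (auto simp: matrix_eq)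
  obtain X where X: "X \<in> V" "X *v (B *v v) = B *v v" using trans [OF v] by blast
  have XB: "X ** B \<in> L \<and> X ** B \<noteq> 0"
    using X v by (auto simp: L_def matrix_vector_mul_assoc)
  define k where "k T = dim {v. T *v v = 0}" for T :: "real^'d^'d"
  have "\<exists>T. (T \<in> L \<and> T \<noteq> 0) \<and> (\<forall>R. (R \<in> L \<and> R \<noteq> 0) \<longrightarrow> k R \<le> k T)"
  proof (rule ex_has_greatest_nat [where k = "X ** B" and b = "Suc CARD('d)"])
    show "\<forall>R. R \<in> L \<and> R \<noteq> 0 \<longrightarrow> k R < Suc CARD('d)"
      using dim_subset_UNIV [where 'a = "real^'d"] by (auto simp: k_def less_Suc_eq_le)
  qed (rule XB)
  then obtain T where T: "T \<in> L" "T \<noteq> 0" and max: "\<And>R. R \<in> L \<Longrightarrow> R \<noteq> 0 \<Longrightarrow> k R \<le> k T"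
    by blast
  obtain v where v: "T *v v \<noteq> 0" using \<open>T \<noteq> 0\<close> by (auto simp: matrix_eq)
  obtain X where X: "X \<in> V" "X *v (T *v v) = v" using trans [OF v] by blast
  define E where "E = X ** T"
  have E: "E \<in> L" "E *v v = v"
    using X T LV by (auto simp: E_def matrix_vector_mul_assoc)
  \<comment> \<open>The matrix \<open>E - E E\<close> is a left multiple of \<open>T\<close>, and it kills \<open>v\<close>, which \<open>T\<close> does not. By
    maximality of the kernel it must be zero, so \<open>E\<close> is idempotent.\<close>
  have "E - E ** E \<in> L"
    using E L L_sub LV by (intro subspace_diff) auto
  moreover have "k T < k (E - E ** E)"
  proof -
    have sub: "{v. T *v v = 0} \<subseteq> {v. (E - E ** E) *v v = 0}"
      by (auto simp: matrix_vector_mult_diff_rdistrib matrix_vector_mul_assoc [symmetric] E_def)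
    have subsp: "subspace {v. R *v v = 0}" for R :: "real^'d^'d"
      by (auto simp: subspace_def matrix_vector_right_distrib matrix_vector_mult_scaleR_right)
    have "v \<in> {v. (E - E ** E) *v v = 0}"
      by (simp add: matrix_vector_mult_diff_rdistrib matrix_vector_mul_assoc [symmetric] E)
    with sub v have "{v. T *v v = 0} \<subset> {v. (E - E ** E) *v v = 0}" by blast
    then show ?thesis
      unfolding k_def using subsp by (intro dim_psubset) (simp add: real_vector.span_eq_iff [THEN iffD2])
  qed
  ultimately have "E - E ** E = 0" using max not_less by blast
  then have "E ** E = E" by simp
  moreover have "trace E = 0" using E(1) tr by (auto simp: L_def)
  ultimately have "E = 0" by (rule idempotent_trace_eq_0)
  with E(2) v show False by simp
qed

lemma matrix_norm_le_norm: "matrix_norm (B :: real^'d^'d) \<le> real CARD('d) * real CARD('d) * norm B"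
proof (rule matrix_norm_le_entries)
  fix i j
  have "\<bar>B $ i $ j\<bar> \<le> norm (B $ i)" by (rule component_le_norm_cart)
  also have "\<dots> \<le> norm B" by (rule Finite_Cartesian_Product.norm_nth_le)
  finally show "\<bar>B $ i $ j\<bar> \<le> norm B" .
qed

text \<open>The traces \<open>tr(X B)\<close>, for \<open>X\<close> in a basis of the span of the semigroup chosen inside the semigroup, separate the
  elements \<open>B\<close> of the span, so the sum of their absolute values dominates a multiple of the norm. On the semigroup itself
  each of them is at most \<open>d \<rho>(X) \<rho>(B)\<close>.\<close>

lemma matrix_norm_le_spectral_radius:
  fixes A :: "nat \<Rightarrow> real^'d^'d"
  assumes irr: "irreducible_tuple M A" and nz: "i \<in> {1..M}" "A i \<noteq> 0"
    and mult: "\<And>B C. B \<in> matrix_semigroup M A \<Longrightarrow> C \<in> matrix_semigroup M A \<Longrightarrow>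
       spectral_radius (B ** C) = spectral_radius B * spectral_radius C"
  shows "\<exists>K>0. \<forall>B\<in>matrix_semigroup M A. matrix_norm B \<le> K * spectral_radius B"
proof -
  let ?S = "matrix_semigroup M A"
  obtain F where F: "F \<subseteq> ?S" "independent F" "?S \<subseteq> span F"
    using maximal_independent_subset by blast
  have finF: "finite F" using F(2) by (rule independent_imp_finite)
  have spanF: "span F = span ?S"
    by (metis F(1) F(3) span_mono span_span subset_antisym)
  define g where "g B = (\<Sum>X\<in>F. \<bar>trace (X ** B)\<bar>)" for B
  have g_pos: "g B > 0" if "B \<in> span ?S" "B \<noteq> 0" for B
  proof -
    have "g B \<noteq> 0"
    proof
      assume "g B = 0"
      then have 0: "trace (X ** B) = 0" if "X \<in> F" for X
        using that finF by (auto simp: g_def sum_nonneg_eq_0_iff)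
      have "trace (X ** B) = 0" if "X \<in> span F" for X
        using that
        by (induction rule: span_induct_alt)
          (auto simp: matrix_mult_add_left matrix_mult_scaleR_left trace_add trace_scaleR 0 trace_0 [unfolded mat_0])
      then have "B = 0"
        using that(1) unfolding spanF by (intro trace_form_nondegenerate [OF irr nz]) auto
      with that show False by simp
    qed
    moreover have "g B \<ge> 0" by (auto simp: g_def intro: sum_nonneg)
    ultimately show ?thesis by simp
  qed
  obtain d where d: "d > 0" "\<And>B. B \<in> span ?S \<Longrightarrow> d * norm B \<le> g B"
  proof -
    let ?U = "sphere 0 1 \<inter> span ?S"
    have cont: "continuous_on ?U g"
      unfolding g_def trace_def matrix_matrix_mult_def
      by (auto intro!: continuous_intros)
    have comp: "compact ?U"
      by (intro compact_Int_closed closed_span) auto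
    have "A i \<in> span ?S" using nz by (intro span_base matrix_semigroup.generator) auto
    then have "inverse (norm (A i)) *\<^sub>R A i \<in> ?U"
      using nz by (simp add: span_scale)
    then have "?U \<noteq> {}" by blast
    then obtain B0 where B0: "B0 \<in> ?U" "\<And>B. B \<in> ?U \<Longrightarrow> g B0 \<le> g B"
      using continuous_attains_inf [OF comp _ cont] by blast
    show thesis
    proof (rule that)
      show "g B0 > 0" using B0(1) by (intro g_pos) auto
      fix B assume B: "B \<in> span ?S"
      show "g B0 * norm B \<le> g B"
      proof (cases "B = 0")
        case False
        have "g B0 \<le> g (inverse (norm B) *\<^sub>R B)"
          using B False by (intro B0) (simp add: span_scale)
        also have "\<dots> = inverse (norm B) * g B"
          by (simp add: g_def matrix_mult_scaleR_right trace_scaleR abs_mult sum_distrib_left)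
        finally show ?thesis using False by (simp add: field_simps)
      qed (auto simp: g_def intro: sum_nonneg)
    qed
  qed
  define c where "c = real CARD('d)"
  have c: "c > 0" by (simp add: c_def)
  define K where "K = c * c * (c * (\<Sum>X\<in>F. spectral_radius X) / d) + 1"
  have "matrix_norm B \<le> K * spectral_radius B" if B: "B \<in> ?S" for B
  proof -
    have "d * norm B \<le> g B" using B by (intro d span_base)
    also have "\<dots> \<le> (\<Sum>X\<in>F. c * spectral_radius (X ** B))"
      unfolding g_def c_def by (intro sum_mono abs_trace_le)
    also have "\<dots> = c * (\<Sum>X\<in>F. spectral_radius X) * spectral_radius B"
      using F(1) B by (auto simp: mult sum_distrib_left sum_distrib_right mult.assoc intro!: sum.cong)
    finally have *: "norm B \<le> c * (\<Sum>X\<in>F. spectral_radius X) / d * spectral_radius B"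
      using d(1) by (simp add: field_simps)
    have "matrix_norm B \<le> c * c * norm B" unfolding c_def by (rule matrix_norm_le_norm)
    also have "\<dots> \<le> c * c * (c * (\<Sum>X\<in>F. spectral_radius X) / d * spectral_radius B)"
      using c by (intro mult_left_mono *) auto
    also have "\<dots> \<le> K * spectral_radius B"
      using spectral_radius_nonneg [of B] by (simp add: K_def algebra_simps)
    finally show ?thesis .
  qed
  moreover have "K > 0"
    unfolding K_def using c d(1) by (intro add_nonneg_pos mult_nonneg_nonneg divide_nonneg_pos sum_nonneg)
      (auto simp: spectral_radius_nonneg)
  ultimately show ?thesis by blast
qed

section \<open>Words and stationary weights\<close>

definition words :: "'a set \<Rightarrow> nat \<Rightarrow> 'a list set" where
  "words S n = {w. set w \<subseteq> S \<and> length w = n}"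

lemma finite_words: "finite S \<Longrightarrow> finite (words S n)"
  unfolding words_def by (rule finite_lists_length_eq)

lemma words_0 [simp]: "words S 0 = {[]}"
  by (auto simp: words_def)

lemma words_append: "u \<in> words S m \<Longrightarrow> v \<in> words S n \<Longrightarrow> u @ v \<in> words S (m + n)"
  by (auto simp: words_def)

lemma sum_words_append:
  assumes "finite S"
  shows "(\<Sum>w\<in>words S (m + n). F w) = (\<Sum>u\<in>words S m. \<Sum>v\<in>words S n. F (u @ v))"
proof -
  have "(\<Sum>u\<in>words S m. \<Sum>v\<in>words S n. F (u @ v)) = (\<Sum>(u, v)\<in>words S m \<times> words S n. F (u @ v))"
    by (rule sum.cartesian_product)
  also have "\<dots> = (\<Sum>w\<in>words S (m + n). F w)"
    by (rule sum.reindex_bij_witness [of _ "\<lambda>w. (take m w, drop m w)" "\<lambda>(u, v). u @ v"])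
      (auto simp: words_def dest: in_set_takeD in_set_dropD)
  finally show ?thesis ..
qed

lemma sum_words_1: "(\<Sum>w\<in>words S (Suc 0). F w) = (\<Sum>i\<in>S. F [i])"
  by (rule sum.reindex_bij_witness [of _ "\<lambda>i. [i]" hd]) (auto simp: words_def length_Suc_conv)

lemma sum_words_Suc:
  assumes "finite S"
  shows "(\<Sum>w\<in>words S (Suc n). F w) = (\<Sum>i\<in>S. \<Sum>v\<in>words S n. F (i # v))"
  using sum_words_append [OF assms, of F "Suc 0" n] by (simp add: sum_words_1)

lemma sum_words_Suc_right:
  assumes "finite S"
  shows "(\<Sum>w\<in>words S (Suc n). F w) = (\<Sum>u\<in>words S n. \<Sum>i\<in>S. F (u @ [i]))"
  using sum_words_append [OF assms, of F n "Suc 0"] by (simp add: sum_words_1)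

text \<open>Cylinder weights of shift-invariant probability measures have these properties: the first sum runs over
  the symbol that follows \<open>w\<close> and expresses additivity, the second over the symbol that precedes it and
  expresses invariance.\<close>

definition stationary :: "'a set \<Rightarrow> ('a list \<Rightarrow> real) \<Rightarrow> bool" where
  "stationary S f \<longleftrightarrow> f [] = 1 \<and> (\<forall>w. set w \<subseteq> S \<longrightarrow> 0 \<le> f w \<and>
     (\<Sum>i\<in>S. f (w @ [i])) = f w \<and> (\<Sum>i\<in>S. f (i # w)) = f w)"

lemma stationaryD:
  assumes "stationary S f"
  shows "f [] = 1" "set w \<subseteq> S \<Longrightarrow> 0 \<le> f w" "set w \<subseteq> S \<Longrightarrow> (\<Sum>i\<in>S. f (w @ [i])) = f w"
    "set w \<subseteq> S \<Longrightarrow> (\<Sum>i\<in>S. f (i # w)) = f w"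
  using assms by (auto simp: stationary_def)

lemma stationary_sum_right:
  assumes "stationary S f" "finite S" "set u \<subseteq> S"
  shows "(\<Sum>v\<in>words S n. f (u @ v)) = f u"
proof (induction n)
  case (Suc n)
  have "(\<Sum>v\<in>words S (Suc n). f (u @ v)) = (\<Sum>v\<in>words S n. \<Sum>i\<in>S. f ((u @ v) @ [i]))"
    by (simp add: sum_words_Suc_right [OF assms(2)])
  also have "\<dots> = (\<Sum>v\<in>words S n. f (u @ v))"
    using assms by (intro sum.cong refl stationaryD) (auto simp: words_def)
  finally show ?case using Suc by simp
qed simp

lemma stationary_sum_left:
  assumes "stationary S f" "finite S" "set v \<subseteq> S"
  shows "(\<Sum>u\<in>words S n. f (u @ v)) = f v"
proof (induction n)
  case (Suc n)
  have "(\<Sum>u\<in>words S (Suc n). f (u @ v)) = (\<Sum>u\<in>words S n. \<Sum>i\<in>S. f (i # u @ v))"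
    unfolding sum_words_Suc [OF assms(2)] by (subst sum.swap) simp
  also have "\<dots> = (\<Sum>u\<in>words S n. f (u @ v))"
    using assms by (intro sum.cong refl stationaryD) (auto simp: words_def)
  finally show ?case using Suc by simp
qed simp

lemma stationary_sum_words:
  assumes "stationary S f" "finite S"
  shows "(\<Sum>w\<in>words S n. f w) = 1"
  using stationary_sum_right [OF assms, of "[]" n] stationaryD(1) [OF assms(1)] by simp

text \<open>The first \<open>m\<close> and the last \<open>n\<close> letters of a word of length \<open>m + n\<close> are both distributed according to \<open>f\<close>. This is
  the source of subadditivity for entropies and for logarithms of norms.\<close>

lemma stationary_sum_additive:
  assumes f: "stationary S f" "finite S"
  shows "(\<Sum>w\<in>words S (m + n). f w * (g (take m w) + h (drop m w)))
    = (\<Sum>u\<in>words S m. f u * g u) + (\<Sum>v\<in>words S n. f v * (h v :: real))"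
proof -
  have "(\<Sum>w\<in>words S (m + n). f w * (g (take m w) + h (drop m w)))
      = (\<Sum>u\<in>words S m. \<Sum>v\<in>words S n. f (u @ v) * g u + f (u @ v) * h v)"
    unfolding sum_words_append [OF f(2)]
    by (intro sum.cong refl) (auto simp: words_def distrib_left)
  also have "\<dots> = (\<Sum>u\<in>words S m. (\<Sum>v\<in>words S n. f (u @ v)) * g u)
      + (\<Sum>v\<in>words S n. (\<Sum>u\<in>words S m. f (u @ v)) * h v)"
    by (simp add: sum.distrib sum_distrib_right) (rule sum.swap)
  also have "\<dots> = (\<Sum>u\<in>words S m. f u * g u) + (\<Sum>v\<in>words S n. f v * h v)"
    using stationary_sum_right [OF f] stationary_sum_left [OF f]
    by (intro arg_cong2 [where f = "(+)"] sum.cong refl) (auto simp: words_def)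
  finally show ?thesis .
qed

section \<open>Gibbs' inequality\<close>

lemma gibbs_inequality:
  assumes "finite I" "\<And>i. i \<in> I \<Longrightarrow> a i \<ge> 0" "\<And>i. i \<in> I \<Longrightarrow> q i \<ge> 0"
    and "\<And>i. i \<in> I \<Longrightarrow> a i > 0 \<Longrightarrow> q i > 0" and "sum q I \<le> sum a I"
  shows "(\<Sum>i\<in>I. - a i * ln (a i)) \<le> (\<Sum>i\<in>I. - a i * ln (q i :: real))"
proof -
  have "- a i * ln (a i) + a i * ln (q i) \<le> q i - a i" if i: "i \<in> I" for i
  proof (cases "a i = 0")
    case False
    then have pos: "a i > 0" "q i > 0" using assms i by (auto simp: less_le)
    have "a i * ln (q i / a i) \<le> a i * (q i / a i - 1)"
      using pos by (intro mult_left_mono ln_le_minus_one) auto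
    then show ?thesis using pos by (simp add: ln_div algebra_simps)
  qed (use assms(3) [OF i] in auto)
  then have "(\<Sum>i\<in>I. - a i * ln (a i) + a i * ln (q i)) \<le> (\<Sum>i\<in>I. q i - a i)"
    by (rule sum_mono)
  also have "\<dots> \<le> 0" using assms(5) by (simp add: sum_subtractf)
  finally show ?thesis by (simp add: sum.distrib sum_negf sum_subtractf)
qed

text \<open>The entropy of a marginal is at most the cost of coding the joint distribution. This form of Gibbs'
  inequality replaces conditional entropies throughout.\<close>

lemma marginal_entropy_le:
  fixes a q :: "'i \<Rightarrow> 'j \<Rightarrow> real"
  assumes "finite I" "finite J" "\<And>i j. i \<in> I \<Longrightarrow> j \<in> J \<Longrightarrow> a i j \<ge> 0"
    and "\<And>i j. i \<in> I \<Longrightarrow> j \<in> J \<Longrightarrow> q i j \<ge> 0"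
    and "\<And>i j. i \<in> I \<Longrightarrow> j \<in> J \<Longrightarrow> a i j > 0 \<Longrightarrow> q i j > 0"
    and "(\<Sum>i\<in>I. \<Sum>j\<in>J. q i j) \<le> (\<Sum>i\<in>I. \<Sum>j\<in>J. a i j)"
  shows "(\<Sum>i\<in>I. - (\<Sum>j\<in>J. a i j) * ln (\<Sum>j\<in>J. a i j)) \<le> (\<Sum>i\<in>I. \<Sum>j\<in>J. - a i j * ln (q i j))"
proof -
  have "(\<Sum>i\<in>I. - (\<Sum>j\<in>J. a i j) * ln (\<Sum>j\<in>J. a i j)) \<le> (\<Sum>i\<in>I. - (\<Sum>j\<in>J. a i j) * ln (\<Sum>j\<in>J. q i j))"
  proof (rule gibbs_inequality)
    fix i assume i: "i \<in> I" "(\<Sum>j\<in>J. a i j) > 0"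
    then obtain j where j: "j \<in> J" "a i j > 0"
      using sum_nonpos [of J "a i"] by (force simp: not_less)
    then have "0 < q i j" using assms i by blast
    also have "\<dots> \<le> (\<Sum>j\<in>J. q i j)" using assms i j by (intro member_le_sum) auto
    finally show "(\<Sum>j\<in>J. q i j) > 0" .
  qed (use assms in \<open>auto intro: sum_nonneg\<close>)
  also have "\<dots> \<le> (\<Sum>i\<in>I. \<Sum>j\<in>J. - a i j * ln (q i j))"
    unfolding sum_negf [symmetric] sum_distrib_right
  proof (intro sum_mono)
    fix i j assume ij: "i \<in> I" "j \<in> J"
    show "- a i j * ln (\<Sum>j\<in>J. q i j) \<le> - a i j * ln (q i j)"
    proof (cases "a i j = 0")
      case False
      then have "a i j > 0" using assms(3) ij by (simp add: less_le)
      moreover have "q i j > 0" using assms(5) ij calculation by blast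
      moreover have "q i j \<le> (\<Sum>j\<in>J. q i j)"
        using assms ij by (intro member_le_sum) auto
      ultimately show ?thesis by (simp add: mult_left_mono)
    qed auto
  qed
  finally show ?thesis .
qed

section \<open>Subadditive sequences\<close>

text \<open>Subadditive sequences may have limit \<open>-\<infinity>\<close>, which does occur for Lyapunov exponents; hence the
  limit is taken in the extended reals.\<close>

lemma fekete:
  fixes a :: "nat \<Rightarrow> real"
  assumes sub: "\<And>m n. a (m + n) \<le> a m + a n"
  shows "(\<lambda>n. ereal (a n / real n)) \<longlonglongrightarrow> (INF n\<in>{1..}. ereal (a n / real n))"
proof (rule order_tendstoI)
  let ?I = "INF n\<in>{1..}. ereal (a n / real n)"
  fix l assume l: "l < ?I"
  have "l < ereal (a n / real n)" if "n \<ge> 1" for n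
    using l that by (meson INF_lower atLeast_iff less_le_trans)
  then show "\<forall>\<^sub>F n in sequentially. l < ereal (a n / real n)"
    by (auto simp: eventually_sequentially)
next
  let ?I = "INF n\<in>{1..}. ereal (a n / real n)"
  fix l assume "?I < l"
  then obtain n where n: "n \<ge> 1" "ereal (a n / real n) < l"
    by (auto simp: INF_less_iff)
  then obtain r where r: "ereal (a n / real n) < ereal r" "ereal r < l"
    using ereal_dense2 [OF n(2)] by blast
  define c where "c = Max (a ` {..<n})"
  have rem: "a k \<le> c" if "k < n" for k
    using that by (auto simp: c_def)
  have mult: "a (q * n + k) \<le> q * a n + a k" for q k
  proof (induction q)
    case (Suc q)
    have "a (Suc q * n + k) \<le> a n + a (q * n + k)"
      using sub [of n "q * n + k"] by (simp add: add.assoc)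
    with Suc show ?case by (simp add: algebra_simps)
  qed simp
  define b where "b = c + \<bar>a n\<bar>"
  have bound: "a m / real m \<le> a n / real n + b / real m" if "m \<ge> 1" for m
  proof -
    have "a m \<le> real (m div n) * a n + c"
      using mult [of "m div n" "m mod n"] rem [of "m mod n"] n by simp
    also have "real (m div n) * a n \<le> real m / real n * a n + \<bar>a n\<bar>"
    proof -
      have "real m = real (m div n) * real n + real (m mod n)"
        by (metis of_nat_add of_nat_mult div_mult_mod_eq)
      then have "real m / real n - real (m div n) = real (m mod n) / real n"
        using n by (simp add: field_simps)
      moreover have "real (m mod n) / real n \<le> 1"
        using n by (simp add: less_imp_le)
      moreover have "real (m mod n) / real n \<ge> 0" by simp
      ultimately have "\<bar>real (m div n) - real m / real n\<bar> \<le> 1"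
        by linarith
      then have "\<bar>(real (m div n) - real m / real n) * a n\<bar> \<le> 1 * \<bar>a n\<bar>"
        unfolding abs_mult by (intro mult_right_mono) auto
      then show ?thesis by (simp add: algebra_simps)
    qed
    finally have "a m \<le> real m * (a n / real n) + b" by (simp add: b_def)
    then have "a m / real m \<le> (real m * (a n / real n) + b) / real m"
      by (intro divide_right_mono) auto
    then show ?thesis using that by (simp add: add_divide_distrib)
  qed
  have "(\<lambda>m. a n / real n + b / real m) \<longlonglongrightarrow> a n / real n + 0"
    by (intro tendsto_intros lim_const_over_n)
  then have "\<forall>\<^sub>F m in sequentially. a n / real n + b / real m < r"
    using r(1) by (intro order_tendstoD) auto
  then have "\<forall>\<^sub>F m in sequentially. a m / real m < r"
    using eventually_ge_at_top [of 1]
  proof eventually_elim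
    case (elim m)
    then show ?case using bound [of m] by linarith
  qed
  then show "\<forall>\<^sub>F m in sequentially. ereal (a m / real m) < l"
  proof eventually_elim
    case (elim m)
    then show ?case using r(2) by (metis less_ereal.simps(1) less_trans)
  qed
qed

lemma fekete_bounded:
  fixes a :: "nat \<Rightarrow> real"
  assumes sub: "\<And>m n. a (m + n) \<le> a m + a n" and bnd: "\<And>n. n \<ge> 1 \<Longrightarrow> c \<le> a n / real n"
  obtains l where "(\<lambda>n. a n / real n) \<longlonglongrightarrow> l" "\<And>n. n \<ge> 1 \<Longrightarrow> l \<le> a n / real n" "c \<le> l"
proof -
  let ?I = "INF n\<in>{1..}. ereal (a n / real n)"
  have lo: "ereal c \<le> ?I" by (intro INF_greatest) (auto intro: bnd)
  have up: "?I \<le> ereal (a n / real n)" if "n \<ge> 1" for n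
    using that by (intro INF_lower) auto
  obtain l where l: "?I = ereal l"
    using lo up [of 1] by (cases ?I) auto
  show thesis
  proof (rule that)
    show "(\<lambda>n. a n / real n) \<longlonglongrightarrow> l"
      using fekete [of a, OF sub] unfolding l by simp
    show "l \<le> a n / real n" if "n \<ge> 1" for n
      using up [OF that] unfolding l by simp
    show "c \<le> l"
      using lo unfolding l by simp
  qed
qed

section \<open>Matrix products along words\<close>

text \<open>The first letter acts first, so words and factors appear in opposite orders, as in the cocycle.\<close>

primrec word_matrix :: "(nat \<Rightarrow> real^'d^'d) \<Rightarrow> nat list \<Rightarrow> real^'d^'d" where
  "word_matrix A [] = mat 1"
| "word_matrix A (i # w) = word_matrix A w ** A i"

lemma word_matrix_append: "word_matrix A (u @ v) = word_matrix A v ** word_matrix A u"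
  by (induction u) (simp_all add: matrix_mul_assoc)

lemma cocycle_eq_word_matrix: "cocycle A x n = word_matrix A (map x [0..<n])"
  by (induction n) (simp_all add: word_matrix_append)

lemma word_matrix_replicate: "word_matrix A (concat (replicate k w)) = matrix_power (word_matrix A w) k"
  by (induction k) (simp_all add: word_matrix_append)

lemma matrix_semigroup_eq: "matrix_semigroup M A = word_matrix A ` {w. w \<noteq> [] \<and> set w \<subseteq> {1..M}}"
proof (intro equalityI subsetI)
  fix B assume "B \<in> matrix_semigroup M A"
  then show "B \<in> word_matrix A ` {w. w \<noteq> [] \<and> set w \<subseteq> {1..M}}"
  proof induction
    case (generator i)
    then show ?case by (intro image_eqI [of _ _ "[i]"]) auto
  next
    case (product B C)
    then obtain u v where "B = word_matrix A u" "C = word_matrix A v" "u \<noteq> []" "v \<noteq> []"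
        "set u \<subseteq> {1..M}" "set v \<subseteq> {1..M}"
      by blast
    then show ?case by (intro image_eqI [of _ _ "v @ u"]) (auto simp: word_matrix_append)
  qed
next
  fix B assume "B \<in> word_matrix A ` {w. w \<noteq> [] \<and> set w \<subseteq> {1..M}}"
  then obtain w where "B = word_matrix A w" "w \<noteq> []" "set w \<subseteq> {1..M}" by blast
  then show "B \<in> matrix_semigroup M A"
  proof (induction w arbitrary: B)
    case (Cons i w)
    show ?case
    proof (cases "w = []")
      case False
      then show ?thesis using Cons by (auto intro!: matrix_semigroup.product intro: matrix_semigroup.generator)
    qed (use Cons in \<open>auto intro: matrix_semigroup.intros\<close>)
  qed simp
qed

section \<open>Itineraries and cylinders of the shift\<close>

lemma shift_funpow: "(shift ^^ i) x n = x (n + i)"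
  by (induction i arbitrary: x n) (simp_all add: shift_def)

lemma shift_in_full_shift: "x \<in> full_shift M \<Longrightarrow> shift x \<in> full_shift M"
  by (simp add: full_shift_def shift_def)

lemma funpow_shift_in_full_shift: "x \<in> full_shift M \<Longrightarrow> (shift ^^ i) x \<in> full_shift M"
  by (simp add: full_shift_def shift_funpow)

lemma coordinate_measurable: "(\<lambda>x. x n) \<in> measurable (shift_borel M) (count_space {1..M})"
  using measurable_component_singleton [of n UNIV "\<lambda>_. count_space {1..M}"]
  by (simp only: measurable_cong_sets [OF sets_shift_borel refl] UNIV_I)

lemma shift_measurable: "shift \<in> measurable (shift_borel M) (shift_borel M)"
proof -
  have "(\<lambda>x n. x (Suc n)) \<in> measurable (shift_borel M) (\<Pi>\<^sub>M n\<in>(UNIV::nat set). count_space {1..M})"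
    by (rule measurable_PiM_single')
      (use coordinate_measurable in \<open>auto simp: space_shift_borel full_shift_def\<close>)
  then show ?thesis
    unfolding measurable_cong_sets [OF refl sets_shift_borel] shift_def .
qed

lemma funpow_shift_measurable: "(shift ^^ i) \<in> measurable (shift_borel M) (shift_borel M)"
  by (induction i) (auto intro: measurable_compose [OF _ shift_measurable] simp: o_def)

lemma invariantD:
  assumes "\<nu> \<in> invariant_measures M"
  shows "prob_space \<nu>" "sets \<nu> = sets (shift_borel M)" "space \<nu> = full_shift M"
    and "B \<in> sets (shift_borel M) \<Longrightarrow> measure \<nu> {x \<in> full_shift M. shift x \<in> B} = measure \<nu> B"
proof -
  show 1: "prob_space \<nu>" and 2: "sets \<nu> = sets (shift_borel M)"
    using assms by (auto simp: invariant_measures_def)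
  show 3: "space \<nu> = full_shift M"
    using sets_eq_imp_space_eq [OF 2] by (simp add: space_shift_borel)
  assume B: "B \<in> sets (shift_borel M)"
  have d: "distr \<nu> (shift_borel M) shift = \<nu>"
    using assms by (simp add: invariant_measures_def)
  have "measure \<nu> B = measure (distr \<nu> (shift_borel M) shift) B" by (simp add: d)
  also have "\<dots> = measure \<nu> (shift -` B \<inter> space \<nu>)"
    using B shift_measurable 2 by (intro measure_distr) (simp_all cong: measurable_cong_sets)
  also have "shift -` B \<inter> space \<nu> = {x \<in> full_shift M. shift x \<in> B}" by (auto simp: 3)
  finally show "measure \<nu> {x \<in> full_shift M. shift x \<in> B} = measure \<nu> B" ..
qed

lemma preimage_sets:
  assumes "B \<in> sets (shift_borel M)"
  shows "{x \<in> full_shift M. (shift ^^ i) x \<in> B} \<in> sets (shift_borel M)"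
  using measurable_sets [OF funpow_shift_measurable assms, of i]
  by (simp add: space_shift_borel vimage_def Int_def conj_commute)

lemma measure_preimage_funpow:
  assumes "\<nu> \<in> invariant_measures M" "B \<in> sets (shift_borel M)"
  shows "measure \<nu> {x \<in> full_shift M. (shift ^^ i) x \<in> B} = measure \<nu> B"
proof (induction i)
  case 0
  have "{x \<in> full_shift M. x \<in> B} = B"
    using sets.sets_into_space [OF assms(2)] by (auto simp: space_shift_borel)
  then show ?case by simp
next
  case (Suc i)
  have "{x \<in> full_shift M. (shift ^^ Suc i) x \<in> B}
      = {x \<in> full_shift M. shift x \<in> {x \<in> full_shift M. (shift ^^ i) x \<in> B}}"
    by (auto simp: shift_in_full_shift funpow_Suc_right simp del: funpow.simps)
  also have "measure \<nu> \<dots> = measure \<nu> B"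
    using invariantD(4) [OF assms(1) preimage_sets [OF assms(2)]] Suc by simp
  finally show ?case .
qed

text \<open>Cells are named by labels. For a partition given as a set of cells the labelling is the identity;
  for the partition by the first symbol the labels are the symbols, and itineraries become cylinders.\<close>

definition itinerary :: "nat \<Rightarrow> ('a \<Rightarrow> (nat \<Rightarrow> nat) set) \<Rightarrow> 'a list \<Rightarrow> (nat \<Rightarrow> nat) set" where
  "itinerary M c w = {x \<in> full_shift M. \<forall>i<length w. (shift ^^ i) x \<in> c (w ! i)}"

definition measurable_partition :: "nat \<Rightarrow> 'a set \<Rightarrow> ('a \<Rightarrow> (nat \<Rightarrow> nat) set) \<Rightarrow> bool" where
  "measurable_partition M S c \<longleftrightarrow> finite S \<and> (\<forall>i\<in>S. c i \<in> sets (shift_borel M)) \<and>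
     (\<forall>x\<in>full_shift M. \<exists>!i. i \<in> S \<and> x \<in> c i)"

lemma itinerary_Nil [simp]: "itinerary M c [] = full_shift M"
  by (simp add: itinerary_def)

lemma itinerary_Cons:
  "itinerary M c (i # w) = {x \<in> full_shift M. x \<in> c i \<and> shift x \<in> itinerary M c w}"
  by (auto simp: itinerary_def shift_in_full_shift All_less_Suc2 funpow_Suc_right simp del: funpow.simps)

lemma itinerary_subset: "x \<in> itinerary M c w \<Longrightarrow> x \<in> full_shift M"
  by (simp add: itinerary_def)

lemma mem_itinerary_append:
  "x \<in> itinerary M c (u @ v) \<longleftrightarrow>
    x \<in> itinerary M c u \<and> (shift ^^ length u) x \<in> itinerary M c v"
proof (induction u arbitrary: x)
  case Nil then show ?case using itinerary_subset by auto
next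
  case (Cons i u)
  have "(shift ^^ length (i # u)) x = (shift ^^ length u) (shift x)"
    by (simp add: funpow_swap1)
  with Cons show ?case by (auto simp only: itinerary_Cons append_Cons mem_Collect_eq)
qed

lemma itinerary_append:
  "itinerary M c (u @ v) = itinerary M c u \<inter> {x \<in> full_shift M. (shift ^^ length u) x \<in> itinerary M c v}"
  using itinerary_subset by (fastforce simp only: mem_itinerary_append Int_iff mem_Collect_eq)

lemma itinerary_sets:
  assumes "measurable_partition M S c" "set w \<subseteq> S"
  shows "itinerary M c w \<in> sets (shift_borel M)"
proof -
  have "itinerary M c w = (\<Inter>i\<in>{..<length w}. {x \<in> full_shift M. (shift ^^ i) x \<in> c (w ! i)}) \<inter> full_shift M"
    by (auto simp: itinerary_def)
  also have "\<dots> \<in> sets (shift_borel M)"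
  proof (cases "w = []")
    case True
    then show ?thesis using sets.top [of "shift_borel M"] by (simp add: space_shift_borel)
  next
    case False
    have "(\<Inter>i\<in>{..<length w}. {x \<in> full_shift M. (shift ^^ i) x \<in> c (w ! i)}) \<in> sets (shift_borel M)"
    proof (intro sets.finite_INT preimage_sets)
      fix i assume "i \<in> {..<length w}"
      then have "w ! i \<in> S" using assms(2) nth_mem [of i w] by blast
      then show "c (w ! i) \<in> sets (shift_borel M)"
        using assms(1) by (simp add: measurable_partition_def)
    qed (use False in auto)
    from sets.Int [OF this sets.top] show ?thesis by (simp only: space_shift_borel)
  qed
  finally show ?thesis .
qed

lemma itinerary_unique:
  assumes "measurable_partition M S c" "x \<in> itinerary M c u" "x \<in> itinerary M c v"
    "set u \<subseteq> S" "set v \<subseteq> S" "length u = length v"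
  shows "u = v"
proof (rule nth_equalityI)
  fix i assume i: "i < length u"
  have "(shift ^^ i) x \<in> full_shift M" using assms(2) by (simp add: itinerary_def funpow_shift_in_full_shift)
  moreover have "(shift ^^ i) x \<in> c (u ! i)" "(shift ^^ i) x \<in> c (v ! i)"
    using assms(2,3,6) i by (auto simp: itinerary_def)
  moreover have "u ! i \<in> S" using assms(4) nth_mem [OF i] by blast
  moreover have "v ! i \<in> S" using assms(5,6) i nth_mem [of i v] by (simp add: subset_iff)
  ultimately show "u ! i = v ! i" using assms(1) unfolding measurable_partition_def by blast
qed (use assms in auto)

lemma itinerary_exists:
  assumes "measurable_partition M S c" "x \<in> full_shift M"
  shows "\<exists>w\<in>words S n. x \<in> itinerary M c w"
proof -
  have "\<forall>y\<in>full_shift M. \<exists>i. i \<in> S \<and> y \<in> c i"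
    using assms(1) unfolding measurable_partition_def by blast
  then obtain g where g: "\<And>y. y \<in> full_shift M \<Longrightarrow> g y \<in> S \<and> y \<in> c (g y)" by metis
  let ?w = "map (\<lambda>i. g ((shift ^^ i) x)) [0..<n]"
  have "?w \<in> words S n" "x \<in> itinerary M c ?w"
    using g assms(2) by (auto simp: words_def itinerary_def funpow_shift_in_full_shift)
  then show ?thesis by blast
qed

lemma sum_measure_itinerary_Int:
  assumes \<nu>: "\<nu> \<in> invariant_measures M" and c: "measurable_partition M S c"
    and X: "X \<in> sets (shift_borel M)"
  shows "(\<Sum>w\<in>words S n. measure \<nu> (itinerary M c w \<inter> X)) = measure \<nu> X"
proof -
  interpret prob_space \<nu> by (rule invariantD(1) [OF \<nu>])
  have "X \<subseteq> full_shift M" using sets.sets_into_space [OF X] by (simp add: space_shift_borel)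
  then have "X = (\<Union>w\<in>words S n. itinerary M c w \<inter> X)"
    using itinerary_exists [OF c] by blast
  moreover have "measure \<nu> (\<Union>w\<in>words S n. itinerary M c w \<inter> X)
      = (\<Sum>w\<in>words S n. measure \<nu> (itinerary M c w \<inter> X))"
  proof (rule finite_measure_finite_Union)
    show "finite (words S n)" using c by (auto simp: measurable_partition_def intro: finite_words)
    show "(\<lambda>w. itinerary M c w \<inter> X) ` words S n \<subseteq> sets \<nu>"
      using itinerary_sets [OF c] X by (auto simp: invariantD(2) [OF \<nu>] words_def)
    show "disjoint_family_on (\<lambda>w. itinerary M c w \<inter> X) (words S n)"
      unfolding disjoint_family_on_def using itinerary_unique [OF c] by (auto simp: words_def)
  qed
  ultimately show ?thesis by simp
qed

lemma stationary_itinerary: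
  assumes \<nu>: "\<nu> \<in> invariant_measures M" and c: "measurable_partition M S c"
  shows "stationary S (\<lambda>w. measure \<nu> (itinerary M c w))"
  unfolding stationary_def
proof (intro conjI allI impI)
  interpret prob_space \<nu> by (rule invariantD(1) [OF \<nu>])
  show "measure \<nu> (itinerary M c []) = 1"
    using prob_space by (simp add: invariantD(3) [OF \<nu>])
  fix w assume w: "set w \<subseteq> S"
  note sets = itinerary_sets [OF c w]
  show "0 \<le> measure \<nu> (itinerary M c w)" by simp
  have fin: "finite S" using c by (simp add: measurable_partition_def)
  have single: "(\<Sum>i\<in>S. measure \<nu> (itinerary M c [i] \<inter> X)) = measure \<nu> X" if "X \<in> sets (shift_borel M)" for X
    using sum_measure_itinerary_Int [OF \<nu> c that, of "Suc 0"] by (simp add: sum_words_1)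
  have "(\<Sum>i\<in>S. measure \<nu> (itinerary M c (i # w)))
      = (\<Sum>i\<in>S. measure \<nu> (itinerary M c [i] \<inter> {x \<in> full_shift M. (shift ^^ 1) x \<in> itinerary M c w}))"
    using itinerary_append [of M c "[_]" w] by simp
  also have "\<dots> = measure \<nu> (itinerary M c w)"
    by (simp only: single [OF preimage_sets [OF sets]] measure_preimage_funpow [OF \<nu> sets])
  finally show "(\<Sum>i\<in>S. measure \<nu> (itinerary M c (i # w))) = measure \<nu> (itinerary M c w)" .
  have "measure \<nu> (itinerary M c w) = (\<Sum>v\<in>words S (length w + 1). measure \<nu> (itinerary M c v \<inter> itinerary M c w))"
    using sum_measure_itinerary_Int [OF \<nu> c sets] by simp
  also have "\<dots> = (\<Sum>u\<in>words S (length w). \<Sum>i\<in>S. measure \<nu> (itinerary M c (u @ [i]) \<inter> itinerary M c w))"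
    using sum_words_Suc_right [OF fin] by simp
  also have "\<dots> = (\<Sum>u\<in>words S (length w). if u = w then \<Sum>i\<in>S. measure \<nu> (itinerary M c (w @ [i])) else 0)"
  proof (intro sum.cong refl)
    fix u assume u: "u \<in> words S (length w)"
    have sub: "itinerary M c (u @ [i]) \<subseteq> itinerary M c u" for i by (auto simp: itinerary_append)
    show "(\<Sum>i\<in>S. measure \<nu> (itinerary M c (u @ [i]) \<inter> itinerary M c w))
        = (if u = w then \<Sum>i\<in>S. measure \<nu> (itinerary M c (w @ [i])) else 0)"
    proof (cases "u = w")
      case False
      then have "itinerary M c u \<inter> itinerary M c w = {}"
        using itinerary_unique [OF c _ _ _ w] u by (auto simp: words_def)
      then have "itinerary M c (u @ [i]) \<inter> itinerary M c w = {}" for i using sub by blast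
      then show ?thesis using False by simp
    qed (use sub in \<open>simp add: Int_absorb2\<close>)
  qed
  also have "\<dots> = (\<Sum>i\<in>S. measure \<nu> (itinerary M c (w @ [i])))"
    using w finite_words [OF fin] by (simp add: words_def)
  finally show "(\<Sum>i\<in>S. measure \<nu> (itinerary M c (w @ [i]))) = measure \<nu> (itinerary M c w)" ..
qed

definition first_symbol :: "nat \<Rightarrow> nat \<Rightarrow> (nat \<Rightarrow> nat) set" where
  "first_symbol M i = {x \<in> full_shift M. x 0 = i}"

abbreviation cylinder :: "nat \<Rightarrow> nat list \<Rightarrow> (nat \<Rightarrow> nat) set" where
  "cylinder M \<equiv> itinerary M (first_symbol M)"

lemma cylinder_eq: "cylinder M w = {x \<in> full_shift M. \<forall>i<length w. x i = w ! i}"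
  by (auto simp: itinerary_def first_symbol_def funpow_shift_in_full_shift shift_funpow)

lemma partition_first_symbol: "measurable_partition M {1..M} (first_symbol M)"
  unfolding measurable_partition_def
proof (intro conjI ballI)
  fix i assume "i \<in> {1..M}"
  then have "(\<lambda>x. x 0) -` {i} \<inter> space (shift_borel M) \<in> sets (shift_borel M)"
    by (intro measurable_sets [OF coordinate_measurable]) auto
  then show "first_symbol M i \<in> sets (shift_borel M)"
    by (simp add: first_symbol_def space_shift_borel vimage_def Int_def conj_commute)
next
  fix x assume "x \<in> full_shift M"
  then show "\<exists>!i. i \<in> {1..M} \<and> x \<in> first_symbol M i"
    by (auto simp: first_symbol_def full_shift_def)
qed simp

lemmas cylinder_sets = itinerary_sets [OF partition_first_symbol]
lemmas stationary_cylinder = stationary_itinerary [OF _ partition_first_symbol]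

lemma mem_cylinder_iff:
  "x \<in> full_shift M \<Longrightarrow> x \<in> cylinder M w \<longleftrightarrow> map x [0..<length w] = w"
  unfolding cylinder_eq by (subst list_eq_iff_nth_eq) simp

text \<open>The sets determined by the first \<open>k\<close> coordinates. The set \<open>U\<close> may contain lists that never occur,
  which makes complements and passage to larger \<open>k\<close> immediate.\<close>

definition cylinder_union :: "nat \<Rightarrow> nat \<Rightarrow> nat list set \<Rightarrow> (nat \<Rightarrow> nat) set" where
  "cylinder_union M k U = {x \<in> full_shift M. map x [0..<k] \<in> U}"

lemma cylinder_union_eq_Union: "cylinder_union M k U = (\<Union>w\<in>words {1..M} k \<inter> U. cylinder M w)"
proof (intro equalityI subsetI)
  fix x assume x: "x \<in> cylinder_union M k U"
  then have "map x [0..<k] \<in> words {1..M} k \<inter> U" "x \<in> cylinder M (map x [0..<k])"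
    by (auto simp: cylinder_union_def words_def full_shift_def cylinder_eq)
  then show "x \<in> (\<Union>w\<in>words {1..M} k \<inter> U. cylinder M w)" by blast
next
  fix x assume "x \<in> (\<Union>w\<in>words {1..M} k \<inter> U. cylinder M w)"
  then obtain w where w: "w \<in> words {1..M} k" "w \<in> U" "x \<in> cylinder M w" by blast
  moreover have "x \<in> full_shift M" using w(3) by (simp add: cylinder_eq)
  ultimately show "x \<in> cylinder_union M k U"
    using mem_cylinder_iff [of x M w] by (auto simp: cylinder_union_def words_def)
qed

lemma cylinder_union_sets: "cylinder_union M k U \<in> sets (shift_borel M)"
proof -
  have "(\<Union>w\<in>words {1..M} k \<inter> U. cylinder M w) \<in> sets (shift_borel M)"
    by (intro sets.finite_UN cylinder_sets) (auto simp: words_def finite_words [unfolded words_def])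
  then show ?thesis unfolding cylinder_union_eq_Union .
qed

lemma cylinder_union_extend:
  "k \<le> k' \<Longrightarrow> cylinder_union M k U = cylinder_union M k' {w. take k w \<in> U}"
  by (simp add: cylinder_union_def take_map)

text \<open>The sets that can be approximated form a sigma-algebra containing those which restrict a single
  coordinate.\<close>

lemma approximation_by_cylinders:
  assumes "prob_space \<nu>" "sets \<nu> = sets (shift_borel M)" "E \<in> sets (shift_borel M)" "\<epsilon> > 0"
  shows "\<exists>k U. measure \<nu> (sym_diff E (cylinder_union M k U)) < \<epsilon>"
proof -
  interpret prob_space \<nu> by fact
  have sp: "space \<nu> = full_shift M"
    using sets_eq_imp_space_eq [OF assms(2)] by (simp add: space_shift_borel)
  let ?G = "{{f \<in> \<Pi>\<^sub>E i\<in>UNIV. space (count_space {1..M}). f i \<in> B} |i B. i \<in> (UNIV::nat set) \<and> B \<in> sets (count_space {1..M})}"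
  have E: "E \<in> sigma_sets (\<Pi>\<^sub>E i\<in>UNIV. space (count_space {1..M})) ?G"
    using assms(3) unfolding sets_shift_borel sets_PiM_single .
  have S: "sigma_sets (\<Pi>\<^sub>E i\<in>UNIV. space (count_space {1..M})) ?G = sets \<nu>"
    unfolding assms(2) sets_shift_borel sets_PiM_single ..
  have space: "(\<Pi>\<^sub>E i\<in>UNIV. space (count_space {1..M})) = full_shift M"
    by (auto simp: full_shift_def PiE_def Pi_def extensional_def)
  note cyl [measurable] = cylinder_union_sets [of M, folded assms(2)]
  show ?thesis
    using E assms(4)
  proof (induction arbitrary: \<epsilon> rule: sigma_sets.induct)
    case (Basic a)
    then obtain i B where a: "a = {f \<in> full_shift M. f i \<in> B}" unfolding space by blast
    have "a = cylinder_union M (Suc i) {w. w ! i \<in> B}"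
      by (auto simp: a cylinder_union_def nth_append)
    then show ?case using Basic by (intro exI [of _ "Suc i"] exI [of _ "{w. w ! i \<in> B}"]) simp
  next
    case Empty
    have "cylinder_union M 0 {} = {}" by (simp add: cylinder_union_def)
    then show ?case using Empty by (intro exI [of _ 0] exI [of _ "{}"]) simp
  next
    case (Compl a)
    then obtain k U where "measure \<nu> (sym_diff a (cylinder_union M k U)) < \<epsilon>" by blast
    moreover have "a \<subseteq> full_shift M"
      using Compl.hyps sets.sets_into_space [of a \<nu>] unfolding S sp by blast
    then have "sym_diff (full_shift M - a) (cylinder_union M k (- U)) = sym_diff a (cylinder_union M k U)"
      by (auto simp: cylinder_union_def)
    ultimately show ?case unfolding space by metis
  next
    case (Union a)
    have a [measurable]: "a i \<in> sets \<nu>" for i using Union.hyps unfolding S .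
    have "(\<lambda>N. measure \<nu> (\<Union>i<N. a i)) \<longlonglongrightarrow> measure \<nu> (\<Union>N. \<Union>i<N. a i)"
      by (rule finite_Lim_measure_incseq) (fastforce simp: incseq_def)+
    also have "(\<Union>N. \<Union>i<N. a i) = (\<Union>i. a i)" by auto
    finally have "\<forall>\<^sub>F N in sequentially. measure \<nu> (\<Union>i. a i) - \<epsilon> / 2 < measure \<nu> (\<Union>i<N. a i)"
      using Union.prems by (intro order_tendstoD) auto
    then obtain N where N: "measure \<nu> (\<Union>i. a i) - \<epsilon> / 2 < measure \<nu> (\<Union>i<N. a i)"
      using eventually_happens trivial_limit_sequentially by blast
    define \<delta> where "\<delta> = \<epsilon> / (2 * real (Suc N))"
    have \<delta>: "\<delta> > 0" using Union.prems by (simp add: \<delta>_def)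
    obtain k U where kU: "\<And>i. measure \<nu> (sym_diff (a i) (cylinder_union M (k i) (U i))) < \<delta>"
      using Union.IH [OF \<delta>] by metis
    define K where "K = Max (insert 0 (k ` {..<N}))"
    have K: "k i \<le> K" if "i < N" for i using that by (auto simp: K_def)
    let ?W = "{w. \<exists>i<N. take (k i) w \<in> U i}"
    have W: "cylinder_union M K ?W = (\<Union>i<N. cylinder_union M (k i) (U i))"
      using K by (auto simp: cylinder_union_def take_map)
    have "measure \<nu> (sym_diff (\<Union>i. a i) (cylinder_union M K ?W))
        \<le> measure \<nu> (((\<Union>i. a i) - (\<Union>i<N. a i)) \<union> (\<Union>i<N. sym_diff (a i) (cylinder_union M (k i) (U i))))"
      unfolding W by (intro finite_measure_mono) auto
    also have "\<dots> \<le> measure \<nu> ((\<Union>i. a i) - (\<Union>i<N. a i)) + measure \<nu> (\<Union>i<N. sym_diff (a i) (cylinder_union M (k i) (U i)))"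
      by (intro measure_Un_le) auto
    also have "measure \<nu> ((\<Union>i. a i) - (\<Union>i<N. a i)) = measure \<nu> (\<Union>i. a i) - measure \<nu> (\<Union>i<N. a i)"
      by (intro finite_measure_Diff) auto
    also have "measure \<nu> (\<Union>i<N. sym_diff (a i) (cylinder_union M (k i) (U i)))
        \<le> (\<Sum>i<N. measure \<nu> (sym_diff (a i) (cylinder_union M (k i) (U i))))"
      by (intro measure_UNION_le) auto
    also have "\<dots> \<le> (\<Sum>i<N. \<delta>)" using kU by (intro sum_mono less_imp_le)
    also have "\<dots> \<le> \<epsilon> / 2" using Union.prems by (simp add: \<delta>_def field_simps)
    finally have "measure \<nu> (sym_diff (\<Union>i. a i) (cylinder_union M K ?W)) < \<epsilon>"
      using N by simp
    then show ?case by blast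
  qed
qed

section \<open>Metric entropy and coding lengths\<close>

definition word_entropy :: "'a set \<Rightarrow> ('a list \<Rightarrow> real) \<Rightarrow> nat \<Rightarrow> real" where
  "word_entropy S f n = (\<Sum>w\<in>words S n. - f w * ln (f w))"

lemma stationary_append_le:
  assumes f: "stationary S f" "finite S" and "set u \<subseteq> S" "set v \<subseteq> S"
  shows "f (u @ v) \<le> f u" "f (u @ v) \<le> f v"
proof -
  have "f (u @ v) \<le> (\<Sum>v\<in>words S (length v). f (u @ v))"
    using f assms(3,4) stationaryD(2) [OF f(1)]
    by (intro member_le_sum [where f = "\<lambda>v. f (u @ v)"]) (auto simp: words_def finite_words [unfolded words_def])
  then show "f (u @ v) \<le> f u" using stationary_sum_right [OF f assms(3)] by simp
  have "f (u @ v) \<le> (\<Sum>u\<in>words S (length u). f (u @ v))"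
    using f assms(3,4) stationaryD(2) [OF f(1)]
    by (intro member_le_sum [where f = "\<lambda>u. f (u @ v)"]) (auto simp: words_def finite_words [unfolded words_def])
  then show "f (u @ v) \<le> f v" using stationary_sum_left [OF f assms(4)] by simp
qed

text \<open>Code a word by the product of the weights of its two parts.\<close>

lemma word_entropy_subadditive:
  assumes f: "stationary S f" "finite S"
  shows "word_entropy S f (m + n) \<le> word_entropy S f m + word_entropy S f n"
proof -
  have "word_entropy S f (m + n) \<le> (\<Sum>w\<in>words S (m + n). - f w * ln (f (take m w) * f (drop m w)))"
    unfolding word_entropy_def
  proof (rule gibbs_inequality)
    fix w assume w: "w \<in> words S (m + n)"
    then have s: "set w \<subseteq> S" "set (take m w) \<subseteq> S" "set (drop m w) \<subseteq> S"
      by (auto simp: words_def dest: in_set_takeD in_set_dropD)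
    then show "f w \<ge> 0" "f (take m w) * f (drop m w) \<ge> 0"
      using stationaryD(2) [OF f(1)] by auto
    assume "f w > 0"
    then show "f (take m w) * f (drop m w) > 0"
      using stationary_append_le [OF f s(2,3)] by simp
  next
    have "(\<Sum>w\<in>words S (m + n). f (take m w) * f (drop m w)) = (\<Sum>u\<in>words S m. f u * (\<Sum>v\<in>words S n. f v))"
      unfolding sum_words_append [OF f(2)] sum_distrib_left
      by (intro sum.cong refl) (simp add: words_def)
    then show "(\<Sum>w\<in>words S (m + n). f (take m w) * f (drop m w)) \<le> sum f (words S (m + n))"
      by (simp add: stationary_sum_words [OF f])
  qed (simp add: finite_words f)
  also have "\<dots> = (\<Sum>w\<in>words S (m + n). f w * (- ln (f (take m w)) + - ln (f (drop m w))))"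
  proof (intro sum.cong refl)
    fix w assume w: "w \<in> words S (m + n)"
    then have s: "set w \<subseteq> S" "set (take m w) \<subseteq> S" "set (drop m w) \<subseteq> S"
      by (auto simp: words_def dest: in_set_takeD in_set_dropD)
    show "- f w * ln (f (take m w) * f (drop m w)) = f w * (- ln (f (take m w)) + - ln (f (drop m w)))"
    proof (cases "f w = 0")
      case False
      then have "f w > 0" using stationaryD(2) [OF f(1) s(1)] by simp
      then have "f (take m w) > 0" "f (drop m w) > 0"
        using stationary_append_le [OF f s(2,3)] by auto
      then show ?thesis by (simp add: ln_mult algebra_simps)
    qed simp
  qed
  also have "\<dots> = word_entropy S f m + word_entropy S f n"
    unfolding word_entropy_def
    using stationary_sum_additive [OF f, where m = m and n = n and g = "\<lambda>u. - ln (f u)" and h = "\<lambda>v. - ln (f v)"]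
    by simp
  finally show ?thesis .
qed

lemma word_entropy_nonneg:
  assumes f: "stationary S f" "finite S"
  shows "0 \<le> word_entropy S f n"
  unfolding word_entropy_def
proof (intro sum_nonneg)
  fix w assume "w \<in> words S n"
  then have s: "set w \<subseteq> S" by (simp add: words_def)
  have "0 \<le> f w" "f w \<le> 1"
    using stationaryD(1,2) [OF f(1)] stationary_append_le(1) [OF f, of "[]" w] s by auto
  then show "0 \<le> - f w * ln (f w)"
    by (cases "f w = 0") (auto simp: mult_nonneg_nonpos)
qed

lemma word_entropy_converges:
  assumes f: "stationary S f" "finite S"
  shows "(\<lambda>n. word_entropy S f n / real n) \<longlonglongrightarrow> lim (\<lambda>n. word_entropy S f n / real n)"
proof -
  obtain l where "(\<lambda>n. word_entropy S f n / real n) \<longlonglongrightarrow> l"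
    by (rule fekete_bounded [of "word_entropy S f" 0, OF word_entropy_subadditive [OF f]])
      (auto simp: word_entropy_nonneg [OF f])
  then show ?thesis by (simp add: limI)
qed

lemma iterated_join_eq_itineraries:
  "iterated_join M (c ` S) n = itinerary M c ` words S n - {{}}"
proof -
  let ?D = "\<lambda>f. {x \<in> full_shift M. \<forall>i<n. (shift ^^ i) x \<in> f i}"
  have "?D ` ({..<n} \<rightarrow>\<^sub>E c ` S) = itinerary M c ` words S n"
  proof (intro equalityI image_subsetI)
    fix f assume f: "f \<in> {..<n} \<rightarrow>\<^sub>E c ` S"
    then have "\<forall>i. \<exists>a. i < n \<longrightarrow> a \<in> S \<and> f i = c a" by (fastforce simp: PiE_iff)
    then obtain g where g: "\<And>i. i < n \<Longrightarrow> g i \<in> S \<and> f i = c (g i)" by metis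
    have "?D f = itinerary M c (map g [0..<n])"
      using g by (auto simp: itinerary_def)
    moreover have "map g [0..<n] \<in> words S n" using g by (auto simp: words_def)
    ultimately show "?D f \<in> itinerary M c ` words S n" by blast
  next
    fix w assume w: "w \<in> words S n"
    define f where "f = (\<lambda>i\<in>{..<n}. c (w ! i))"
    have "w ! i \<in> S" if "i < n" for i
      using w that nth_mem [of i w] by (auto simp only: words_def mem_Collect_eq)
    then have "f \<in> {..<n} \<rightarrow>\<^sub>E c ` S" by (simp add: f_def PiE_iff)
    moreover have "itinerary M c w = ?D f"
      using w by (auto simp: itinerary_def f_def words_def)
    ultimately show "itinerary M c w \<in> ?D ` ({..<n} \<rightarrow>\<^sub>E c ` S)" by blast
  qed
  then show ?thesis by (simp only: iterated_join_def)
qed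

text \<open>The join of a partition is a set, so equal cells are counted once; distinct words with nonempty
  itineraries give distinct cells, and empty ones contribute nothing.\<close>

lemma partition_entropy_iterated_join:
  assumes "measurable_partition M S c"
  shows "partition_entropy \<nu> (iterated_join M (c ` S) n)
    = word_entropy S (\<lambda>w. measure \<nu> (itinerary M c w)) n"
proof -
  let ?W = "{w \<in> words S n. itinerary M c w \<noteq> {}}"
  have fin: "finite (words S n)" using assms by (simp add: finite_words measurable_partition_def)
  have inj: "inj_on (itinerary M c) ?W"
    using itinerary_unique [OF assms] by (fastforce simp: inj_on_def words_def)
  have "iterated_join M (c ` S) n = itinerary M c ` ?W"
    unfolding iterated_join_eq_itineraries by auto
  then have "partition_entropy \<nu> (iterated_join M (c ` S) n)
      = (\<Sum>w\<in>?W. - measure \<nu> (itinerary M c w) * ln (measure \<nu> (itinerary M c w)))"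
    unfolding partition_entropy_def by (simp add: sum.reindex [OF inj])
  also have "\<dots> = word_entropy S (\<lambda>w. measure \<nu> (itinerary M c w)) n"
    unfolding word_entropy_def using fin by (intro sum.mono_neutral_left) auto
  finally show ?thesis .
qed

lemma finite_partition_measurable:
  assumes "P \<in> finite_partitions M"
  shows "measurable_partition M P (\<lambda>B. B)"
proof -
  have P: "finite P" "P \<subseteq> sets (shift_borel M)" "partition_on (full_shift M) P"
    using assms by (auto simp: finite_partitions_def)
  have "\<exists>!B. B \<in> P \<and> x \<in> B" if "x \<in> full_shift M" for x
    using that P(3) unfolding partition_on_def disjoint_def by (metis IntI UnionE empty_iff)
  with P show ?thesis unfolding measurable_partition_def by blast
qed

lemma partition_first_symbol_finite: "first_symbol M ` {1..M} \<in> finite_partitions M"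
proof -
  have "partition_on (full_shift M) (first_symbol M ` {1..M})"
  proof (rule partition_onI)
    show "\<Union> (first_symbol M ` {1..M}) = full_shift M"
      by (auto simp: first_symbol_def full_shift_def)
    show "disjnt p q" if "p \<in> first_symbol M ` {1..M}" "q \<in> first_symbol M ` {1..M}" "p \<noteq> q" for p q
      using that by (auto simp: first_symbol_def disjnt_def)
    have "(\<lambda>_. i) \<in> first_symbol M i" if "i \<in> {1..M}" for i
      using that by (auto simp: first_symbol_def full_shift_def)
    then show "{} \<notin> first_symbol M ` {1..M}" by blast
  qed
  then show ?thesis
    using partition_first_symbol [of M] by (auto simp: finite_partitions_def measurable_partition_def)
qed

lemma cylinder_entropy_le_metric_entropy:
  assumes \<nu>: "\<nu> \<in> invariant_measures M"
    and l: "(\<lambda>n. word_entropy {1..M} (\<lambda>w. measure \<nu> (cylinder M w)) n / real n) \<longlonglongrightarrow> l"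
  shows "ereal l \<le> metric_entropy M \<nu>"
proof -
  have "l = lim (\<lambda>n. partition_entropy \<nu> (iterated_join M (first_symbol M ` {1..M}) n) / real n)"
    using l unfolding partition_entropy_iterated_join [OF partition_first_symbol]
    by (rule limI [symmetric])
  then show ?thesis
    unfolding metric_entropy_def
    by (auto intro!: SUP_upper2 [OF partition_first_symbol_finite])
qed

text \<open>Coordinatewise kernels give a kernel on words.\<close>

lemma sum_words_prod:
  assumes "finite S"
  shows "(\<Sum>l\<in>words S n. \<Prod>j<n. \<phi> j (l ! j)) = (\<Prod>j<n. \<Sum>b\<in>S. \<phi> j b :: real)"
proof (induction n)
  case (Suc n)
  have "(\<Sum>l\<in>words S (Suc n). \<Prod>j<Suc n. \<phi> j (l ! j))
      = (\<Sum>l\<in>words S n. \<Sum>b\<in>S. (\<Prod>j<n. \<phi> j (l ! j)) * \<phi> n b)"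
    unfolding sum_words_Suc_right [OF assms]
    by (intro sum.cong refl) (auto simp: words_def nth_append intro!: prod.cong)
  also have "\<dots> = (\<Prod>j<Suc n. \<Sum>b\<in>S. \<phi> j b)"
    by (simp add: sum_distrib_left [symmetric] sum_distrib_right [symmetric] Suc)
  finally show ?case .
qed simp

text \<open>The cell of a point can be guessed from finitely many of its coordinates with a small probability of error.
  This is where an arbitrary Borel partition is reduced to cylinders.\<close>

lemma partition_guess_from_cylinders:
  assumes \<nu>: "\<nu> \<in> invariant_measures M" and P: "P \<in> finite_partitions M" and "\<theta> > 0"
  obtains k \<kappa> where "\<And>v. \<kappa> v \<in> P"
    "measure \<nu> {x \<in> full_shift M. x \<notin> \<kappa> (map x [0..<k])} < \<theta>"
    "{x \<in> full_shift M. x \<notin> \<kappa> (map x [0..<k])} \<in> sets (shift_borel M)"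
proof -
  interpret prob_space \<nu> by (rule invariantD(1) [OF \<nu>])
  note sets_\<nu> = invariantD(2) [OF \<nu>] and space_\<nu> = invariantD(3) [OF \<nu>]
  have mp: "measurable_partition M P (\<lambda>B. B)" using P by (rule finite_partition_measurable)
  then have fin: "finite P" and Psets: "\<And>B. B \<in> P \<Longrightarrow> B \<in> sets (shift_borel M)"
    by (auto simp: measurable_partition_def)
  have "full_shift M \<noteq> {}" using not_empty space_\<nu> by simp
  then obtain B0 where B0: "B0 \<in> P" using mp unfolding measurable_partition_def by blast
  define \<delta> where "\<delta> = \<theta> / real (card P)"
  have "card P > 0" using B0 fin card_gt_0_iff by blast
  then have \<delta>: "\<delta> > 0" using \<open>\<theta> > 0\<close> by (simp add: \<delta>_def)
  have "\<forall>B\<in>P. \<exists>k U. measure \<nu> (sym_diff B (cylinder_union M k U)) < \<delta>"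
    using approximation_by_cylinders [OF invariantD(1) [OF \<nu>] sets_\<nu> _ \<delta>] Psets by blast
  then obtain k U where kU: "\<And>B. B \<in> P \<Longrightarrow> measure \<nu> (sym_diff B (cylinder_union M (k B) (U B))) < \<delta>"
    by metis
  define K where "K = Max (k ` P)"
  define V where "V B = {w. take (k B) w \<in> U B}" for B
  have kV: "cylinder_union M (k B) (U B) = cylinder_union M K (V B)" if "B \<in> P" for B
    unfolding V_def using that fin by (intro cylinder_union_extend) (auto simp: K_def)
  define \<kappa> where "\<kappa> w = (if \<exists>B\<in>P. w \<in> V B then SOME B. B \<in> P \<and> w \<in> V B else B0)" for w
  have \<kappa>: "\<kappa> w \<in> P" for w
    unfolding \<kappa>_def using B0 by (auto intro: someI2_ex)
  let ?Bad = "{x \<in> full_shift M. x \<notin> \<kappa> (map x [0..<K])}"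
  have Bad_sets: "?Bad \<in> sets (shift_borel M)"
  proof -
    have "?Bad = (\<Union>B\<in>P. cylinder_union M K {w. \<kappa> w = B} - B)"
      using \<kappa> by (auto simp: cylinder_union_def)
    also have "\<dots> \<in> sets (shift_borel M)"
      using fin Psets cylinder_union_sets by (intro sets.finite_UN sets.Diff) auto
    finally show ?thesis .
  qed
  have "?Bad \<subseteq> (\<Union>B\<in>P. sym_diff B (cylinder_union M K (V B)))"
  proof
    fix x assume x: "x \<in> ?Bad"
    let ?w = "map x [0..<K]"
    obtain B where B: "B \<in> P" "x \<in> B" using x mp by (auto simp: measurable_partition_def)
    have mem: "x \<in> cylinder_union M K (V C) \<longleftrightarrow> ?w \<in> V C" for C
      using x by (simp add: cylinder_union_def)
    show "x \<in> (\<Union>B\<in>P. sym_diff B (cylinder_union M K (V B)))"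
    proof (cases "?w \<in> V B")
      case False
      then show ?thesis using B mem by blast
    next
      case True
      then have "\<exists>B\<in>P. ?w \<in> V B" using B by blast
      then have "?w \<in> V (\<kappa> ?w)" unfolding \<kappa>_def by (auto intro: someI2_ex)
      then show ?thesis using x \<kappa> mem by blast
    qed
  qed
  then have "measure \<nu> ?Bad \<le> measure \<nu> (\<Union>B\<in>P. sym_diff B (cylinder_union M K (V B)))"
    using fin Psets cylinder_union_sets
    by (intro finite_measure_mono) (auto simp: sets_\<nu> intro!: sets.finite_UN sets.Un sets.Diff)
  also have "\<dots> \<le> (\<Sum>B\<in>P. measure \<nu> (sym_diff B (cylinder_union M K (V B))))"
    using fin Psets cylinder_union_sets
    by (intro measure_UNION_le) (auto simp: sets_\<nu> intro!: sets.Un sets.Diff)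
  also have "\<dots> < (\<Sum>B\<in>P. \<delta>)"
    using fin B0 kU kV by (intro sum_strict_mono) auto
  also have "\<dots> = \<theta>" using fin B0 by (auto simp: \<delta>_def)
  finally show thesis using that [OF \<kappa> _ Bad_sets] by blast
qed


lemma double_sum_split:
  fixes x y :: "'i \<Rightarrow> 'j \<Rightarrow> real"
  shows "(\<Sum>l\<in>I. \<Sum>w\<in>J. x l w + (\<Sum>j<n. y l w * c + b * z j l w))
    = (\<Sum>l\<in>I. \<Sum>w\<in>J. x l w) + (\<Sum>j<n. (\<Sum>l\<in>I. \<Sum>w\<in>J. y l w) * c + b * (\<Sum>l\<in>I. \<Sum>w\<in>J. z j l w))"
proof -
  have "(\<Sum>l\<in>I. \<Sum>w\<in>J. \<Sum>j<n. y l w * c + b * z j l w) = (\<Sum>l\<in>I. \<Sum>j<n. \<Sum>w\<in>J. y l w * c + b * z j l w)"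
    by (intro sum.cong refl sum.swap)
  also have "\<dots> = (\<Sum>j<n. \<Sum>l\<in>I. \<Sum>w\<in>J. y l w * c + b * z j l w)"
    by (rule sum.swap)
  also have "\<dots> = (\<Sum>j<n. (\<Sum>l\<in>I. \<Sum>w\<in>J. y l w) * c + b * (\<Sum>l\<in>I. \<Sum>w\<in>J. z j l w))"
    by (simp only: sum.distrib sum_distrib_left sum_distrib_right)
  finally show ?thesis by (simp only: sum.distrib)
qed

text \<open>The cells visited during \<open>n\<close> steps are coded together with the first \<open>n + k\<close> symbols: the symbols with
  weight \<open>\<pi>\<close>, and each cell by a kernel \<open>K\<close> that gives weight \<open>1 - \<epsilon>\<close> to the guess made from the next \<open>k\<close>
  symbols and \<open>\<epsilon> / card P\<close> to every other cell. A right guess costs \<open>e/2\<close>, a wrong one at most \<open>L\<close> more, and the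
  probability \<open>\<theta>\<close> of a wrong guess is so small that \<open>L \<theta> = e/2\<close>. Together with \<open>marginal_entropy_le\<close> this bounds
  the entropy of every partition directly, without conditional entropy or a generator theorem.\<close>

lemma word_entropy_le_coding_length:
  assumes \<nu>: "\<nu> \<in> invariant_measures M" and P: "P \<in> finite_partitions M"
    and \<pi>: "\<And>w. set w \<subseteq> {1..M} \<Longrightarrow> \<pi> w \<ge> 0" "\<And>n. (\<Sum>w\<in>words {1..M} n. \<pi> w) \<le> 1"
    and pos: "\<And>w. set w \<subseteq> {1..M} \<Longrightarrow> measure \<nu> (cylinder M w) > 0 \<Longrightarrow> \<pi> w > 0"
    and e: "e > 0"
  shows "\<exists>k. \<forall>n. word_entropy P (\<lambda>l. measure \<nu> (itinerary M (\<lambda>B. B) l)) n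
    \<le> (\<Sum>w\<in>words {1..M} (n + k). - measure \<nu> (cylinder M w) * ln (\<pi> w)) + real n * e"
proof -
  interpret prob_space \<nu> by (rule invariantD(1) [OF \<nu>])
  note sets_\<nu> = invariantD(2) [OF \<nu>] and space_\<nu> = invariantD(3) [OF \<nu>]
  let ?S = "{1..M}"
  let ?D = "itinerary M (\<lambda>B. B)"
  have mp: "measurable_partition M P (\<lambda>B. B)" using P by (rule finite_partition_measurable)
  then have fin: "finite P" by (simp add: measurable_partition_def)
  have "full_shift M \<noteq> {}" using not_empty space_\<nu> by simp
  then have "P \<noteq> {}" using mp unfolding measurable_partition_def by blast
  then have cardP: "card P \<ge> 1" using fin by (simp add: Suc_leI card_gt_0_iff)
  define \<epsilon> where "\<epsilon> = 1 - exp (- (e / 2))"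
  have \<epsilon>: "0 < \<epsilon>" "\<epsilon> < 1" "- ln (1 - \<epsilon>) = e / 2" using e by (auto simp: \<epsilon>_def)
  define L where "L = - ln (\<epsilon> / card P)"
  have "\<epsilon> / card P < 1" using \<epsilon> cardP by (simp add: divide_less_eq)
  then have L: "L > 0" using \<epsilon> cardP by (simp add: L_def ln_less_zero)
  define \<theta> where "\<theta> = e / (2 * L)"
  have \<theta>: "\<theta> > 0" using e L by (simp add: \<theta>_def)
  obtain k \<kappa> where \<kappa>: "\<And>v. \<kappa> v \<in> P"
    and bad: "measure \<nu> {x \<in> full_shift M. x \<notin> \<kappa> (map x [0..<k])} < \<theta>"
      "{x \<in> full_shift M. x \<notin> \<kappa> (map x [0..<k])} \<in> sets (shift_borel M)"
    using partition_guess_from_cylinders [OF \<nu> P \<theta>] by blast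
  define Bad where "Bad = {x \<in> full_shift M. x \<notin> \<kappa> (map x [0..<k])}"
  define K where "K v B = (if B = \<kappa> v then 1 - \<epsilon> else \<epsilon> / card P)" for v B
  have K_pos: "K v B > 0" for v B using \<epsilon> cardP by (simp add: K_def)
  have K_sum: "(\<Sum>B\<in>P. K v B) \<le> 1" for v
  proof -
    have "(\<Sum>B\<in>P. K v B) \<le> (\<Sum>B\<in>P. (if B = \<kappa> v then 1 - \<epsilon> else 0) + \<epsilon> / card P)"
      using \<epsilon> by (intro sum_mono) (auto simp: K_def)
    also have "\<dots> = 1" using fin \<kappa> cardP \<open>P \<noteq> {}\<close> by (simp add: sum.distrib)
    finally show ?thesis .
  qed
  have K_ln: "- ln (K v B) \<le> e / 2 + (if B = \<kappa> v then 0 else L)" for v B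
    using e \<epsilon> L by (simp add: K_def L_def)
  show ?thesis
  proof (intro exI allI)
    fix n
    let ?a = "\<lambda>l w. measure \<nu> (?D l \<inter> cylinder M w)"
    let ?win = "\<lambda>w j. take k (drop j w)"
    let ?q = "\<lambda>l w. \<pi> w * (\<Prod>j<n. K (?win w j) (l ! j))"
    let ?W = "words ?S (n + k)"
    have D_sets: "?D l \<in> sets \<nu>" if "l \<in> words P n" for l
      using that itinerary_sets [OF mp] by (auto simp: sets_\<nu> words_def)
    have C_sets: "cylinder M w \<in> sets \<nu>" if "w \<in> ?W" for w
      using that cylinder_sets by (auto simp: sets_\<nu> words_def)
    have marg: "(\<Sum>w\<in>?W. ?a l w) = measure \<nu> (?D l)" if "l \<in> words P n" for l
      using sum_measure_itinerary_Int [OF \<nu> partition_first_symbol, of "?D l" "n + k"] D_sets [OF that]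
      by (simp add: Int_commute sets_\<nu>)
    have marg': "(\<Sum>l\<in>words P n. ?a l w) = measure \<nu> (cylinder M w)" if "w \<in> ?W" for w
      using sum_measure_itinerary_Int [OF \<nu> mp, of "cylinder M w" n] C_sets [OF that]
      by (simp add: sets_\<nu>)
    have total: "(\<Sum>l\<in>words P n. \<Sum>w\<in>?W. ?a l w) = 1"
      using stationary_sum_words [OF stationary_itinerary [OF \<nu> mp] fin, of n] marg by simp
    have "word_entropy P (\<lambda>l. measure \<nu> (?D l)) n
        = (\<Sum>l\<in>words P n. - (\<Sum>w\<in>?W. ?a l w) * ln (\<Sum>w\<in>?W. ?a l w))"
      unfolding word_entropy_def by (intro sum.cong refl) (simp only: marg)
    also have "\<dots> \<le> (\<Sum>l\<in>words P n. \<Sum>w\<in>?W. - ?a l w * ln (?q l w))"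
    proof (rule marginal_entropy_le)
      show "?q l w \<ge> 0" if "w \<in> ?W" for l w
        using that \<pi>(1) K_pos by (intro mult_nonneg_nonneg prod_nonneg) (auto simp: words_def less_imp_le)
      show "?q l w > 0" if "w \<in> ?W" "?a l w > 0" for l w
      proof -
        have "?a l w \<le> measure \<nu> (cylinder M w)"
          using C_sets [OF that(1)] by (intro finite_measure_mono) auto
        then have "\<pi> w > 0" using that by (intro pos) (auto simp: words_def)
        then show ?thesis using K_pos by (intro mult_pos_pos prod_pos) auto
      qed
      have "(\<Sum>l\<in>words P n. \<Sum>w\<in>?W. ?q l w) = (\<Sum>w\<in>?W. \<pi> w * (\<Prod>j<n. \<Sum>B\<in>P. K (?win w j) B))"
        by (subst sum.swap, intro sum.cong refl, subst sum_distrib_left [symmetric],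
            rule arg_cong [where f = "(*) _"], rule sum_words_prod [OF fin])
      also have "\<dots> \<le> (\<Sum>w\<in>?W. \<pi> w * 1)"
      proof (intro sum_mono mult_left_mono)
        fix w assume "w \<in> ?W"
        then show "\<pi> w \<ge> 0" by (intro \<pi>(1)) (simp add: words_def)
        have "0 \<le> (\<Sum>B\<in>P. K v B)" for v by (intro sum_nonneg less_imp_le K_pos)
        then show "(\<Prod>j<n. \<Sum>B\<in>P. K (?win w j) B) \<le> 1"
          using K_sum by (intro prod_le_1) blast
      qed
      also have "\<dots> \<le> 1" using \<pi>(2) by simp
      finally show "(\<Sum>l\<in>words P n. \<Sum>w\<in>?W. ?q l w) \<le> (\<Sum>l\<in>words P n. \<Sum>w\<in>?W. ?a l w)"
        using total by simp
    qed (simp_all add: finite_words fin)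
    also have "\<dots> \<le> (\<Sum>l\<in>words P n. \<Sum>w\<in>?W. ?a l w * - ln (\<pi> w)
        + (\<Sum>j<n. ?a l w * (e / 2) + L * measure \<nu> (?D l \<inter> cylinder M w \<inter> {x \<in> full_shift M. (shift ^^ j) x \<in> Bad})))"
    proof (intro sum_mono)
      fix l w assume l: "l \<in> words P n" and w: "w \<in> ?W"
      let ?X = "\<lambda>j. {x \<in> full_shift M. (shift ^^ j) x \<in> Bad}"
      show "- ?a l w * ln (?q l w) \<le> ?a l w * - ln (\<pi> w)
        + (\<Sum>j<n. ?a l w * (e / 2) + L * measure \<nu> (?D l \<inter> cylinder M w \<inter> ?X j))"
      proof (cases "?a l w = 0")
        case True
        then show ?thesis using L by (auto intro!: sum_nonneg)
      next
        case False
        have "?a l w \<le> measure \<nu> (cylinder M w)"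
          using C_sets [OF w] by (intro finite_measure_mono) auto
        moreover have "0 < ?a l w" using False by (simp add: less_le)
        ultimately have "measure \<nu> (cylinder M w) > 0" by linarith
        then have \<pi>w: "\<pi> w > 0" using w by (intro pos) (auto simp: words_def)
        have K0: "K v B \<noteq> 0" for v B using K_pos [of v B] by simp
        have "ln (?q l w) = ln (\<pi> w) + (\<Sum>j<n. ln (K (?win w j) (l ! j)))"
          using \<pi>w K_pos K0 by (subst ln_mult_pos) (auto intro!: prod_pos simp: ln_prod)
        then have expand: "- ?a l w * ln (?q l w)
            = ?a l w * - ln (\<pi> w) + (\<Sum>j<n. ?a l w * - ln (K (?win w j) (l ! j)))"
          by (simp add: algebra_simps sum_distrib_left sum_negf)
        have "(\<Sum>j<n. ?a l w * - ln (K (?win w j) (l ! j)))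
            \<le> (\<Sum>j<n. ?a l w * (e / 2) + L * measure \<nu> (?D l \<inter> cylinder M w \<inter> ?X j))"
        proof (intro sum_mono)
          fix j assume j: "j \<in> {..<n}"
          show "?a l w * - ln (K (?win w j) (l ! j))
              \<le> ?a l w * (e / 2) + L * measure \<nu> (?D l \<inter> cylinder M w \<inter> ?X j)"
          proof (cases "l ! j = \<kappa> (?win w j)")
            case True
            then have "?a l w * - ln (K (?win w j) (l ! j)) \<le> ?a l w * (e / 2)"
              using K_ln [of "?win w j" "l ! j"] by (intro mult_left_mono) auto
            then show ?thesis using L
              by (smt (verit) measure_nonneg mult_nonneg_nonneg)
          next
            case False
            \<comment> \<open>If the guess for time \<open>j\<close> is not the prescribed cell, then all points with this itinerary and
              these symbols are guessed wrongly at time \<open>j\<close>.\<close>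
            have sub: "?D l \<inter> cylinder M w \<subseteq> ?X j"
            proof
              fix x assume x: "x \<in> ?D l \<inter> cylinder M w"
              then have xs: "x \<in> full_shift M" by (auto simp: itinerary_def)
              have in_l: "(shift ^^ j) x \<in> l ! j" using x j l by (auto simp: itinerary_def words_def)
              have map_eq: "map ((shift ^^ j) x) [0..<k] = ?win w j"
              proof -
                have "length w = n + k" using w by (simp add: words_def)
                then show ?thesis
                  using x j by (intro nth_equalityI) (auto simp: cylinder_eq shift_funpow add.commute)
              qed
              have lP: "l ! j \<in> P" using l j nth_mem [of j l] by (auto simp only: words_def mem_Collect_eq lessThan_iff)
              have y: "(shift ^^ j) x \<in> full_shift M" using xs by (rule funpow_shift_in_full_shift)
              then have "\<exists>!B. B \<in> P \<and> (shift ^^ j) x \<in> B"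
                using mp by (simp only: measurable_partition_def)
              then have "(shift ^^ j) x \<notin> \<kappa> (?win w j)"
                using in_l lP \<kappa> False by blast
              then have "(shift ^^ j) x \<in> Bad"
                using y by (simp only: Bad_def mem_Collect_eq map_eq simp_thms)
              then show "x \<in> ?X j" using xs by blast
            qed
            have "?a l w * - ln (K (?win w j) (l ! j)) \<le> ?a l w * (e / 2 + L)"
              using K_ln [of "?win w j" "l ! j"] False by (intro mult_left_mono) auto
            also have "?a l w = measure \<nu> (?D l \<inter> cylinder M w \<inter> ?X j)"
              using sub by (simp add: Int_absorb2)
            finally show ?thesis using sub by (simp add: Int_absorb2 algebra_simps)
          qed
        qed
        then show ?thesis unfolding expand by (rule add_left_mono)
      qed
    qed
    also have "\<dots> = (\<Sum>l\<in>words P n. \<Sum>w\<in>?W. ?a l w * - ln (\<pi> w))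
        + (\<Sum>j<n. (\<Sum>l\<in>words P n. \<Sum>w\<in>?W. ?a l w) * (e / 2)
          + L * (\<Sum>l\<in>words P n. \<Sum>w\<in>?W. measure \<nu> (?D l \<inter> cylinder M w \<inter> {x \<in> full_shift M. (shift ^^ j) x \<in> Bad})))"
      by (rule double_sum_split)
    also have "(\<Sum>l\<in>words P n. \<Sum>w\<in>?W. ?a l w * - ln (\<pi> w)) = (\<Sum>w\<in>?W. - measure \<nu> (cylinder M w) * ln (\<pi> w))"
      by (subst sum.swap, intro sum.cong refl, subst sum_distrib_right [symmetric], subst marg') auto
    also have "(\<Sum>j<n. (\<Sum>l\<in>words P n. \<Sum>w\<in>?W. ?a l w) * (e / 2)
          + L * (\<Sum>l\<in>words P n. \<Sum>w\<in>?W. measure \<nu> (?D l \<inter> cylinder M w \<inter> {x \<in> full_shift M. (shift ^^ j) x \<in> Bad})))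
        \<le> (\<Sum>j<n. e)"
    proof (intro sum_mono)
      fix j
      let ?X = "{x \<in> full_shift M. (shift ^^ j) x \<in> Bad}"
      have X: "?X \<in> sets (shift_borel M)" unfolding Bad_def by (rule preimage_sets [OF bad(2)])
      have "(\<Sum>l\<in>words P n. \<Sum>w\<in>?W. measure \<nu> (?D l \<inter> cylinder M w \<inter> ?X))
          = (\<Sum>l\<in>words P n. \<Sum>w\<in>?W. measure \<nu> (cylinder M w \<inter> (?D l \<inter> ?X)))"
        by (intro sum.cong refl arg_cong [where f = "measure \<nu>"]) auto
      also have "\<dots> = (\<Sum>l\<in>words P n. measure \<nu> (?D l \<inter> ?X))"
        using D_sets X by (intro sum.cong refl sum_measure_itinerary_Int [OF \<nu> partition_first_symbol])
          (simp add: sets_\<nu>)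
      also have "\<dots> = measure \<nu> ?X" by (rule sum_measure_itinerary_Int [OF \<nu> mp X])
      also have "\<dots> = measure \<nu> Bad"
        using measure_preimage_funpow [OF \<nu> bad(2)] by (simp add: Bad_def)
      finally have "(\<Sum>l\<in>words P n. \<Sum>w\<in>?W. measure \<nu> (?D l \<inter> cylinder M w \<inter> ?X)) \<le> \<theta>"
        using bad(1) by (simp add: Bad_def)
      then have "L * (\<Sum>l\<in>words P n. \<Sum>w\<in>?W. measure \<nu> (?D l \<inter> cylinder M w \<inter> ?X)) \<le> L * \<theta>"
        using L by (intro mult_left_mono) auto
      moreover have "L * \<theta> = e / 2" using L by (simp add: \<theta>_def)
      ultimately show "(\<Sum>l\<in>words P n. \<Sum>w\<in>?W. ?a l w) * (e / 2)
          + L * (\<Sum>l\<in>words P n. \<Sum>w\<in>?W. measure \<nu> (?D l \<inter> cylinder M w \<inter> ?X)) \<le> e"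
        using total by simp
    qed
    finally show "word_entropy P (\<lambda>l. measure \<nu> (?D l)) n
        \<le> (\<Sum>w\<in>?W. - measure \<nu> (cylinder M w) * ln (\<pi> w)) + real n * e"
      by simp
  qed
qed

text \<open>The shift of the index by \<open>k\<close> in the previous bound disappears in the limit, and \<open>e\<close> is arbitrary.\<close>

lemma metric_entropy_le_coding_rate:
  assumes \<nu>: "\<nu> \<in> invariant_measures M"
    and \<pi>: "\<And>w. set w \<subseteq> {1..M} \<Longrightarrow> \<pi> w \<ge> 0" "\<And>n. (\<Sum>w\<in>words {1..M} n. \<pi> w) \<le> 1"
    and pos: "\<And>w. set w \<subseteq> {1..M} \<Longrightarrow> measure \<nu> (cylinder M w) > 0 \<Longrightarrow> \<pi> w > 0"
    and lim: "(\<lambda>n. (\<Sum>w\<in>words {1..M} n. - measure \<nu> (cylinder M w) * ln (\<pi> w)) / real n) \<longlonglongrightarrow> \<gamma>"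
  shows "metric_entropy M \<nu> \<le> ereal \<gamma>"
  unfolding metric_entropy_def
proof (rule SUP_least)
  fix P assume P: "P \<in> finite_partitions M"
  then have mp: "measurable_partition M P (\<lambda>B. B)" by (rule finite_partition_measurable)
  then have fin: "finite P" by (simp add: measurable_partition_def)
  define H where "H = word_entropy P (\<lambda>l. measure \<nu> (itinerary M (\<lambda>B. B) l))"
  define G where "G n = (\<Sum>w\<in>words {1..M} n. - measure \<nu> (cylinder M w) * ln (\<pi> w))" for n
  have eq: "partition_entropy \<nu> (iterated_join M P n) = H n" for n
    using partition_entropy_iterated_join [OF mp, of \<nu> n] by (simp add: H_def)
  have conv: "(\<lambda>n. H n / real n) \<longlonglongrightarrow> lim (\<lambda>n. H n / real n)"
    unfolding H_def by (rule word_entropy_converges [OF stationary_itinerary [OF \<nu> mp] fin])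
  have "lim (\<lambda>n. H n / real n) \<le> \<gamma> + e" if e: "e > 0" for e
  proof -
    obtain k where k: "\<And>n. H n \<le> G (n + k) + real n * e"
      using word_entropy_le_coding_length [OF \<nu> P \<pi> pos e] unfolding H_def G_def by blast
    have "(\<lambda>n. G (n + k) / real (n + k)) \<longlonglongrightarrow> \<gamma>"
      using LIMSEQ_ignore_initial_segment [OF lim, of k] by (simp add: G_def)
    moreover have "(\<lambda>n. real (n + k) / real n) \<longlonglongrightarrow> 1"
      by real_asymp
    ultimately have "(\<lambda>n. G (n + k) / real (n + k) * (real (n + k) / real n) + e) \<longlonglongrightarrow> \<gamma> * 1 + e"
      by (intro tendsto_intros)
    moreover have "\<forall>\<^sub>F n in sequentially. H n / real n \<le> G (n + k) / real (n + k) * (real (n + k) / real n) + e"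
      using eventually_gt_at_top [of 0]
    proof eventually_elim
      case (elim n)
      have "H n / real n \<le> (G (n + k) + real n * e) / real n"
        using k by (intro divide_right_mono) auto
      also have "\<dots> = G (n + k) / real n + e"
        using elim by (simp add: add_divide_distrib)
      also have "G (n + k) / real n = G (n + k) / real (n + k) * (real (n + k) / real n)"
        using elim by simp
      finally show ?case .
    qed
    ultimately have "lim (\<lambda>n. H n / real n) \<le> \<gamma> * 1 + e"
      using conv by (intro tendsto_le [OF trivial_limit_sequentially])
    then show ?thesis by simp
  qed
  then have "lim (\<lambda>n. H n / real n) \<le> \<gamma>" by (rule field_le_epsilon)
  then show "ereal (lim (\<lambda>n. partition_entropy \<nu> (iterated_join M P n) / real n)) \<le> ereal \<gamma>"
    by (simp add: eq)
qed

section \<open>Lyapunov exponents and the variational principle\<close>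

text \<open>A function of the first \<open>n\<close> coordinates is simple, so its integral is a finite sum.\<close>

lemma nn_integral_word:
  assumes \<nu>: "\<nu> \<in> invariant_measures M"
  shows "(\<integral>\<^sup>+ x. g (map x [0..<n]) \<partial>\<nu>) = (\<Sum>w\<in>words {1..M} n. g w * ennreal (measure \<nu> (cylinder M w)))"
proof -
  interpret prob_space \<nu> by (rule invariantD(1) [OF \<nu>])
  have fin: "finite (words {1..M} n)" by (simp add: finite_words)
  have "(\<integral>\<^sup>+ x. g (map x [0..<n]) \<partial>\<nu>) = (\<integral>\<^sup>+ x. (\<Sum>w\<in>words {1..M} n. g w * indicator (cylinder M w) x) \<partial>\<nu>)"
  proof (rule nn_integral_cong)
    fix x assume "x \<in> space \<nu>"
    then have x: "x \<in> full_shift M" by (simp add: invariantD(3) [OF \<nu>])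
    then have w: "map x [0..<n] \<in> words {1..M} n" by (auto simp: words_def full_shift_def)
    have "(\<Sum>w\<in>words {1..M} n. g w * indicator (cylinder M w) x)
        = (\<Sum>w\<in>words {1..M} n. if w = map x [0..<n] then g w else 0)"
      using mem_cylinder_iff [OF x] by (intro sum.cong refl) (auto simp: words_def indicator_def)
    then show "g (map x [0..<n]) = (\<Sum>w\<in>words {1..M} n. g w * indicator (cylinder M w) x)"
      using w fin by simp
  qed
  also have "\<dots> = (\<Sum>w\<in>words {1..M} n. \<integral>\<^sup>+ x. g w * indicator (cylinder M w) x \<partial>\<nu>)"
    using cylinder_sets [of _ M]
    by (intro nn_integral_sum borel_measurable_times_ennreal borel_measurable_const borel_measurable_indicator)
      (auto simp: invariantD(2) [OF \<nu>] words_def)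
  also have "\<dots> = (\<Sum>w\<in>words {1..M} n. g w * ennreal (measure \<nu> (cylinder M w)))"
    using cylinder_sets [of _ M]
    by (intro sum.cong refl) (auto simp: nn_integral_cmult_indicator invariantD(2) [OF \<nu>] words_def emeasure_eq_measure)
  finally show ?thesis .
qed

text \<open>Since \<open>ln 0 = 0\<close> for real numbers, this is the integral of the logarithm of the norm only if no word of
  positive measure has product zero; the next definition describes the other case.\<close>

definition mean_log_norm :: "nat \<Rightarrow> (nat \<Rightarrow> real^'d^'d) \<Rightarrow> (nat \<Rightarrow> nat) measure \<Rightarrow> nat \<Rightarrow> real" where
  "mean_log_norm M A \<nu> n =
     (\<Sum>w\<in>words {1..M} n. measure \<nu> (cylinder M w) * ln (matrix_norm (word_matrix A w)))"

definition charges_zero :: "nat \<Rightarrow> (nat \<Rightarrow> real^'d^'d) \<Rightarrow> (nat \<Rightarrow> nat) measure \<Rightarrow> nat \<Rightarrow> bool" where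
  "charges_zero M A \<nu> n \<longleftrightarrow>
     (\<exists>w\<in>words {1..M} n. measure \<nu> (cylinder M w) > 0 \<and> word_matrix A w = 0)"

lemma ereal_integral_log_norm:
  assumes \<nu>: "\<nu> \<in> invariant_measures M"
  shows "ereal_integral \<nu> (\<lambda>x. ln_ereal (matrix_norm (cocycle A x n)))
    = (if charges_zero M A \<nu> n then -\<infinity> else ereal (mean_log_norm M A \<nu> n))"
proof -
  let ?W = "words {1..M} n"
  have fin: "finite ?W" by (simp add: finite_words)
  let ?m = "\<lambda>w. measure \<nu> (cylinder M w)" and ?N = "\<lambda>w. matrix_norm (word_matrix A w)"
  have eq: "ereal_integral \<nu> (\<lambda>x. ln_ereal (matrix_norm (cocycle A x n)))
      = enn2ereal (\<Sum>w\<in>?W. e2ennreal (ln_ereal (?N w)) * ennreal (?m w))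
        - enn2ereal (\<Sum>w\<in>?W. e2ennreal (- ln_ereal (?N w)) * ennreal (?m w))"
    unfolding ereal_integral_def cocycle_eq_word_matrix
    by (simp only: nn_integral_word [OF \<nu>, of "\<lambda>w. e2ennreal (ln_ereal (?N w))"]
        nn_integral_word [OF \<nu>, of "\<lambda>w. e2ennreal (- ln_ereal (?N w))"])
  have first: "(\<Sum>w\<in>?W. e2ennreal (ln_ereal (?N w)) * ennreal (?m w)) = ennreal (\<Sum>w\<in>?W. max 0 (ln (?N w)) * ?m w)"
  proof -
    have "e2ennreal (ln_ereal (?N w)) * ennreal (?m w) = ennreal (max 0 (ln (?N w)) * ?m w)" for w
      by (cases "?N w = 0") (auto simp: ln_ereal_def e2ennreal_neg ennreal_mult max_def ennreal_neg simp flip: ennreal_def)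
    then show ?thesis by (simp add: sum_ennreal)
  qed
  show ?thesis
  proof (cases "charges_zero M A \<nu> n")
    case True
    then obtain w where w: "w \<in> ?W" "?m w > 0" "word_matrix A w = 0"
      by (auto simp: charges_zero_def)
    then have "e2ennreal (- ln_ereal (?N w)) * ennreal (?m w) = \<infinity>"
      by (simp add: ln_ereal_def matrix_norm_eq_0_iff ennreal_top_mult e2ennreal_infty)
    then have "(\<Sum>w\<in>?W. e2ennreal (- ln_ereal (?N w)) * ennreal (?m w)) = \<infinity>"
      using member_le_sum [OF w(1), of "\<lambda>w. e2ennreal (- ln_ereal (?N w)) * ennreal (?m w)"] fin
      by (simp add: top_unique)
    then show ?thesis unfolding eq first using True by (simp add: enn2ereal_ennreal sum_nonneg)
  next
    case False
    have "e2ennreal (- ln_ereal (?N w)) * ennreal (?m w) = ennreal (max 0 (- ln (?N w)) * ?m w)"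
      if "w \<in> ?W" for w
    proof (cases "?m w = 0")
      case m: False
      then have "?N w \<noteq> 0"
        using False that by (auto simp: charges_zero_def less_le matrix_norm_eq_0_iff)
      then show ?thesis
        by (auto simp: ln_ereal_def ennreal_mult max_def ennreal_neg simp flip: ennreal_def)
    qed simp
    then have second: "(\<Sum>w\<in>?W. e2ennreal (- ln_ereal (?N w)) * ennreal (?m w)) = ennreal (\<Sum>w\<in>?W. max 0 (- ln (?N w)) * ?m w)"
      by (simp add: sum_ennreal cong: sum.cong)
    have "(\<Sum>w\<in>?W. max 0 (ln (?N w)) * ?m w) - (\<Sum>w\<in>?W. max 0 (- ln (?N w)) * ?m w) = mean_log_norm M A \<nu> n"
      unfolding mean_log_norm_def sum_subtractf [symmetric]
      by (intro sum.cong refl) (auto simp: max_def mult.commute)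
    then show ?thesis
      unfolding eq first second using False by (simp add: enn2ereal_ennreal sum_nonneg)
  qed
qed

text \<open>A word of positive measure extends to longer words of positive measure, and a product that vanishes
  keeps vanishing.\<close>

lemma charges_zero_mono:
  assumes \<nu>: "\<nu> \<in> invariant_measures M" and "charges_zero M A \<nu> m" "m \<le> n"
  shows "charges_zero M A \<nu> n"
proof -
  obtain u where u: "u \<in> words {1..M} m" "measure \<nu> (cylinder M u) > 0" "word_matrix A u = 0"
    using assms(2) by (auto simp: charges_zero_def)
  have "(\<Sum>v\<in>words {1..M} (n - m). measure \<nu> (cylinder M (u @ v))) > 0"
    using u stationary_sum_right [OF stationary_cylinder [OF \<nu>], of u] by (simp add: words_def)
  then obtain v where v: "v \<in> words {1..M} (n - m)" "measure \<nu> (cylinder M (u @ v)) > 0"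
    using sum_nonpos [of "words {1..M} (n - m)" "\<lambda>v. measure \<nu> (cylinder M (u @ v))"]
    by (force simp: not_less)
  have "word_matrix A (u @ v) = 0"
    using u(3) by (simp add: word_matrix_append matrix_matrix_mult_def vec_eq_iff)
  then show ?thesis
    using words_append [OF u(1) v(1)] v(2) assms(3) by (auto simp: charges_zero_def)
qed

lemma word_norm_pos:
  assumes "\<And>n. \<not> charges_zero M A \<nu> n" "set w \<subseteq> {1..M}" "measure \<nu> (cylinder M w) > 0"
  shows "matrix_norm (word_matrix A w) > 0"
  using assms(1) [of "length w"] assms(2,3) matrix_norm_nonneg [of "word_matrix A w"]
  by (auto simp: charges_zero_def words_def less_le matrix_norm_eq_0_iff)

lemma mean_log_norm_subadditive:
  assumes \<nu>: "\<nu> \<in> invariant_measures M" and nz: "\<And>n. \<not> charges_zero M A \<nu> n"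
  shows "mean_log_norm M A \<nu> (m + n) \<le> mean_log_norm M A \<nu> m + mean_log_norm M A \<nu> n"
proof -
  let ?f = "\<lambda>w. measure \<nu> (cylinder M w)" and ?N = "\<lambda>w. matrix_norm (word_matrix A w)"
  have f: "stationary {1..M} ?f" "finite {1..M}" using stationary_cylinder [OF \<nu>] by auto
  note N = word_norm_pos [of M A \<nu>, OF nz]
  have "mean_log_norm M A \<nu> (m + n) \<le> (\<Sum>w\<in>words {1..M} (m + n). ?f w * (ln (?N (take m w)) + ln (?N (drop m w))))"
    unfolding mean_log_norm_def
  proof (intro sum_mono)
    fix w assume "w \<in> words {1..M} (m + n)"
    then have s: "set w \<subseteq> {1..M}" "set (take m w) \<subseteq> {1..M}" "set (drop m w) \<subseteq> {1..M}"
      by (auto simp: words_def dest: in_set_takeD in_set_dropD)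
    show "?f w * ln (?N w) \<le> ?f w * (ln (?N (take m w)) + ln (?N (drop m w)))"
    proof (cases "?f w = 0")
      case False
      then have fw: "?f w > 0" by (simp add: less_le)
      then have "?f (take m w) > 0" "?f (drop m w) > 0"
        using stationary_append_le [OF f s(2,3)] by auto
      then have pos: "?N w > 0" "?N (take m w) > 0" "?N (drop m w) > 0"
        using N s fw by auto
      have "?N w \<le> ?N (drop m w) * ?N (take m w)"
        using matrix_norm_mult_le [of "word_matrix A (drop m w)" "word_matrix A (take m w)"]
        by (simp add: word_matrix_append [symmetric])
      then have "ln (?N w) \<le> ln (?N (drop m w) * ?N (take m w))"
        using pos by simp
      also have "\<dots> = ln (?N (take m w)) + ln (?N (drop m w))"
        using pos by (simp add: ln_mult)
      finally show ?thesis by (intro mult_left_mono) auto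
    qed simp
  qed
  also have "\<dots> = mean_log_norm M A \<nu> m + mean_log_norm M A \<nu> n"
    unfolding mean_log_norm_def
    by (rule stationary_sum_additive [OF f, where g = "\<lambda>w. ln (?N w)" and h = "\<lambda>w. ln (?N w)"])
  finally show ?thesis .
qed

lemma lyapunov_exponent_charges_zero:
  assumes \<nu>: "\<nu> \<in> invariant_measures M" and z: "charges_zero M A \<nu> m"
  shows "lyapunov_exponent A \<nu> = -\<infinity>"
proof -
  have "\<forall>\<^sub>F n in sequentially. -\<infinity> = ereal (1 / real n) * ereal_integral \<nu> (\<lambda>x. ln_ereal (matrix_norm (cocycle A x n)))"
    using eventually_ge_at_top [of "Suc m"]
  proof eventually_elim
    case (elim n)
    then have "charges_zero M A \<nu> n" by (intro charges_zero_mono [OF \<nu> z]) simp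
    then show ?case using elim by (simp add: ereal_integral_log_norm [OF \<nu>])
  qed
  then have "(\<lambda>n. ereal (1 / real n) * ereal_integral \<nu> (\<lambda>x. ln_ereal (matrix_norm (cocycle A x n)))) \<longlonglongrightarrow> -\<infinity>"
    by (rule tendsto_eventually [OF eventually_mono]) auto
  then show ?thesis unfolding lyapunov_exponent_def by (rule limI)
qed

lemma lyapunov_exponent_limit:
  assumes \<nu>: "\<nu> \<in> invariant_measures M" and nz: "\<And>n. \<not> charges_zero M A \<nu> n"
  shows "(\<lambda>n. ereal (mean_log_norm M A \<nu> n / real n)) \<longlonglongrightarrow> lyapunov_exponent A \<nu>"
    and "lyapunov_exponent A \<nu> \<noteq> \<infinity>"
proof -
  let ?I = "INF n\<in>{1..}. ereal (mean_log_norm M A \<nu> n / real n)"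
  have conv: "(\<lambda>n. ereal (mean_log_norm M A \<nu> n / real n)) \<longlonglongrightarrow> ?I"
    by (rule fekete [OF mean_log_norm_subadditive [OF \<nu> nz]])
  have "lyapunov_exponent A \<nu> = lim (\<lambda>n. ereal (mean_log_norm M A \<nu> n / real n))"
    unfolding lyapunov_exponent_def by (simp add: ereal_integral_log_norm [OF \<nu>] nz)
  also have "\<dots> = ?I" using conv by (rule limI)
  finally have eq: "lyapunov_exponent A \<nu> = ?I" .
  show "(\<lambda>n. ereal (mean_log_norm M A \<nu> n / real n)) \<longlonglongrightarrow> lyapunov_exponent A \<nu>"
    using conv by (simp only: eq)
  have "?I \<le> ereal (mean_log_norm M A \<nu> 1 / real 1)" by (rule INF_lower) simp
  then show "lyapunov_exponent A \<nu> \<noteq> \<infinity>" unfolding eq by auto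
qed

lemma card_words: "finite S \<Longrightarrow> card (words S n) = card S ^ n"
  unfolding words_def by (rule card_lists_length_eq)

text \<open>Uniform weights. Finiteness of the entropy matters because \<open>\<infinity> - \<infinity>\<close> would evaluate to \<open>\<infinity>\<close>.\<close>

lemma metric_entropy_le_ln_card:
  assumes \<nu>: "\<nu> \<in> invariant_measures M" and M: "M \<ge> 1"
  shows "metric_entropy M \<nu> \<le> ereal (ln (real M))"
proof (rule metric_entropy_le_coding_rate [OF \<nu>, where \<pi> = "\<lambda>w. 1 / real M ^ length w"])
  show "(\<Sum>w\<in>words {1..M} n. 1 / real M ^ length w) \<le> 1" for n
  proof -
    have "(\<Sum>w\<in>words {1..M} n. 1 / real M ^ length w) = (\<Sum>w\<in>words {1..M} n. 1 / real M ^ n)"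
      by (intro sum.cong) (auto simp: words_def)
    then show ?thesis using M by (simp add: card_words)
  qed
  have "(\<Sum>w\<in>words {1..M} n. - measure \<nu> (cylinder M w) * ln (1 / real M ^ length w)) = real n * ln (real M)" for n
  proof -
    have "(\<Sum>w\<in>words {1..M} n. - measure \<nu> (cylinder M w) * ln (1 / real M ^ length w))
        = (\<Sum>w\<in>words {1..M} n. measure \<nu> (cylinder M w)) * (real n * ln (real M))"
      unfolding sum_distrib_right using M
      by (intro sum.cong) (auto simp: words_def ln_div ln_realpow)
    then show ?thesis
      using stationary_sum_words [OF stationary_cylinder [OF \<nu>], of n] by (simp del: One_nat_def)
  qed
  then have "(\<Sum>w\<in>words {1..M} n. - measure \<nu> (cylinder M w) * ln (1 / real M ^ length w)) / real n = ln (real M)" if "n \<ge> 1" for n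
    using that by simp
  then show "(\<lambda>n. (\<Sum>w\<in>words {1..M} n. - measure \<nu> (cylinder M w) * ln (1 / real M ^ length w)) / real n) \<longlonglongrightarrow> ln (real M)"
    by (intro tendsto_eventually) (auto simp: eventually_sequentially)
qed (use M in auto)

text \<open>The quantity whose exponential growth rate is the pressure.\<close>

definition norm_sum :: "nat \<Rightarrow> (nat \<Rightarrow> real^'d^'d) \<Rightarrow> real \<Rightarrow> nat \<Rightarrow> real" where
  "norm_sum M A s n = (\<Sum>w\<in>words {1..M} n. matrix_norm (word_matrix A w) powr s)"

text \<open>Use the normalized weights \<open>\<parallel>A\<^sub>w\<parallel>\<^sup>s / (C R\<^sup>n)\<close> as code. If the Lyapunov exponent is \<open>-\<infinity>\<close> the bound is
  trivial, the entropy being finite.\<close>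

lemma variational_upper_bound:
  assumes M: "M \<ge> 1" and s: "s > 0" and \<nu>: "\<nu> \<in> invariant_measures M"
    and RC: "R > 0" "C > 0" "\<And>n. norm_sum M A s n \<le> C * R ^ n"
  shows "metric_entropy M \<nu> + ereal s * lyapunov_exponent A \<nu> \<le> ereal (ln R)"
proof (cases "lyapunov_exponent A \<nu> = -\<infinity>")
  case True
  then have "metric_entropy M \<nu> + ereal s * lyapunov_exponent A \<nu> = -\<infinity>"
    using metric_entropy_le_ln_card [OF \<nu> M] s by (cases "metric_entropy M \<nu>") auto
  then show ?thesis by (simp only: ereal_infty_less_eq2 ereal_less_eq)
next
  case False
  then have nz: "\<not> charges_zero M A \<nu> n" for n using lyapunov_exponent_charges_zero [OF \<nu>] by blast
  obtain l where l: "lyapunov_exponent A \<nu> = ereal l"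
    using False lyapunov_exponent_limit(2) [OF \<nu> nz] by (cases "lyapunov_exponent A \<nu>") auto
  have lim: "(\<lambda>n. mean_log_norm M A \<nu> n / real n) \<longlonglongrightarrow> l"
    using lyapunov_exponent_limit(1) [OF \<nu> nz] by (simp add: l)
  let ?f = "\<lambda>w. measure \<nu> (cylinder M w)" and ?N = "\<lambda>w. matrix_norm (word_matrix A w)"
  note N = word_norm_pos [of M A \<nu>, OF nz]
  have "metric_entropy M \<nu> \<le> ereal (ln R - s * l)"
  proof (rule metric_entropy_le_coding_rate [OF \<nu>, where \<pi> = "\<lambda>w. ?N w powr s / (C * R ^ length w)"])
    show "(\<Sum>w\<in>words {1..M} n. ?N w powr s / (C * R ^ length w)) \<le> 1" for n
    proof -
      have "(\<Sum>w\<in>words {1..M} n. ?N w powr s / (C * R ^ length w)) = norm_sum M A s n / (C * R ^ n)"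
        unfolding norm_sum_def sum_divide_distrib by (intro sum.cong) (auto simp: words_def)
      then show ?thesis using RC by (simp add: divide_le_eq)
    qed
    have sum: "(\<Sum>w\<in>words {1..M} n. - ?f w * ln (?N w powr s / (C * R ^ length w)))
        = ln C + real n * ln R - s * mean_log_norm M A \<nu> n" for n
    proof -
      have "- ?f w * ln (?N w powr s / (C * R ^ length w))
          = ?f w * (ln C + real n * ln R) - s * (?f w * ln (?N w))" if "w \<in> words {1..M} n" for w
      proof (cases "?f w = 0")
        case False
        then have "?f w > 0" by (simp add: less_le)
        then have "?N w > 0" using that by (intro N) (auto simp: words_def)
        then show ?thesis using RC that
          by (simp add: words_def ln_div ln_mult ln_powr ln_realpow algebra_simps)
      qed simp
      then have "(\<Sum>w\<in>words {1..M} n. - ?f w * ln (?N w powr s / (C * R ^ length w)))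
          = (\<Sum>w\<in>words {1..M} n. ?f w) * (ln C + real n * ln R) - s * mean_log_norm M A \<nu> n"
        by (simp add: sum_subtractf sum_distrib_left sum_distrib_right mean_log_norm_def)
      then show ?thesis
        using stationary_sum_words [OF stationary_cylinder [OF \<nu>], of n] by (simp del: One_nat_def)
    qed
    have "(\<lambda>n. ln C / real n + ln R - s * (mean_log_norm M A \<nu> n / real n)) \<longlonglongrightarrow> 0 + ln R - s * l"
      by (intro tendsto_intros lim lim_const_over_n)
    moreover have "ln C / real n + ln R - s * (mean_log_norm M A \<nu> n / real n)
        = (\<Sum>w\<in>words {1..M} n. - ?f w * ln (?N w powr s / (C * R ^ length w))) / real n" if "n \<ge> 1" for n
      using that unfolding sum by (simp add: field_simps)
    ultimately show "(\<lambda>n. (\<Sum>w\<in>words {1..M} n. - ?f w * ln (?N w powr s / (C * R ^ length w))) / real n) \<longlonglongrightarrow> ln R - s * l"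
      using Lim_transform_eventually [OF _ eventually_sequentiallyI [of 1]] by fastforce
  next
    show "?N w powr s / (C * R ^ length w) > 0" if "set w \<subseteq> {1..M}" "?f w > 0" for w
      using N [OF that] RC by simp
  qed (use RC in auto)
  then show ?thesis
    unfolding l by (cases "metric_entropy M \<nu>") auto
qed

text \<open>Taking logarithms, the bound on the cylinder weights makes the entropy large. Since the entropies
  of cylinders converge at a finite rate, the same inequality keeps the Lyapunov exponent of \<open>m\<close> above \<open>-\<infinity>\<close>.\<close>

lemma gibbs_imp_equilibrium_state:
  assumes M: "M \<ge> 1" and s: "s > 0" and m: "m \<in> invariant_measures M"
    and RC: "R > 0" "C > 0" "\<And>n. norm_sum M A s n \<le> C * R ^ n"
    and K: "\<And>w. set w \<subseteq> {1..M} \<Longrightarrow>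
      measure m (cylinder M w) \<le> K * matrix_norm (word_matrix A w) powr s / R ^ length w"
  shows "m \<in> equilibrium_states M A s"
proof -
  let ?f = "\<lambda>w. measure m (cylinder M w)" and ?N = "\<lambda>w. matrix_norm (word_matrix A w)"
  have f: "stationary {1..M} ?f" "finite {1..M}" using stationary_cylinder [OF m] by auto
  \<comment> \<open>A positive constant, so that its logarithm is meaningful.\<close>
  define K' where "K' = max K 1"
  have K': "K' > 0" "K \<le> K'" by (auto simp: K'_def)
  have N: "?N w > 0" if "set w \<subseteq> {1..M}" "?f w > 0" for w
  proof -
    have "?N w \<noteq> 0" using K [OF that(1)] that(2) by auto
    then show ?thesis using matrix_norm_nonneg [of "word_matrix A w"] by simp
  qed
  then have nz: "\<not> charges_zero M A m n" for n
    by (force simp: charges_zero_def words_def matrix_norm_eq_0_iff [THEN iffD2])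
  let ?H = "word_entropy {1..M} ?f" and ?L = "mean_log_norm M A m"
  obtain h where h: "(\<lambda>n. ?H n / real n) \<longlonglongrightarrow> h"
    using word_entropy_converges [OF f] by blast
  have low: "?H n \<ge> - ln K' + real n * ln R - s * ?L n" for n
  proof -
    have "?f w * (- ln K' + real n * ln R) - s * (?f w * ln (?N w)) \<le> - ?f w * ln (?f w)"
      if w: "w \<in> words {1..M} n" for w
    proof (cases "?f w = 0")
      case False
      then have fw: "?f w > 0" by (simp add: less_le)
      then have Nw: "?N w > 0" using w by (intro N) (auto simp: words_def)
      have "?f w \<le> K * ?N w powr s / R ^ n" using K [of w] w by (simp add: words_def)
      also have "\<dots> \<le> K' * ?N w powr s / R ^ n"
        using K' RC by (intro divide_right_mono mult_right_mono) auto
      finally have "ln (?f w) \<le> ln (K' * ?N w powr s / R ^ n)" using fw by simp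
      also have "\<dots> = ln K' + s * ln (?N w) - real n * ln R"
        using K' Nw RC by (simp add: ln_div ln_mult ln_powr ln_realpow)
      finally have "?f w * (- (ln K' + s * ln (?N w) - real n * ln R)) \<le> ?f w * (- ln (?f w))"
        using fw by (intro mult_left_mono) auto
      then show ?thesis by (simp add: algebra_simps)
    qed simp
    then have "(\<Sum>w\<in>words {1..M} n. ?f w * (- ln K' + real n * ln R) - s * (?f w * ln (?N w))) \<le> ?H n"
      unfolding word_entropy_def by (rule sum_mono)
    also have "(\<Sum>w\<in>words {1..M} n. ?f w * (- ln K' + real n * ln R) - s * (?f w * ln (?N w)))
        = (\<Sum>w\<in>words {1..M} n. ?f w) * (- ln K' + real n * ln R) - s * ?L n"
      by (simp add: sum_subtractf sum_distrib_left sum_distrib_right mean_log_norm_def)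
    finally show ?thesis using stationary_sum_words [OF f, of n] by (simp del: One_nat_def)
  qed
  have low': "(ln R - ln K' / real n - ?H n / real n) / s \<le> ?L n / real n" if "n \<ge> 1" for n
  proof -
    have "(- ln K' + real n * ln R - ?H n) / real n \<le> (s * ?L n) / real n"
      using low [of n] by (intro divide_right_mono) auto
    moreover have "(- ln K' + real n * ln R - ?H n) / real n = ln R - ln K' / real n - ?H n / real n"
      using that by (simp add: field_simps)
    ultimately show ?thesis using s by (simp add: field_simps)
  qed
  have lim_low: "(\<lambda>n. (ln R - ln K' / real n - ?H n / real n) / s) \<longlonglongrightarrow> (ln R - 0 - h) / s"
    using s by (intro tendsto_intros h lim_const_over_n) auto
  have "ereal ((ln R - 0 - h) / s) \<le> lyapunov_exponent A m"
  proof (rule tendsto_le [OF trivial_limit_sequentially lyapunov_exponent_limit(1) [OF m nz]])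
    show "(\<lambda>n. ereal ((ln R - ln K' / real n - ?H n / real n) / s)) \<longlonglongrightarrow> ereal ((ln R - 0 - h) / s)"
      using lim_low by simp
    show "\<forall>\<^sub>F n in sequentially. ereal ((ln R - ln K' / real n - ?H n / real n) / s) \<le> ereal (?L n / real n)"
      using low' by (auto simp: eventually_sequentially)
  qed
  then obtain l where l: "lyapunov_exponent A m = ereal l" "(ln R - h) / s \<le> l"
    using lyapunov_exponent_limit(2) [OF m nz] by (cases "lyapunov_exponent A m") auto
  have "ereal (ln R) \<le> ereal h + ereal s * ereal l"
    using l(2) s by (simp add: field_simps)
  also have "\<dots> \<le> metric_entropy M m + ereal s * lyapunov_exponent A m"
    unfolding l using cylinder_entropy_le_metric_entropy [OF m h] by (rule add_right_mono)
  finally have ge: "ereal (ln R) \<le> metric_entropy M m + ereal s * lyapunov_exponent A m" .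
  have "metric_entropy M m + ereal s * lyapunov_exponent A m
      = (SUP \<nu>\<in>invariant_measures M. metric_entropy M \<nu> + ereal s * lyapunov_exponent A \<nu>)"
  proof (rule antisym)
    show "metric_entropy M m + ereal s * lyapunov_exponent A m
      \<le> (SUP \<nu>\<in>invariant_measures M. metric_entropy M \<nu> + ereal s * lyapunov_exponent A \<nu>)"
      using m by (rule SUP_upper)
    show "(SUP \<nu>\<in>invariant_measures M. metric_entropy M \<nu> + ereal s * lyapunov_exponent A \<nu>)
      \<le> metric_entropy M m + ereal s * lyapunov_exponent A m"
      using variational_upper_bound [OF M s _ RC] ge by (intro SUP_least) (metis order_trans)
  qed
  with m show ?thesis by (simp add: equilibrium_states_def)
qed

section \<open>Measures determined by their cylinder weights\<close>

lemma sum_measure_cylinders: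
  assumes "prob_space \<nu>" "sets \<nu> = sets (shift_borel M)"
  shows "measure \<nu> (cylinder_union M k U) = (\<Sum>w\<in>words {1..M} k \<inter> U. measure \<nu> (cylinder M w))"
proof -
  interpret prob_space \<nu> by fact
  show ?thesis
    unfolding cylinder_union_eq_Union
  proof (rule finite_measure_finite_Union)
    show "finite (words {1..M} k \<inter> U)" by (simp add: finite_words)
    show "cylinder M ` (words {1..M} k \<inter> U) \<subseteq> sets \<nu>"
      using cylinder_sets by (auto simp: assms(2) words_def)
    show "disjoint_family_on (cylinder M) (words {1..M} k \<inter> U)"
      unfolding disjoint_family_on_def
      using itinerary_unique [OF partition_first_symbol] by (auto simp: words_def)
  qed
qed

lemma cylinder_union_Int:
  "cylinder_union M k U \<inter> cylinder_union M k' U'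
    = cylinder_union M (max k k') {w. take k w \<in> U \<and> take k' w \<in> U'}"
  by (auto simp: cylinder_union_def take_map)

text \<open>Finite unions of cylinders of a common length are stable under intersection and generate the
  sigma-algebra.\<close>

lemma measure_eqI_cylinders:
  assumes \<mu>: "prob_space \<mu>" "sets \<mu> = sets (shift_borel M)"
    and \<nu>: "prob_space \<nu>" "sets \<nu> = sets (shift_borel M)"
    and eq: "\<And>w. set w \<subseteq> {1..M} \<Longrightarrow> measure \<mu> (cylinder M w) = measure \<nu> (cylinder M w)"
  shows "\<mu> = \<nu>"
proof -
  interpret M: prob_space \<mu> by fact
  interpret N: prob_space \<nu> by fact
  let ?E = "range (\<lambda>(k, U). cylinder_union M k U)"
  let ?G = "{{f \<in> \<Pi>\<^sub>E i\<in>UNIV. space (count_space {1..M}). f i \<in> B} |i B. i \<in> (UNIV::nat set) \<and> B \<in> sets (count_space {1..M})}"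
  have space: "(\<Pi>\<^sub>E i\<in>UNIV. space (count_space {1..M})) = full_shift M"
    by (auto simp: full_shift_def PiE_def Pi_def extensional_def)
  have E_sub: "?E \<subseteq> sets (shift_borel M)" using cylinder_union_sets by auto
  have "?G \<subseteq> ?E"
  proof
    fix a assume "a \<in> ?G"
    then obtain i B where a: "a = {f \<in> full_shift M. f i \<in> B}" unfolding space by blast
    have "a = (\<lambda>(k, U). cylinder_union M k U) (Suc i, {w. w ! i \<in> B})"
      by (auto simp: a cylinder_union_def nth_append)
    then show "a \<in> ?E" by blast
  qed
  then have "sets (shift_borel M) \<subseteq> sigma_sets (full_shift M) ?E"
    unfolding sets_shift_borel sets_PiM_single unfolding space by (rule sigma_sets_mono')
  moreover have "sigma_sets (full_shift M) ?E \<subseteq> sets (shift_borel M)"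
    using sets.sigma_sets_subset [OF E_sub] by (simp add: space_shift_borel)
  ultimately have gen: "sets (shift_borel M) = sigma_sets (full_shift M) ?E" by (rule equalityI)
  show ?thesis
  proof (rule measure_eqI_generator_eq [where E = ?E and \<Omega> = "full_shift M" and A = "\<lambda>_. full_shift M"])
    show "Int_stable ?E"
      by (auto simp: Int_stable_def cylinder_union_Int)
    show "?E \<subseteq> Pow (full_shift M)" by (auto simp: cylinder_union_def)
    show "emeasure \<mu> X = emeasure \<nu> X" if X_in: "X \<in> ?E" for X
    proof -
      obtain k U where X: "X = cylinder_union M k U" using X_in by (fastforce simp: split_def)
      show ?thesis
        unfolding X M.emeasure_eq_measure N.emeasure_eq_measure
        by (simp add: sum_measure_cylinders [OF \<mu>] sum_measure_cylinders [OF \<nu>] eq words_def)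
    qed
    have "full_shift M = cylinder_union M 0 UNIV" by (auto simp: cylinder_union_def)
    then show "range (\<lambda>_. full_shift M) \<subseteq> ?E" by auto
  qed (auto simp: \<mu> \<nu> gen M.emeasure_eq_measure)
qed

text \<open>The preimage of a cylinder under the shift is the union over the possible first symbols.\<close>

lemma stationary_imp_invariant:
  assumes \<nu>: "prob_space \<nu>" "sets \<nu> = sets (shift_borel M)"
    and f: "stationary {1..M} f"
    and eq: "\<And>w. set w \<subseteq> {1..M} \<Longrightarrow> measure \<nu> (cylinder M w) = f w"
  shows "\<nu> \<in> invariant_measures M"
proof -
  interpret prob_space \<nu> by fact
  have space: "space \<nu> = full_shift M"
    using sets_eq_imp_space_eq [OF \<nu>(2)] by (simp add: space_shift_borel)
  have shift: "shift \<in> measurable \<nu> (shift_borel M)"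
    using shift_measurable [of M] by (simp only: measurable_cong_sets [OF \<nu>(2) refl])
  have "distr \<nu> (shift_borel M) shift = \<nu>"
  proof (rule measure_eqI_cylinders)
    show "prob_space (distr \<nu> (shift_borel M) shift)" by (rule prob_space_distr [OF shift])
    fix w assume w: "set w \<subseteq> {1..M}"
    have "measure (distr \<nu> (shift_borel M) shift) (cylinder M w) = measure \<nu> (shift -` cylinder M w \<inter> space \<nu>)"
      by (rule measure_distr [OF shift cylinder_sets [OF w]])
    also have "shift -` cylinder M w \<inter> space \<nu> = cylinder_union M (Suc (length w)) ((\<lambda>i. i # w) ` {1..M})"
    proof (intro equalityI subsetI)
      fix x assume "x \<in> shift -` cylinder M w \<inter> space \<nu>"
      then have x: "x \<in> full_shift M" "map (shift x) [0..<length w] = w"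
        using mem_cylinder_iff [OF shift_in_full_shift, of x M w] by (auto simp: space)
      have "map x [0..<Suc (length w)] = x 0 # map (shift x) [0..<length w]"
        by (subst upt_conv_Cons) (simp_all add: shift_def map_Suc_upt [symmetric] del: upt_Suc)
      then show "x \<in> cylinder_union M (Suc (length w)) ((\<lambda>i. i # w) ` {1..M})"
        using x by (auto simp: cylinder_union_def full_shift_def simp del: upt_Suc)
    next
      fix x assume "x \<in> cylinder_union M (Suc (length w)) ((\<lambda>i. i # w) ` {1..M})"
      then have x: "x \<in> full_shift M" "map x [0..<Suc (length w)] \<in> (\<lambda>i. i # w) ` {1..M}"
        by (auto simp: cylinder_union_def simp del: upt_Suc)
      have "map x [0..<Suc (length w)] = x 0 # map (shift x) [0..<length w]"
        by (subst upt_conv_Cons) (simp_all add: shift_def map_Suc_upt [symmetric] del: upt_Suc)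
      then show "x \<in> shift -` cylinder M w \<inter> space \<nu>"
        using x mem_cylinder_iff [OF shift_in_full_shift, of x M w] by (auto simp: space simp del: upt_Suc)
    qed
    also have "measure \<nu> \<dots> = (\<Sum>v\<in>(\<lambda>i. i # w) ` {1..M}. measure \<nu> (cylinder M v))"
      unfolding sum_measure_cylinders [OF \<nu>] using w by (intro sum.cong) (auto simp: words_def)
    also have "\<dots> = (\<Sum>i\<in>{1..M}. f (i # w))"
      using w by (subst sum.reindex) (auto simp: inj_on_def eq)
    also have "\<dots> = measure \<nu> (cylinder M w)"
      using stationaryD(4) [OF f w] eq [OF w] by simp
    finally show "measure (distr \<nu> (shift_borel M) shift) (cylinder M w) = measure \<nu> (cylinder M w)" .
  qed (use \<nu> in auto)
  then show ?thesis using \<nu> by (simp add: invariant_measures_def)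
qed

lemma bernoulli_cylinder:
  assumes p: "prob_space p" "sets p = Pow {1..M}" and w: "set w \<subseteq> {1..M}"
  shows "measure (\<Pi>\<^sub>M n\<in>(UNIV::nat set). p) (cylinder M w) = (\<Prod>i<length w. measure p {w ! i})"
proof -
  interpret p: prob_space p by fact
  interpret product_prob_space "\<lambda>_::nat. p" UNIV by standard
  have sp: "space p = {1..M}" using sets_eq_imp_space_eq [of p "count_space {1..M}"] p(2) by simp
  let ?J = "{..<length w}"
  have in_S: "w ! i \<in> {1..M}" if "i < length w" for i using w that nth_mem by blast
  have "cylinder M w = prod_emb UNIV (\<lambda>_. p) ?J (\<Pi>\<^sub>E i\<in>?J. {w ! i})"
    unfolding cylinder_eq prod_emb_def by (auto simp: sp full_shift_def space_PiM PiE_iff restrict_def extensional_def)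
  also have "measure (\<Pi>\<^sub>M n\<in>(UNIV::nat set). p) \<dots> = (\<Prod>i\<in>?J. measure p {w ! i})"
    using in_S by (intro measure_PiM_emb) (auto simp: p(2))
  finally show ?thesis .
qed

lemma bernoulli_prob_space:
  assumes p: "prob_space p" "sets p = Pow {1..M}"
  shows "prob_space (\<Pi>\<^sub>M n\<in>(UNIV::nat set). p)"
    and "sets (\<Pi>\<^sub>M n\<in>(UNIV::nat set). p) = sets (shift_borel M)"
proof -
  show "prob_space (\<Pi>\<^sub>M n\<in>(UNIV::nat set). p)" using p(1) by (intro prob_space_PiM)
  show "sets (\<Pi>\<^sub>M n\<in>(UNIV::nat set). p) = sets (shift_borel M)"
    unfolding sets_shift_borel by (intro sets_PiM_cong) (simp_all add: p(2))
qed

lemma stationary_product: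
  assumes p: "\<And>i. i \<in> S \<Longrightarrow> q i \<ge> 0" "(\<Sum>i\<in>S. q i) = (1::real)"
  shows "stationary S (\<lambda>w. \<Prod>i<length w. q (w ! i))"
  unfolding stationary_def
proof (intro conjI allI impI)
  fix w assume w: "set w \<subseteq> S"
  show "0 \<le> (\<Prod>i<length w. q (w ! i))"
    using w by (intro prod_nonneg) (auto intro!: p simp: nth_mem subsetD)
  have "(\<Prod>i<length (w @ [a]). q ((w @ [a]) ! i)) = (\<Prod>i<length w. q (w ! i)) * q a" for a
    by (simp add: nth_append)
  then show "(\<Sum>a\<in>S. \<Prod>i<length (w @ [a]). q ((w @ [a]) ! i)) = (\<Prod>i<length w. q (w ! i))"
    by (simp only: sum_distrib_left [symmetric] p mult_1_right)
  have "(\<Prod>i<length (a # w). q ((a # w) ! i)) = q a * (\<Prod>i<length w. q (w ! i))" for a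
    by (simp add: prod.lessThan_Suc_shift del: prod.lessThan_Suc)
  then show "(\<Sum>a\<in>S. \<Prod>i<length (a # w). q ((a # w) ! i)) = (\<Prod>i<length w. q (w ! i))"
    by (simp only: sum_distrib_right [symmetric] p mult_1_left)
qed simp

lemma bernoulli_exists:
  assumes q: "\<And>i. i \<in> {1..M} \<Longrightarrow> q i \<ge> 0" "(\<Sum>i\<in>{1..M}. q i) = (1::real)"
  obtains \<mu> where "bernoulli_measure M \<mu>" "\<mu> \<in> invariant_measures M"
    "\<And>w. set w \<subseteq> {1..M} \<Longrightarrow> measure \<mu> (cylinder M w) = (\<Prod>i<length w. q (w ! i))"
proof -
  define p where "p = point_measure {1..M} (\<lambda>i. ennreal (q i))"
  have p: "prob_space p" "sets p = Pow {1..M}"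
  proof -
    have "(\<Sum>i\<in>{1..M}. ennreal (q i)) = 1"
      using q by (subst sum_ennreal) auto
    then show "prob_space p" unfolding p_def by (intro prob_space_point_measure) auto
    show "sets p = Pow {1..M}" by (simp only: p_def sets_point_measure)
  qed
  have mp: "measure p {i} = q i" if "i \<in> {1..M}" for i
    using that q(1) unfolding p_def measure_def by (subst emeasure_point_measure_finite) auto
  let ?\<mu> = "\<Pi>\<^sub>M n\<in>(UNIV::nat set). p"
  have cyl: "measure ?\<mu> (cylinder M w) = (\<Prod>i<length w. q (w ! i))" if w: "set w \<subseteq> {1..M}" for w
  proof -
    have "w ! i \<in> {1..M}" if "i < length w" for i using w that nth_mem by blast
    then show ?thesis unfolding bernoulli_cylinder [OF p w] by (intro prod.cong refl mp) auto
  qed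
  show thesis
  proof (rule that [OF _ _ cyl])
    show "bernoulli_measure M ?\<mu>" using p by (auto simp: bernoulli_measure_def)
    show "?\<mu> \<in> invariant_measures M"
      by (rule stationary_imp_invariant [OF bernoulli_prob_space [OF p] stationary_product [OF q] cyl])
  qed
qed

text \<open>A measure with prescribed cylinder weights is obtained from Lebesgue measure on \<open>[0,1)\<close>: the unit
  interval is cut successively into intervals of length \<open>f w\<close>, in lexicographic order, and a number is sent
  to the sequence of intervals containing it. This is the left end point of the interval of \<open>w\<close>: the total length
  of all intervals branching off to the left.\<close>

definition code_left :: "(nat list \<Rightarrow> real) \<Rightarrow> nat list \<Rightarrow> real" where
  "code_left f w = (\<Sum>k<length w. \<Sum>i\<in>{1..<w ! k}. f (take k w @ [i]))"

definition code_interval :: "(nat list \<Rightarrow> real) \<Rightarrow> nat list \<Rightarrow> real set" where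
  "code_interval f w = {code_left f w ..< code_left f w + f w}"

lemma code_left_snoc: "code_left f (w @ [j]) = code_left f w + (\<Sum>i\<in>{1..<j}. f (w @ [i]))"
  by (simp add: code_left_def nth_append)

lemma ex1_level_crossing:
  fixes g :: "nat \<Rightarrow> real"
  assumes "\<And>j. j < M \<Longrightarrow> g j \<le> g (Suc j)" "g 0 \<le> t" "t < g M"
  shows "\<exists>!j. j \<in> {1..M} \<and> g (j - 1) \<le> t \<and> t < g j"
proof -
  define j where "j = (LEAST j. t < g j)"
  have j: "t < g j" unfolding j_def using assms(3) by (rule LeastI)
  have jM: "j \<le> M" unfolding j_def using assms(3) by (rule Least_le)
  have j0: "j \<noteq> 0" using j assms(2) by (metis not_less)
  then have "\<not> t < g (j - 1)" using not_less_Least [of "j - 1" "\<lambda>j. t < g j"] by (simp add: j_def)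
  moreover have mono: "g a \<le> g b" if "a \<le> b" "b \<le> M" for a b
    using that by (induction rule: dec_induct) (use assms(1) in \<open>auto intro: order_trans\<close>)
  have "i = j" if i: "i \<in> {1..M}" "g (i - 1) \<le> t" "t < g i" for i
  proof (rule ccontr)
    assume "i \<noteq> j"
    then consider "i \<le> j - 1" | "j \<le> i - 1" by linarith
    then show False
    proof cases
      case 1
      moreover have "j - 1 \<le> M" using jM by linarith
      ultimately have "g i \<le> g (j - 1)" by (rule mono)
      then show False using i(3) \<open>\<not> t < g (j - 1)\<close> by linarith
    next
      case 2
      moreover have "i - 1 \<le> M" using i(1) by auto
      ultimately have "g j \<le> g (i - 1)" by (rule mono)
      then show False using i(2) j by linarith
    qed
  qed
  ultimately show ?thesis using j jM j0 by (intro ex1I [of _ j]) auto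
qed

lemma code_interval_step:
  assumes f: "stationary {1..M} f" and w: "set w \<subseteq> {1..M}" and t: "t \<in> code_interval f w"
  shows "\<exists>!j. j \<in> {1..M} \<and> t \<in> code_interval f (w @ [j])"
proof -
  let ?g = "\<lambda>j. code_left f w + (\<Sum>i\<in>{1..j}. f (w @ [i]))"
  have "\<exists>!j. j \<in> {1..M} \<and> ?g (j - 1) \<le> t \<and> t < ?g j"
  proof (rule ex1_level_crossing)
    show "?g j \<le> ?g (Suc j)" if "j < M" for j
      using stationaryD(2) [OF f, of "w @ [Suc j]"] w that by simp
    show "t < ?g M" using t stationaryD(3) [OF f w] by (simp add: code_interval_def)
  qed (use t in \<open>simp add: code_interval_def\<close>)
  moreover have "(?g (j - 1) \<le> t \<and> t < ?g j) \<longleftrightarrow> t \<in> code_interval f (w @ [j])" if j: "j \<in> {1..M}" for j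
  proof -
    have "{1..j - 1} = {1..<j}" "{1..j} = insert j {1..<j}" using j by auto
    then show ?thesis by (auto simp: code_interval_def code_left_snoc)
  qed
  ultimately show ?thesis by (metis (no_types, lifting))
qed

lemma code_interval_prefix:
  assumes f: "stationary {1..M} f" and w: "set w \<subseteq> {1..M}" "j \<in> {1..M}"
    and t: "t \<in> code_interval f (w @ [j])"
  shows "t \<in> code_interval f w"
proof -
  have nn: "f (w @ [i]) \<ge> 0" if "i \<in> {1..M}" for i
    using stationaryD(2) [OF f, of "w @ [i]"] w that by simp
  have "(\<Sum>i\<in>{1..<j}. f (w @ [i])) \<ge> 0" using nn w by (intro sum_nonneg) auto
  moreover have "(\<Sum>i\<in>{1..<j}. f (w @ [i])) + f (w @ [j]) \<le> f w"
  proof -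
    have "(\<Sum>i\<in>{1..<j}. f (w @ [i])) + f (w @ [j]) = (\<Sum>i\<in>insert j {1..<j}. f (w @ [i]))" by simp
    also have "\<dots> \<le> (\<Sum>i\<in>{1..M}. f (w @ [i]))" using nn w by (intro sum_mono2) auto
    finally show ?thesis using stationaryD(3) [OF f w(1)] by simp
  qed
  ultimately show ?thesis using t by (simp add: code_interval_def code_left_snoc)
qed

lemma code_word_ex1:
  assumes f: "stationary {1..M} f" and t: "t \<in> {0..<1}"
  shows "\<exists>!w. w \<in> words {1..M} n \<and> t \<in> code_interval f w"
proof (induction n)
  case 0
  then show ?case using t stationaryD(1) [OF f]
    by (intro ex1I [of _ "[]"]) (simp_all add: code_interval_def code_left_def)
next
  case (Suc n)
  then obtain w where w: "w \<in> words {1..M} n" "t \<in> code_interval f w"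
    and uw: "\<And>v. v \<in> words {1..M} n \<Longrightarrow> t \<in> code_interval f v \<Longrightarrow> v = w" by blast
  have ws: "set w \<subseteq> {1..M}" using w by (simp add: words_def)
  obtain j where j: "j \<in> {1..M}" "t \<in> code_interval f (w @ [j])"
    and uj: "\<And>i. i \<in> {1..M} \<Longrightarrow> t \<in> code_interval f (w @ [i]) \<Longrightarrow> i = j"
    using code_interval_step [OF f ws w(2)] by blast
  show ?case
  proof (rule ex1I [of _ "w @ [j]"])
    show "w @ [j] \<in> words {1..M} (Suc n) \<and> t \<in> code_interval f (w @ [j])"
      using w j by (auto simp: words_def)
    fix v assume v: "v \<in> words {1..M} (Suc n) \<and> t \<in> code_interval f v"
    then obtain u i where u: "v = u @ [i]" by (cases v rule: rev_cases) (auto simp: words_def)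
    then have us: "u \<in> words {1..M} n" "i \<in> {1..M}" using v by (auto simp: words_def)
    then have "u = w"
      using v code_interval_prefix [OF f, of u i t] by (intro uw) (auto simp: u words_def)
    then show "v = w @ [j]" using uj us v by (simp add: u)
  qed
qed

text \<open>The measure is the image of Lebesgue measure under the coding described above.\<close>

lemma stationary_extends_to_measure:
  assumes f: "stationary {1..M} f"
  obtains \<nu> where "\<nu> \<in> invariant_measures M" "\<And>w. set w \<subseteq> {1..M} \<Longrightarrow> measure \<nu> (cylinder M w) = f w"
proof -
  define L where "L = restrict_space lborel {0..<1::real}"
  have space_L: "space L = {0..<1}" by (simp add: L_def space_restrict_space)
  have sets_L: "B \<in> sets L" if "B \<in> sets borel" "B \<subseteq> {0..<1}" for B
    using that by (auto simp: L_def sets_restrict_space_iff)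
  have emeasure_L: "emeasure L B = emeasure lborel B" if "B \<subseteq> {0..<1}" for B
    using that by (auto simp: L_def emeasure_restrict_space)
  interpret L: prob_space L
    by (rule prob_spaceI) (simp add: space_L emeasure_L)
  define word where "word t n = (THE w. w \<in> words {1..M} n \<and> t \<in> code_interval f w)" for t n
  have word: "word t n \<in> words {1..M} n" "t \<in> code_interval f (word t n)" if "t \<in> {0..<1}" for t n
    using theI' [OF code_word_ex1 [OF f that, of n]] by (auto simp: word_def)
  have word_eq: "word t n = w" if "t \<in> {0..<1}" "w \<in> words {1..M} n" "t \<in> code_interval f w" for t n w
    using the1_equality [OF code_word_ex1 [OF f that(1), of n]] that by (simp add: word_def)
  define X where "X t n = last (word t (Suc n))" for t n
  have word_Suc: "word t (Suc n) = word t n @ [X t n]" "X t n \<in> {1..M}" if t: "t \<in> {0..<1}" for t n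
  proof -
    obtain u i where u: "word t (Suc n) = u @ [i]"
      using word(1) [OF t, of "Suc n"] by (cases "word t (Suc n)" rule: rev_cases) (auto simp: words_def)
    then have us: "u \<in> words {1..M} n" "i \<in> {1..M}"
      using word(1) [OF t, of "Suc n"] by (auto simp: words_def)
    have "t \<in> code_interval f u"
      using word(2) [OF t, of "Suc n"] us code_interval_prefix [OF f, of u i t] by (simp add: u words_def)
    then have "word t n = u" using us by (intro word_eq [OF t])
    then show "word t (Suc n) = word t n @ [X t n]" "X t n \<in> {1..M}"
      using us by (simp_all add: X_def u)
  qed
  have map_X: "map (X t) [0..<n] = word t n" if t: "t \<in> {0..<1}" for t n
  proof (induction n)
    case 0
    then show ?case using word(1) [OF t, of 0] by simp
  qed (simp add: word_Suc [OF t])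
  have X_full: "X t \<in> full_shift M" if "t \<in> {0..<1}" for t
    using word_Suc(2) [OF that] by (simp add: full_shift_def)
  have preimage: "{t \<in> {0..<1}. X t \<in> cylinder M w} = code_interval f w \<inter> {0..<1}" if w: "set w \<subseteq> {1..M}" for w
  proof -
    have "X t \<in> cylinder M w \<longleftrightarrow> t \<in> code_interval f w" if t: "t \<in> {0..<1}" for t
      unfolding mem_cylinder_iff [OF X_full [OF t]] map_X [OF t]
      using word(2) [OF t, of "length w"] word_eq [OF t, of w "length w"] w by (auto simp: words_def)
    then show ?thesis by blast
  qed
  have sub: "code_interval f w \<subseteq> {0..<1}" if w: "set w \<subseteq> {1..M}" for w
    using w
  proof (induction w rule: rev_induct)
    case Nil
    then show ?case using stationaryD(1) [OF f] by (simp add: code_interval_def code_left_def)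
  next
    case (snoc j w)
    then show ?case using code_interval_prefix [OF f, of w j] by auto
  qed
  have "X \<in> measurable L (\<Pi>\<^sub>M n\<in>(UNIV::nat set). count_space {1..M})"
  proof (rule measurable_PiM_single')
    fix n
    show "(\<lambda>t. X t n) \<in> measurable L (count_space {1..M})"
      unfolding measurable_count_space_eq2 [OF finite_atLeastAtMost]
    proof (intro conjI ballI)
      show "(\<lambda>t. X t n) \<in> space L \<rightarrow> {1..M}" using word_Suc(2) by (auto simp: space_L)
      fix j assume j: "j \<in> {1..M}"
      have "(\<lambda>t. X t n) -` {j} \<inter> space L = (\<Union>w\<in>words {1..M} n. code_interval f (w @ [j]) \<inter> {0..<1})"
      proof (intro equalityI subsetI)
        fix t assume "t \<in> (\<lambda>t. X t n) -` {j} \<inter> space L"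
        then have t: "t \<in> {0..<1}" "X t n = j" by (auto simp: space_L)
        then have "word t n \<in> words {1..M} n" "t \<in> code_interval f (word t n @ [j])"
          using word [OF t(1)] word_Suc(1) [OF t(1), of n] by auto (metis word(2))
        then show "t \<in> (\<Union>w\<in>words {1..M} n. code_interval f (w @ [j]) \<inter> {0..<1})" using t by blast
      next
        fix t assume "t \<in> (\<Union>w\<in>words {1..M} n. code_interval f (w @ [j]) \<inter> {0..<1})"
        then obtain w where w: "w \<in> words {1..M} n" "t \<in> code_interval f (w @ [j])" "t \<in> {0..<1}" by blast
        have "word t (Suc n) = w @ [j]" using w j by (intro word_eq) (auto simp: words_def)
        then show "t \<in> (\<lambda>t. X t n) -` {j} \<inter> space L" using w(3) by (simp add: X_def space_L)
      qed
      also have "\<dots> \<in> sets L"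
        by (intro sets.finite_UN finite_words sets_L) (auto simp: code_interval_def)
      finally show "(\<lambda>t. X t n) -` {j} \<inter> space L \<in> sets L" .
    qed
  qed (use X_full in \<open>auto simp: space_L full_shift_def PiE_def\<close>)
  then have X: "X \<in> measurable L (shift_borel M)"
    by (simp only: measurable_cong_sets [OF refl sets_shift_borel])
  let ?\<nu> = "distr L (shift_borel M) X"
  have prob: "prob_space ?\<nu>" by (rule L.prob_space_distr [OF X])
  have cyl: "measure ?\<nu> (cylinder M w) = f w" if w: "set w \<subseteq> {1..M}" for w
  proof -
    have "measure ?\<nu> (cylinder M w) = measure L (X -` cylinder M w \<inter> space L)"
      by (rule measure_distr [OF X cylinder_sets [OF w]])
    also have "X -` cylinder M w \<inter> space L = code_interval f w"
      using preimage [OF w] sub [OF w] by (auto simp: space_L)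
    also have "measure L (code_interval f w) = f w"
      using emeasure_L [OF sub [OF w]] stationaryD(2) [OF f w]
      by (simp add: measure_def code_interval_def)
    finally show ?thesis .
  qed
  show thesis
    by (rule that [OF stationary_imp_invariant [OF prob _ f cyl] cyl]) auto
qed

section \<open>Quasi-multiplicativity of irreducible tuples\<close>

text \<open>The vectors \<open>A\<^sub>k x\<close> span an invariant subspace.\<close>

lemma irreducible_orbit_nonorthogonal:
  fixes A :: "nat \<Rightarrow> real^'d^'d"
  assumes irr: "irreducible_tuple M A" and x: "x \<noteq> 0" and y: "y \<noteq> 0"
  shows "\<exists>k. set k \<subseteq> {1..M} \<and> y \<bullet> (word_matrix A k *v x) \<noteq> 0"
proof (rule ccontr)
  assume neg: "\<not> ?thesis"
  let ?O = "(\<lambda>k. word_matrix A k *v x) ` {k. set k \<subseteq> {1..M}}"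
  have "span ?O = UNIV"
  proof (rule irreducible_invariant_subspace [OF irr subspace_span])
    fix i u assume i: "i \<in> {1..M}" and "u \<in> span ?O"
    from this(2) show "A i *v u \<in> span ?O"
    proof (induction rule: span_induct_alt)
      case (step c z u)
      then obtain k where k: "set k \<subseteq> {1..M}" "z = word_matrix A k *v x" by blast
      have "A i *v z = word_matrix A (k @ [i]) *v x"
        by (simp add: k word_matrix_append matrix_vector_mul_assoc)
      then have "A i *v z \<in> span ?O"
        using k i by (intro span_base) (auto intro!: image_eqI [of _ _ "k @ [i]"])
      then show ?case
        using step by (simp add: matrix_vector_right_distrib matrix_vector_mult_scaleR_right span_add span_scale)
    qed (simp add: span_zero)
  next
    show "x \<in> span ?O" by (intro span_base image_eqI [of _ _ "[]"]) auto
  qed (rule x)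
  moreover have "y \<bullet> u = 0" if "u \<in> span ?O" for u
    using that
  proof (induction rule: span_induct_alt)
    case (step c z u)
    then show ?case using neg by (auto simp: inner_add_right)
  qed simp
  ultimately have "y \<bullet> y = 0" by blast
  then show False using y by simp
qed

lemma matrix_norm_le_bound:
  assumes "\<And>v. norm (B *v v) \<le> c * norm v"
  shows "matrix_norm B \<le> c"
  unfolding matrix_norm_def using assms by (rule onorm_le)

text \<open>From \<open>\<parallel>B v\<parallel>\<^sup>2 = \<langle>v, B\<^sup>T B v\<rangle>\<close> and the Cauchy-Schwarz inequality.\<close>

lemma matrix_norm_transpose_ge: "matrix_norm B \<le> matrix_norm (transpose (B :: real^'d^'d))"
proof (rule matrix_norm_le_bound)
  fix v
  show "norm (B *v v) \<le> matrix_norm (transpose B) * norm v"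
  proof (cases "B *v v = 0")
    case True
    then show ?thesis using matrix_norm_nonneg [of "transpose B"] by simp
  next
    case False
    have "norm (B *v v) * norm (B *v v) = v \<bullet> (transpose B *v (B *v v))"
      by (subst inner_commute)
        (simp add: dot_lmul_matrix power2_norm_eq_inner [symmetric] power2_eq_square)
    also have "\<dots> \<le> norm v * norm (transpose B *v (B *v v))" by (rule norm_cauchy_schwarz)
    also have "\<dots> \<le> norm v * (matrix_norm (transpose B) * norm (B *v v))"
      by (intro mult_left_mono norm_mult_le_matrix_norm) auto
    finally have "norm (B *v v) * norm (B *v v) \<le> (matrix_norm (transpose B) * norm v) * norm (B *v v)"
      by (simp add: mult_ac)
    then show ?thesis using False by simp
  qed
qed

text \<open>By \<open>irreducible_orbit_nonorthogonal\<close> and compactness of pairs of unit vectors, finitely many words \<open>k\<close> suffice to keep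
  the sum of \<open>|\<langle>y, A\<^sub>k x\<rangle>|\<close> bounded away from zero. Apply this to \<open>x = C v\<close> and \<open>y = B\<^sup>T z\<close>.\<close>

lemma quasi_multiplicative:
  fixes A :: "nat \<Rightarrow> real^'d^'d"
  assumes irr: "irreducible_tuple M A"
  obtains F d where "finite F" "\<And>k. k \<in> F \<Longrightarrow> set k \<subseteq> {1..M}" "d > 0"
    "\<And>B C. d * (matrix_norm B * matrix_norm C) \<le> (\<Sum>k\<in>F. matrix_norm (B ** word_matrix A k ** C))"
proof -
  let ?S = "sphere (0 :: real^'d) 1 \<times> sphere (0 :: real^'d) 1"
  let ?h = "\<lambda>k p. snd p \<bullet> (word_matrix A k *v fst p)"
  have cont: "continuous_on UNIV (?h k)" for k
    by (intro continuous_intros linear_continuous_on_compose [OF continuous_on_fst]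
        matrix_vector_mul_linear)
  have comp: "compact ?S" by (intro compact_Times) auto
  have cover0: "?S \<subseteq> (\<Union>k\<in>{k. set k \<subseteq> {1..M}}. {p. ?h k p \<noteq> 0})"
  proof
    fix p assume p: "p \<in> ?S"
    then have "fst p \<noteq> 0" "snd p \<noteq> 0" by auto
    then show "p \<in> (\<Union>k\<in>{k. set k \<subseteq> {1..M}}. {p. ?h k p \<noteq> 0})"
      using irreducible_orbit_nonorthogonal [OF irr, of "fst p" "snd p"] by blast
  qed
  have opens: "open {p. ?h k p \<noteq> 0}" for k
    by (intro open_Collect_neq cont continuous_on_const)
  obtain F where F: "F \<subseteq> {k. set k \<subseteq> {1..M}}" "finite F"
    and cover: "?S \<subseteq> (\<Union>k\<in>F. {p. ?h k p \<noteq> 0})"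
    by (rule compactE_image [OF comp opens cover0])
  define g where "g p = (\<Sum>k\<in>F. \<bar>?h k p\<bar>)" for p
  have g_pos: "g p > 0" if "p \<in> ?S" for p
  proof -
    obtain k where k: "k \<in> F" "?h k p \<noteq> 0" using cover \<open>p \<in> ?S\<close> by blast
    then have "0 < \<bar>?h k p\<bar>" by simp
    also have "\<dots> \<le> g p" unfolding g_def using F(2) k(1) by (intro member_le_sum) auto
    finally show ?thesis .
  qed
  have "continuous_on ?S g"
    unfolding g_def by (intro continuous_intros continuous_on_subset [OF cont] subset_UNIV)
  moreover have "?S \<noteq> {}"
  proof -
    have "(axis undefined 1, axis undefined 1) \<in> ?S" by (simp add: norm_axis_1)
    then show ?thesis by blast
  qed
  ultimately obtain p0 where p0: "p0 \<in> ?S" "\<And>p. p \<in> ?S \<Longrightarrow> g p0 \<le> g p"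
    using continuous_attains_inf [OF comp] by blast
  define d where "d = g p0"
  have d: "d > 0" unfolding d_def by (rule g_pos [OF p0(1)])
  have hom: "d * (norm c * norm b) \<le> (\<Sum>k\<in>F. \<bar>b \<bullet> (word_matrix A k *v c)\<bar>)" for b c
  proof (cases "b = 0 \<or> c = 0")
    case True
    then show ?thesis by (auto intro: sum_nonneg)
  next
    case False
    let ?p = "(inverse (norm c) *\<^sub>R c, inverse (norm b) *\<^sub>R b)"
    have "d \<le> g ?p" unfolding d_def using False by (intro p0(2)) simp
    also have "g ?p = inverse (norm c) * inverse (norm b) * (\<Sum>k\<in>F. \<bar>b \<bullet> (word_matrix A k *v c)\<bar>)"
      unfolding g_def sum_distrib_left by (simp add: matrix_vector_mult_scaleR_right abs_mult mult_ac)
    finally show ?thesis using False by (simp add: field_simps)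
  qed
  show thesis
  proof (rule that [OF F(2) _ d])
    show "set k \<subseteq> {1..M}" if "k \<in> F" for k using F(1) that by blast
    fix B C :: "real^'d^'d"
    let ?D = "\<Sum>k\<in>F. matrix_norm (B ** word_matrix A k ** C)"
    have D: "?D \<ge> 0" by (intro sum_nonneg matrix_norm_nonneg)
    have bound: "d * (norm (C *v x) * norm (transpose B *v z)) \<le> ?D * norm x * norm z" for x z
    proof -
      have "d * (norm (C *v x) * norm (transpose B *v z))
          \<le> (\<Sum>k\<in>F. \<bar>(transpose B *v z) \<bullet> (word_matrix A k *v (C *v x))\<bar>)"
        by (rule hom)
      also have "\<dots> \<le> (\<Sum>k\<in>F. matrix_norm (B ** word_matrix A k ** C) * norm x * norm z)"
      proof (intro sum_mono)
        fix k
        have "(transpose B *v z) \<bullet> (word_matrix A k *v (C *v x)) = z \<bullet> ((B ** word_matrix A k ** C) *v x)"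
          by (simp add: dot_lmul_matrix vector_transpose_matrix matrix_vector_mul_assoc matrix_mul_assoc)
        then have "\<bar>(transpose B *v z) \<bullet> (word_matrix A k *v (C *v x))\<bar>
            \<le> norm z * norm ((B ** word_matrix A k ** C) *v x)"
          using Cauchy_Schwarz_ineq2 by metis
        also have "\<dots> \<le> norm z * (matrix_norm (B ** word_matrix A k ** C) * norm x)"
          by (intro mult_left_mono norm_mult_le_matrix_norm) auto
        finally show "\<bar>(transpose B *v z) \<bullet> (word_matrix A k *v (C *v x))\<bar>
            \<le> matrix_norm (B ** word_matrix A k ** C) * norm x * norm z"
          by (simp add: mult_ac)
      qed
      finally show ?thesis by (simp add: sum_distrib_right)
    qed
    have 1: "d * norm (transpose B *v z) * matrix_norm C \<le> ?D * norm z" for z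
    proof (cases "transpose B *v z = 0")
      case False
      then have pos: "d * norm (transpose B *v z) > 0" using d by simp
      have "matrix_norm C \<le> ?D * norm z / (d * norm (transpose B *v z))"
        by (rule matrix_norm_le_bound) (use bound pos in \<open>simp add: field_simps\<close>)
      then show ?thesis using pos by (simp add: field_simps)
    qed (use D in simp)
    have "d * matrix_norm C * matrix_norm (transpose B) \<le> ?D"
    proof (cases "matrix_norm C = 0")
      case False
      then have pos: "d * matrix_norm C > 0" using d matrix_norm_nonneg [of C] by simp
      have "matrix_norm (transpose B) \<le> ?D / (d * matrix_norm C)"
        by (rule matrix_norm_le_bound) (use 1 pos in \<open>simp add: field_simps\<close>)
      then show ?thesis using pos by (simp add: field_simps)
    qed (use D in simp)
    moreover have "d * matrix_norm C * matrix_norm B \<le> d * matrix_norm C * matrix_norm (transpose B)"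
      using d by (intro mult_left_mono matrix_norm_transpose_ge) (simp add: matrix_norm_nonneg)
    ultimately show "d * (matrix_norm B * matrix_norm C) \<le> ?D" by (simp add: mult_ac)
  qed
qed

text \<open>At least one term of the sum is as large as the average.\<close>

lemma quasi_multiplicative_powr:
  fixes A :: "nat \<Rightarrow> real^'d^'d"
  assumes irr: "irreducible_tuple M A" and s: "s > 0"
  obtains F c where "finite F" "\<And>k. k \<in> F \<Longrightarrow> set k \<subseteq> {1..M}" "c > 0"
    "\<And>B C. c * (matrix_norm B powr s * matrix_norm C powr s)
        \<le> (\<Sum>k\<in>F. matrix_norm (B ** word_matrix A k ** C) powr s)"
proof -
  obtain F d where F: "finite F" "\<And>k. k \<in> F \<Longrightarrow> set k \<subseteq> {1..M}" and d: "d > 0"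
    and le: "\<And>B C. d * (matrix_norm B * matrix_norm C) \<le> (\<Sum>k\<in>F. matrix_norm (B ** word_matrix A k ** C))"
    using quasi_multiplicative [OF irr] by blast
  have "F \<noteq> {}"
  proof
    assume "F = {}"
    then have "d \<le> 0" using le [of "mat 1" "mat 1"] by (simp add: matrix_norm_mat1)
    then show False using d by simp
  qed
  then have n: "real (card F) > 0" using F(1) by (simp add: card_gt_0_iff)
  define c where "c = (d / card F) powr s"
  show thesis
  proof (rule that [OF F])
    show "c > 0" using d n by (simp add: c_def)
    fix B C :: "real^'d^'d"
    let ?N = "\<lambda>k. matrix_norm (B ** word_matrix A k ** C)"
    have "\<exists>k\<in>F. d * (matrix_norm B * matrix_norm C) / card F \<le> ?N k"
    proof (rule ccontr)
      assume "\<not> ?thesis"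
      then have "(\<Sum>k\<in>F. ?N k) < (\<Sum>k\<in>F. d * (matrix_norm B * matrix_norm C) / card F)"
        using F(1) \<open>F \<noteq> {}\<close> by (intro sum_strict_mono) (auto simp: not_le)
      then show False using le [of B C] n by simp
    qed
    then obtain k where k: "k \<in> F" "d * (matrix_norm B * matrix_norm C) / card F \<le> ?N k" by blast
    have "c * (matrix_norm B powr s * matrix_norm C powr s) = (d * (matrix_norm B * matrix_norm C) / card F) powr s"
      using d n by (simp add: c_def powr_mult powr_divide matrix_norm_nonneg)
    also have "\<dots> \<le> ?N k powr s"
      using k(2) d n s by (intro powr_mono2) (auto simp: matrix_norm_nonneg)
    also have "\<dots> \<le> (\<Sum>k\<in>F. ?N k powr s)"
      using F(1) k(1) by (intro member_le_sum) auto
    finally show "c * (matrix_norm B powr s * matrix_norm C powr s) \<le> (\<Sum>k\<in>F. ?N k powr s)" .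
  qed
qed

lemma norm_powr_mult_le:
  "s > 0 \<Longrightarrow> matrix_norm (B ** C) powr s \<le> matrix_norm B powr s * matrix_norm C powr s"
  using powr_mono2 [of s "matrix_norm (B ** C)" "matrix_norm B * matrix_norm C"]
  by (simp add: matrix_norm_mult_le matrix_norm_nonneg powr_mult)

lemma norm_sum_nonneg: "norm_sum M A s n \<ge> 0"
  unfolding norm_sum_def by (intro sum_nonneg) simp

text \<open>Summing over all words of length \<open>n\<close> removes the connecting words: \<open>k v\<close> is one of the words of length \<open>|k| + n\<close>,
  and the superfluous \<open>|k|\<close> letters at its other end cost at most the factor \<open>Z\<close> at \<open>|k|\<close>. The length \<open>n\<close>
  therefore stays exact, although the connecting words have different lengths.\<close>

lemma averaged_quasi_multiplicative:
  fixes A :: "nat \<Rightarrow> real^'d^'d"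
  assumes irr: "irreducible_tuple M A" and s: "s > 0"
  obtains c where "c > 0" "c \<le> 1"
    "\<And>B n. c * (norm_sum M A s n * matrix_norm B powr s)
      \<le> (\<Sum>v\<in>words {1..M} n. matrix_norm (word_matrix A v ** B) powr s)"
    "\<And>B n. c * (norm_sum M A s n * matrix_norm B powr s)
      \<le> (\<Sum>u\<in>words {1..M} n. matrix_norm (B ** word_matrix A u) powr s)"
proof -
  obtain F c where F: "finite F" "\<And>k. k \<in> F \<Longrightarrow> set k \<subseteq> {1..M}" and c: "c > 0"
    and le: "\<And>B C. c * (matrix_norm B powr s * matrix_norm C powr s)
        \<le> (\<Sum>k\<in>F. matrix_norm (B ** word_matrix A k ** C) powr s)"
    using quasi_multiplicative_powr [OF irr s] by blast
  let ?W = "words {1..M}" and ?Z = "norm_sum M A s"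
  have fin: "finite {1..M}" by simp
  define D where "D = (\<Sum>k\<in>F. ?Z (length k)) + c + 1"
  have D: "D > 0" "D \<ge> c" "(\<Sum>k\<in>F. ?Z (length k)) \<le> D"
    using c norm_sum_nonneg [of M A s] by (auto simp: D_def add_nonneg_pos sum_nonneg)
  have right: "c * (?Z n * matrix_norm B powr s) \<le> D * (\<Sum>v\<in>?W n. matrix_norm (word_matrix A v ** B) powr s)" for B n
  proof -
    let ?G = "\<lambda>w. matrix_norm (word_matrix A w ** B) powr s"
    have "c * (?Z n * matrix_norm B powr s)
        = (\<Sum>v\<in>?W n. c * (matrix_norm (word_matrix A v) powr s * matrix_norm B powr s))"
      by (simp add: norm_sum_def sum_distrib_left sum_distrib_right)
    also have "\<dots> \<le> (\<Sum>v\<in>?W n. \<Sum>k\<in>F. ?G (k @ v))"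
      using le by (intro sum_mono) (simp add: word_matrix_append)
    also have "\<dots> = (\<Sum>k\<in>F. \<Sum>v\<in>?W n. ?G (k @ v))" by (rule sum.swap)
    also have "\<dots> \<le> (\<Sum>k\<in>F. ?Z (length k) * (\<Sum>v\<in>?W n. ?G v))"
    proof (intro sum_mono)
      fix k assume k: "k \<in> F"
      have "(\<Sum>v\<in>?W n. ?G (k @ v)) \<le> (\<Sum>u\<in>?W (length k). \<Sum>v\<in>?W n. ?G (u @ v))"
        using F(2) [OF k] by (intro member_le_sum [of k _ "\<lambda>u. \<Sum>v\<in>?W n. ?G (u @ v)"] sum_nonneg finite_words)
          (auto simp: words_def)
      also have "\<dots> = (\<Sum>w\<in>?W (length k + n). ?G w)"
        by (rule sum_words_append [OF fin, symmetric])
      also have "\<dots> = (\<Sum>w\<in>?W (n + length k). ?G w)" by (simp only: add.commute)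
      also have "\<dots> = (\<Sum>v\<in>?W n. \<Sum>t\<in>?W (length k). ?G (v @ t))"
        by (rule sum_words_append [OF fin])
      also have "\<dots> \<le> (\<Sum>v\<in>?W n. \<Sum>t\<in>?W (length k). matrix_norm (word_matrix A t) powr s * ?G v)"
        by (intro sum_mono) (simp only: word_matrix_append matrix_mul_assoc [symmetric] norm_powr_mult_le [OF s])
      also have "\<dots> = ?Z (length k) * (\<Sum>v\<in>?W n. ?G v)"
        by (simp only: norm_sum_def sum_distrib_left sum_distrib_right)
      finally show "(\<Sum>v\<in>?W n. ?G (k @ v)) \<le> ?Z (length k) * (\<Sum>v\<in>?W n. ?G v)" .
    qed
    also have "\<dots> = (\<Sum>k\<in>F. ?Z (length k)) * (\<Sum>v\<in>?W n. ?G v)" by (simp only: sum_distrib_right)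
    also have "\<dots> \<le> D * (\<Sum>v\<in>?W n. ?G v)"
      using D(3) by (intro mult_right_mono sum_nonneg) auto
    finally show ?thesis .
  qed
  have left: "c * (?Z n * matrix_norm B powr s) \<le> D * (\<Sum>u\<in>?W n. matrix_norm (B ** word_matrix A u) powr s)" for B n
  proof -
    let ?G = "\<lambda>w. matrix_norm (B ** word_matrix A w) powr s"
    have "c * (?Z n * matrix_norm B powr s)
        = (\<Sum>u\<in>?W n. c * (matrix_norm B powr s * matrix_norm (word_matrix A u) powr s))"
      by (simp add: norm_sum_def sum_distrib_left sum_distrib_right mult_ac)
    also have "\<dots> \<le> (\<Sum>u\<in>?W n. \<Sum>k\<in>F. ?G (u @ k))"
      using le by (intro sum_mono) (simp add: word_matrix_append matrix_mul_assoc)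
    also have "\<dots> = (\<Sum>k\<in>F. \<Sum>u\<in>?W n. ?G (u @ k))" by (rule sum.swap)
    also have "\<dots> \<le> (\<Sum>k\<in>F. ?Z (length k) * (\<Sum>u\<in>?W n. ?G u))"
    proof (intro sum_mono)
      fix k assume k: "k \<in> F"
      have "(\<Sum>u\<in>?W n. ?G (u @ k)) \<le> (\<Sum>u\<in>?W n. \<Sum>t\<in>?W (length k). ?G (u @ t))"
        using F(2) [OF k] by (intro sum_mono member_le_sum [of k _ "\<lambda>t. ?G (_ @ t)"] finite_words)
          (auto simp: words_def)
      also have "\<dots> = (\<Sum>w\<in>?W (n + length k). ?G w)"
        by (rule sum_words_append [OF fin, symmetric])
      also have "\<dots> = (\<Sum>w\<in>?W (length k + n). ?G w)" by (simp only: add.commute)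
      also have "\<dots> = (\<Sum>t\<in>?W (length k). \<Sum>u\<in>?W n. ?G (t @ u))"
        by (rule sum_words_append [OF fin])
      also have "\<dots> \<le> (\<Sum>t\<in>?W (length k). \<Sum>u\<in>?W n. ?G u * matrix_norm (word_matrix A t) powr s)"
        by (intro sum_mono) (simp only: word_matrix_append matrix_mul_assoc norm_powr_mult_le [OF s])
      also have "\<dots> = ?Z (length k) * (\<Sum>u\<in>?W n. ?G u)"
        unfolding norm_sum_def sum_product by (intro sum.cong refl mult.commute)
      finally show "(\<Sum>u\<in>?W n. ?G (u @ k)) \<le> ?Z (length k) * (\<Sum>u\<in>?W n. ?G u)" .
    qed
    also have "\<dots> = (\<Sum>k\<in>F. ?Z (length k)) * (\<Sum>u\<in>?W n. ?G u)" by (simp only: sum_distrib_right)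
    also have "\<dots> \<le> D * (\<Sum>u\<in>?W n. ?G u)"
      using D(3) by (intro mult_right_mono sum_nonneg) auto
    finally show ?thesis .
  qed
  show thesis
  proof (rule that [of "c / D"])
    show "c / D > 0" "c / D \<le> 1" using c D by (auto simp: divide_le_eq)
  qed (use left right D(1) in \<open>simp_all add: divide_le_eq mult_ac\<close>)
qed

lemma norm_sum_submultiplicative:
  assumes "s > 0"
  shows "norm_sum M A s (m + n) \<le> norm_sum M A s m * norm_sum M A s n"
proof -
  have "norm_sum M A s (m + n) \<le> (\<Sum>u\<in>words {1..M} m. \<Sum>v\<in>words {1..M} n.
      matrix_norm (word_matrix A v) powr s * matrix_norm (word_matrix A u) powr s)"
    unfolding norm_sum_def sum_words_append [OF finite_atLeastAtMost] word_matrix_append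
    by (intro sum_mono norm_powr_mult_le assms)
  also have "\<dots> = norm_sum M A s m * norm_sum M A s n"
    unfolding norm_sum_def sum_product by (intro sum.cong refl mult.commute)
  finally show ?thesis .
qed

lemma norm_sum_supermultiplicative:
  assumes "\<And>B n. c * (norm_sum M A s n * matrix_norm B powr s)
      \<le> (\<Sum>v\<in>words {1..M} n. matrix_norm (word_matrix A v ** B) powr s)"
  shows "c * (norm_sum M A s m * norm_sum M A s n) \<le> norm_sum M A s (m + n)"
proof -
  have "c * (norm_sum M A s m * norm_sum M A s n)
      = (\<Sum>u\<in>words {1..M} m. c * (norm_sum M A s n * matrix_norm (word_matrix A u) powr s))"
    by (simp add: norm_sum_def [of M A s m] sum_distrib_left sum_distrib_right mult_ac)
  also have "\<dots> \<le> (\<Sum>u\<in>words {1..M} m. \<Sum>v\<in>words {1..M} n. matrix_norm (word_matrix A v ** word_matrix A u) powr s)"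
    by (intro sum_mono assms)
  also have "\<dots> = norm_sum M A s (m + n)"
    by (simp only: norm_sum_def sum_words_append [OF finite_atLeastAtMost] word_matrix_append)
  finally show ?thesis .
qed

lemma norm_sum_0: "norm_sum M A s 0 = 1"
  by (simp add: norm_sum_def matrix_norm_mat1)

text \<open>The logarithms of the sums are subadditive and, up to the constant \<open>ln c\<close>, superadditive. Applying Fekete's
  lemma to both gives bounds from below and from above by the same exponential.\<close>

lemma norm_sum_growth:
  fixes A :: "nat \<Rightarrow> real^'d^'d"
  assumes s: "s > 0" and c: "c > 0"
    and sup: "\<And>m n. c * (norm_sum M A s m * norm_sum M A s n) \<le> norm_sum M A s (m + n)"
    and nz: "i \<in> {1..M}" "A i \<noteq> 0"
  obtains R where "R > 0" "\<And>n. R ^ n \<le> norm_sum M A s n" "\<And>n. c * norm_sum M A s n \<le> R ^ n"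
proof -
  let ?Z = "norm_sum M A s"
  have "0 < matrix_norm (A i) powr s"
    using nz matrix_norm_nonneg [of "A i"] matrix_norm_eq_0_iff [of "A i"] by simp
  also have "\<dots> \<le> ?Z 1"
    unfolding norm_sum_def One_nat_def sum_words_1 using nz(1)
    by (simp del: One_nat_def) (rule member_le_sum [of i _ "\<lambda>i. matrix_norm (A i) powr s"], auto)
  finally have Z1: "?Z 1 > 0" .
  have low: "(c * ?Z 1) ^ n \<le> ?Z n" for n
  proof (induction n)
    case (Suc n)
    have "(c * ?Z 1) ^ Suc n \<le> c * (?Z 1 * ?Z n)"
      using Suc c Z1 by (simp add: mult.assoc mult_left_mono)
    also have "\<dots> \<le> ?Z (Suc n)" using sup [of 1 n] by simp
    finally show ?case .
  qed (simp add: norm_sum_0)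
  have Z: "?Z n > 0" for n
    using low [of n] c Z1 by (smt (verit) mult_pos_pos zero_less_power)
  have sub: "ln (?Z (m + n)) \<le> ln (?Z m) + ln (?Z n)" for m n
  proof -
    have "ln (?Z (m + n)) \<le> ln (?Z m * ?Z n)"
      using norm_sum_submultiplicative [OF s, of M A m n] Z by simp
    then show ?thesis using Z [of m] Z [of n] by (simp add: ln_mult)
  qed
  have bnd: "ln (c * ?Z 1) \<le> ln (?Z n) / real n" if "n \<ge> 1" for n
  proof -
    have "ln ((c * ?Z 1) ^ n) \<le> ln (?Z n)" using low [of n] Z [of n] c Z1 by simp
    then have "real n * ln (c * ?Z 1) \<le> ln (?Z n)" using c Z1 by (simp add: ln_realpow)
    then show ?thesis using that by (simp add: field_simps)
  qed
  obtain P where P: "(\<lambda>n. ln (?Z n) / real n) \<longlonglongrightarrow> P" "\<And>n. n \<ge> 1 \<Longrightarrow> P \<le> ln (?Z n) / real n"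
    using fekete_bounded [of "\<lambda>n. ln (?Z n)", OF sub bnd] by blast
  \<comment> \<open>Minus the logarithm, shifted so as to be subadditive; its rate is \<open>- P\<close>.\<close>
  define b where "b n = - ln (?Z n) - ln c" for n
  have sub_b: "b (m + n) \<le> b m + b n" for m n
  proof -
    have "ln (c * (?Z m * ?Z n)) \<le> ln (?Z (m + n))" using sup [of m n] c Z by simp
    then show ?thesis using Z [of m] Z [of n] c by (simp add: ln_mult b_def)
  qed
  have "(\<lambda>n. - (ln (?Z n) / real n) - ln c / real n) \<longlonglongrightarrow> - P - 0"
    by (intro tendsto_intros P(1) lim_const_over_n)
  then have "(\<lambda>n. ereal (b n / real n)) \<longlonglongrightarrow> ereal (- P)"
    by (simp add: b_def diff_divide_distrib)
  then have eq: "ereal (- P) = (INF n\<in>{1..}. ereal (b n / real n))"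
    using LIMSEQ_unique fekete [of b, OF sub_b] by blast
  have up: "- P \<le> b n / real n" if "n \<ge> 1" for n
  proof -
    have "(INF n\<in>{1..}. ereal (b n / real n)) \<le> ereal (b n / real n)"
      using that by (intro INF_lower) auto
    then show ?thesis unfolding eq [symmetric] by simp
  qed
  show thesis
  proof (rule that [of "exp P"])
    show "exp P ^ n \<le> ?Z n" for n
    proof (cases "n = 0")
      case False
      then have "real n * P \<le> ln (?Z n)" using P(2) [of n] by (simp add: field_simps)
      then have "exp (real n * P) \<le> ?Z n" using Z [of n] by (metis exp_le_cancel_iff exp_ln)
      then show ?thesis by (simp add: exp_of_nat_mult)
    qed (simp add: norm_sum_0)
    show "c * ?Z n \<le> exp P ^ n" for n
    proof (cases "n = 0")
      case True
      then show ?thesis using sup [of 0 0] by (simp add: norm_sum_0)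
    next
      case False
      then have "ln c + ln (?Z n) \<le> real n * P" using up [of n] by (simp add: field_simps b_def)
      then have "ln (c * ?Z n) \<le> real n * P" using c Z [of n] by (simp add: ln_mult)
      then have "c * ?Z n \<le> exp (real n * P)" using c Z [of n] by (metis exp_le_cancel_iff exp_ln mult_pos_pos)
      then show ?thesis by (simp add: exp_of_nat_mult)
    qed
  qed simp
qed

section \<open>Gibbs measures of irreducible tuples\<close>

text \<open>A product of compact intervals is compact, and sequentially so when there are countably many factors.\<close>

lemma bounded_functions_subsequence:
  fixes g :: "nat \<Rightarrow> 'a::countable \<Rightarrow> real"
  assumes "\<And>n w. g n w \<in> {0..b w}"
  obtains r l where "strict_mono r" "\<And>w. (\<lambda>k. g (r k) w) \<longlonglongrightarrow> l w"
proof -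
  have "compactin (product_topology (\<lambda>_. euclidean) UNIV) (\<Pi>\<^sub>E w\<in>UNIV. {0..b w})"
    unfolding compactin_PiE by auto
  then have "compact (\<Pi>\<^sub>E w\<in>UNIV. {0..b w})"
    by (simp only: euclidean_product_topology compactin_euclidean_iff)
  then have sc: "seq_compact (\<Pi>\<^sub>E w\<in>UNIV. {0..b w})" by (rule compact_imp_seq_compact)
  have "\<forall>n. g n \<in> (\<Pi>\<^sub>E w\<in>UNIV. {0..b w})" using assms by (auto simp: PiE_def)
  then obtain l r where r: "strict_mono r" "(g \<circ> r) \<longlonglongrightarrow> l"
    using sc by (elim seq_compactE)
  have "(\<lambda>k. g (r k) w) \<longlonglongrightarrow> l w" for w
  proof -
    have "continuous_on UNIV (\<lambda>h :: 'a \<Rightarrow> real. h w)" by simp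
    then have "isCont (\<lambda>h. h w) l" by (simp only: continuous_on_eq_continuous_at [OF open_UNIV] UNIV_I ball_UNIV)
    from isCont_tendsto_compose [OF this r(2)] show ?thesis by (simp add: o_def)
  qed
  with r(1) show thesis by (rule that)
qed

text \<open>\<open>T N j w\<close> is the probability of seeing \<open>w\<close> at position \<open>j\<close> in a random word of length \<open>2 N\<close> drawn with
  weights \<open>\<parallel>A\<^sub>w\<parallel>\<^sup>s\<close>. By quasi-multiplicativity it is comparable with \<open>\<parallel>A\<^sub>w\<parallel>\<^sup>s / Z\<^sub>|\<^sub>w\<^sub>|\<close> for every \<open>j\<close>. Averaging over \<open>j < N\<close>
  makes it invariant up to an error of order \<open>1/N\<close>, and a limit along a subsequence is stationary and inherits both bounds.
  The word has length \<open>2 N\<close> so that \<open>w\<close>, of length less than \<open>N\<close>, fits in at all positions \<open>j \<le> N\<close>.\<close>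

lemma gibbs_word_function:
  fixes A :: "nat \<Rightarrow> real^'d^'d"
  assumes s: "s > 0" and c: "c > 0" and Zpos: "\<And>n. norm_sum M A s n > 0"
    and right: "\<And>B n. c * (norm_sum M A s n * matrix_norm B powr s)
      \<le> (\<Sum>v\<in>words {1..M} n. matrix_norm (word_matrix A v ** B) powr s)"
    and left: "\<And>B n. c * (norm_sum M A s n * matrix_norm B powr s)
      \<le> (\<Sum>u\<in>words {1..M} n. matrix_norm (B ** word_matrix A u) powr s)"
  obtains g where "stationary {1..M} g"
    "\<And>w. set w \<subseteq> {1..M} \<Longrightarrow> g w \<le> matrix_norm (word_matrix A w) powr s / (c\<^sup>2 * norm_sum M A s (length w))"
    "\<And>w. set w \<subseteq> {1..M} \<Longrightarrow> c\<^sup>2 * matrix_norm (word_matrix A w) powr s / norm_sum M A s (length w) \<le> g w"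
proof -
  let ?W = "words {1..M}" and ?Z = "norm_sum M A s" and ?F = "\<lambda>w. matrix_norm (word_matrix A w) powr s"
  have fin: "finite {1..M}" by simp
  note super = norm_sum_supermultiplicative [of c M A s, OF right]
  note sub = norm_sum_submultiplicative [OF s, of M A]
  define T where "T N j w = (\<Sum>u\<in>?W j. \<Sum>v\<in>?W (2 * N - j - length w). ?F (u @ w @ v)) / ?Z (2 * N)" for N j w
  have T_nonneg: "0 \<le> T N j w" for N j w
    unfolding T_def using Zpos by (intro divide_nonneg_pos sum_nonneg) auto
  define b where "b w = ?F w / (c\<^sup>2 * ?Z (length w))" for w
  have b_nonneg: "0 \<le> b w" for w
    unfolding b_def using Zpos c by (intro divide_nonneg_pos) auto
  have T_up: "T N j w \<le> b w" if len: "j + length w \<le> 2 * N" for N j w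
  proof -
    define r where "r = 2 * N - j - length w"
    have N2: "2 * N = j + (r + length w)" using len by (simp add: r_def)
    have "(\<Sum>u\<in>?W j. \<Sum>v\<in>?W r. ?F (u @ w @ v)) \<le> (\<Sum>u\<in>?W j. \<Sum>v\<in>?W r. ?F u * ?F v * ?F w)"
    proof (intro sum_mono)
      fix u v
      have "?F (u @ w @ v) \<le> matrix_norm (word_matrix A v ** word_matrix A w) powr s * ?F u"
        unfolding word_matrix_append by (rule norm_powr_mult_le [OF s])
      also have "\<dots> \<le> (?F v * ?F w) * ?F u"
        by (intro mult_right_mono norm_powr_mult_le [OF s]) simp
      finally show "?F (u @ w @ v) \<le> ?F u * ?F v * ?F w" by (simp add: mult_ac)
    qed
    also have "\<dots> = ?Z j * ?Z r * ?F w"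
      unfolding norm_sum_def sum_product by (simp only: sum_distrib_right)
    finally have num: "(\<Sum>u\<in>?W j. \<Sum>v\<in>?W r. ?F (u @ w @ v)) \<le> ?Z j * ?Z r * ?F w" .
    have "c * (?Z j * (c * (?Z r * ?Z (length w)))) \<le> c * (?Z j * ?Z (r + length w))"
      using c Zpos [of j] super [of r "length w"] by (intro mult_left_mono) auto
    also have "\<dots> \<le> ?Z (2 * N)" unfolding N2 by (rule super)
    finally have den: "c\<^sup>2 * ?Z (length w) * (?Z j * ?Z r) \<le> ?Z (2 * N)"
      by (simp add: power2_eq_square mult_ac)
    have "T N j w \<le> ?Z j * ?Z r * ?F w / ?Z (2 * N)"
      unfolding T_def r_def [symmetric] using num Zpos by (intro divide_right_mono) (auto intro: less_imp_le)
    also have "\<dots> \<le> ?Z j * ?Z r * ?F w / (c\<^sup>2 * ?Z (length w) * (?Z j * ?Z r))"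
      using den c Zpos by (intro divide_left_mono mult_pos_pos mult_nonneg_nonneg) (auto intro: less_imp_le)
    also have "\<dots> = b w" using Zpos [of j] Zpos [of r] by (simp add: b_def)
    finally show ?thesis .
  qed
  have T_low: "c\<^sup>2 * ?F w / ?Z (length w) \<le> T N j w" if len: "j + length w \<le> 2 * N" for N j w
  proof -
    define r where "r = 2 * N - j - length w"
    have N2: "2 * N = j + (r + length w)" using len by (simp add: r_def)
    have "c * (c * (?Z r * ?F w) * ?Z j) = c * ?Z r * (c * (?Z j * ?F w))" by (simp add: mult_ac)
    also have "\<dots> \<le> c * ?Z r * (\<Sum>u\<in>?W j. ?F (u @ w))"
      using left [of j "word_matrix A w"] c Zpos [of r]
      by (intro mult_left_mono) (auto simp: word_matrix_append)
    also have "\<dots> = (\<Sum>u\<in>?W j. c * (?Z r * ?F (u @ w)))" by (simp add: sum_distrib_left mult_ac)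
    also have "\<dots> \<le> (\<Sum>u\<in>?W j. \<Sum>v\<in>?W r. ?F (u @ w @ v))"
    proof (intro sum_mono)
      fix u
      show "c * (?Z r * ?F (u @ w)) \<le> (\<Sum>v\<in>?W r. ?F (u @ w @ v))"
        using right [of r "word_matrix A (u @ w)"]
        by (simp only: word_matrix_append [of A "u @ w", symmetric] append_assoc)
    qed
    finally have num: "c\<^sup>2 * ?F w * (?Z j * ?Z r) \<le> (\<Sum>u\<in>?W j. \<Sum>v\<in>?W r. ?F (u @ w @ v))"
      by (simp add: power2_eq_square mult_ac)
    have "?Z (2 * N) \<le> ?Z j * ?Z (r + length w)" unfolding N2 by (rule sub)
    also have "\<dots> \<le> ?Z j * (?Z r * ?Z (length w))"
      using Zpos [of j] by (intro mult_left_mono sub) auto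
    finally have den: "?Z (2 * N) \<le> ?Z (length w) * (?Z j * ?Z r)" by (simp add: mult_ac)
    have "c\<^sup>2 * ?F w / ?Z (length w) = c\<^sup>2 * ?F w * (?Z j * ?Z r) / (?Z (length w) * (?Z j * ?Z r))"
      using Zpos [of j] Zpos [of r] by simp
    also have "\<dots> \<le> c\<^sup>2 * ?F w * (?Z j * ?Z r) / ?Z (2 * N)"
      using den c Zpos by (intro divide_left_mono mult_pos_pos mult_nonneg_nonneg) (auto intro: less_imp_le)
    also have "\<dots> \<le> T N j w"
      unfolding T_def r_def [symmetric] using num Zpos by (intro divide_right_mono) (auto intro: less_imp_le)
    finally show ?thesis .
  qed
  have T_Nil: "T N j [] = 1" if "j \<le> 2 * N" for N j
  proof -
    have "(\<Sum>u\<in>?W j. \<Sum>v\<in>?W (2 * N - j). ?F (u @ v)) = ?Z (j + (2 * N - j))"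
      unfolding norm_sum_def by (rule sum_words_append [OF fin, symmetric])
    then show ?thesis using that Zpos [of "2 * N"] by (simp add: T_def)
  qed
  have T_snoc: "(\<Sum>i\<in>{1..M}. T N j (w @ [i])) = T N j w" if "j + length w < 2 * N" for N j w
  proof -
    have r: "2 * N - j - length w = Suc (2 * N - j - Suc (length w))" using that by simp
    have "(\<Sum>u\<in>?W j. \<Sum>v\<in>?W (2 * N - j - length w). ?F (u @ w @ v))
        = (\<Sum>u\<in>?W j. \<Sum>i\<in>{1..M}. \<Sum>v\<in>?W (2 * N - j - Suc (length w)). ?F (u @ w @ i # v))"
      unfolding r sum_words_Suc [OF fin] by simp
    also have "\<dots> = (\<Sum>i\<in>{1..M}. \<Sum>u\<in>?W j. \<Sum>v\<in>?W (2 * N - j - Suc (length w)). ?F (u @ w @ i # v))"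
      by (rule sum.swap)
    finally show ?thesis by (simp add: T_def sum_divide_distrib)
  qed
  have T_Cons: "(\<Sum>i\<in>{1..M}. T N j (i # w)) = T N (Suc j) w" for N j w
  proof -
    have r: "2 * N - Suc j - length w = 2 * N - j - Suc (length w)" by simp
    have "(\<Sum>u\<in>?W (Suc j). \<Sum>v\<in>?W (2 * N - Suc j - length w). ?F (u @ w @ v))
        = (\<Sum>u\<in>?W j. \<Sum>i\<in>{1..M}. \<Sum>v\<in>?W (2 * N - j - Suc (length w)). ?F (u @ i # w @ v))"
      unfolding r sum_words_Suc_right [OF fin] by simp
    also have "\<dots> = (\<Sum>i\<in>{1..M}. \<Sum>u\<in>?W j. \<Sum>v\<in>?W (2 * N - j - Suc (length w)). ?F (u @ i # w @ v))"
      by (rule sum.swap)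
    finally show ?thesis by (simp add: T_def sum_divide_distrib)
  qed
  define G where "G N w = (if length w < N then (\<Sum>j<N. T N j w) / real N else 0)" for N w
  have G_up: "G N w \<le> b w" for N w
  proof (cases "length w < N")
    case True
    then have "(\<Sum>j<N. T N j w) \<le> (\<Sum>j<N. b w)" by (intro sum_mono T_up) simp
    then show ?thesis using True by (simp add: G_def divide_le_eq mult.commute)
  qed (simp add: G_def b_nonneg)
  have G_nonneg: "0 \<le> G N w" for N w
    using T_nonneg by (auto simp: G_def intro!: divide_nonneg_nonneg sum_nonneg)
  have G_low: "c\<^sup>2 * ?F w / ?Z (length w) \<le> G N w" if "length w < N" for N w
  proof -
    have "(\<Sum>j<N. c\<^sup>2 * ?F w / ?Z (length w)) \<le> (\<Sum>j<N. T N j w)"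
      using that by (intro sum_mono T_low) simp
    then show ?thesis using that by (simp add: G_def le_divide_eq mult.commute)
  qed
  have G_snoc: "(\<Sum>i\<in>{1..M}. G N (w @ [i])) = G N w" if "Suc (length w) < N" for N w
  proof -
    have "(\<Sum>i\<in>{1..M}. G N (w @ [i])) = (\<Sum>i\<in>{1..M}. \<Sum>j<N. T N j (w @ [i])) / real N"
      using that by (simp add: G_def sum_divide_distrib)
    also have "(\<Sum>i\<in>{1..M}. \<Sum>j<N. T N j (w @ [i])) = (\<Sum>j<N. \<Sum>i\<in>{1..M}. T N j (w @ [i]))"
      by (rule sum.swap)
    also have "\<dots> = (\<Sum>j<N. T N j w)" using that by (intro sum.cong refl T_snoc) simp
    finally show ?thesis using that by (simp add: G_def)
  qed
  have G_Cons: "(\<Sum>i\<in>{1..M}. G N (i # w)) = G N w + (T N N w - T N 0 w) / real N" if "Suc (length w) < N" for N w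
  proof -
    have "(\<Sum>i\<in>{1..M}. G N (i # w)) = (\<Sum>i\<in>{1..M}. \<Sum>j<N. T N j (i # w)) / real N"
      using that by (simp add: G_def sum_divide_distrib)
    also have "(\<Sum>i\<in>{1..M}. \<Sum>j<N. T N j (i # w)) = (\<Sum>j<N. \<Sum>i\<in>{1..M}. T N j (i # w))"
      by (rule sum.swap)
    also have "\<dots> = (\<Sum>j<N. T N (Suc j) w)" by (simp only: T_Cons)
    also have "\<dots> = (\<Sum>j<N. T N j w) + (T N N w - T N 0 w)"
      using sum_lessThan_telescope [of "\<lambda>j. T N j w" N] by (simp add: sum_subtractf)
    finally show ?thesis using that by (simp add: G_def add_divide_distrib)
  qed
  obtain r g where r: "strict_mono r" and g: "\<And>w. (\<lambda>k. G (r k) w) \<longlonglongrightarrow> g w"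
    using bounded_functions_subsequence [of G b] G_up G_nonneg by auto
  have large: "\<forall>\<^sub>F k in sequentially. n < r k" for n
    using eventually_gt_at_top [of n]
  proof eventually_elim
    case (elim k)
    then show ?case using seq_suble [OF r, of k] by simp
  qed
  show thesis
  proof (rule that)
    fix w :: "nat list"
    show "g w \<le> ?F w / (c\<^sup>2 * ?Z (length w))"
      using LIMSEQ_le_const2 [OF g, of w] G_up by (auto simp: b_def)
    show "c\<^sup>2 * ?F w / ?Z (length w) \<le> g w"
      using large [of "length w"]
      by (intro tendsto_lowerbound [OF g _ trivial_limit_sequentially]) (auto elim!: eventually_mono intro: G_low)
  next
    show "stationary {1..M} g"
      unfolding stationary_def
    proof (intro conjI allI impI)
      have "\<forall>\<^sub>F k in sequentially. 1 = G (r k) []"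
        using large [of 0] by eventually_elim (simp add: G_def T_Nil)
      then have "(\<lambda>k. G (r k) []) \<longlonglongrightarrow> 1" by (rule tendsto_eventually [OF eventually_mono]) simp
      then show "g [] = 1" using g LIMSEQ_unique by blast
      fix w :: "nat list"
      show "0 \<le> g w" using LIMSEQ_le_const [OF g, of 0 w] G_nonneg by auto
      have "(\<lambda>k. \<Sum>i\<in>{1..M}. G (r k) (w @ [i])) \<longlonglongrightarrow> (\<Sum>i\<in>{1..M}. g (w @ [i]))"
        by (intro tendsto_sum g)
      moreover have "\<forall>\<^sub>F k in sequentially. (\<Sum>i\<in>{1..M}. G (r k) (w @ [i])) = G (r k) w"
        using large [of "Suc (length w)"] by eventually_elim (rule G_snoc)
      ultimately have "(\<lambda>k. G (r k) w) \<longlonglongrightarrow> (\<Sum>i\<in>{1..M}. g (w @ [i]))"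
        by (rule Lim_transform_eventually)
      then show "(\<Sum>i\<in>{1..M}. g (w @ [i])) = g w" using g LIMSEQ_unique by blast
      have "(\<lambda>k. \<Sum>i\<in>{1..M}. G (r k) (i # w)) \<longlonglongrightarrow> (\<Sum>i\<in>{1..M}. g (i # w))"
        by (intro tendsto_sum g)
      moreover have "(\<lambda>k. \<Sum>i\<in>{1..M}. G (r k) (i # w)) \<longlonglongrightarrow> g w"
      proof -
        have "(\<lambda>N. b w / real N) \<longlonglongrightarrow> 0" by (rule lim_const_over_n)
        from LIMSEQ_subseq_LIMSEQ [OF this r] have lim0: "(\<lambda>k. b w / real (r k)) \<longlonglongrightarrow> 0" by (simp add: o_def)
        have "\<forall>\<^sub>F k in sequentially. norm ((\<Sum>i\<in>{1..M}. G (r k) (i # w)) - G (r k) w) \<le> b w / real (r k)"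
          using large [of "Suc (length w)"]
        proof eventually_elim
          case (elim k)
          have "\<bar>T (r k) (r k) w - T (r k) 0 w\<bar> \<le> b w"
            using T_up [of "r k" w "r k"] T_up [of 0 w "r k"] T_nonneg [of "r k" "r k" w] T_nonneg [of "r k" 0 w] elim
            by (simp add: abs_le_iff)
          then show ?case
            using elim unfolding G_Cons [OF elim] by (simp add: abs_divide divide_right_mono)
        qed
        then have "(\<lambda>k. (\<Sum>i\<in>{1..M}. G (r k) (i # w)) - G (r k) w) \<longlonglongrightarrow> 0"
          using lim0 by (rule Lim_null_comparison)
        from tendsto_add [OF this g [of w]] show ?thesis by simp
      qed
      ultimately show "(\<Sum>i\<in>{1..M}. g (i # w)) = g w" using LIMSEQ_unique by blast
    qed
  qed
qed

text \<open>The sums \<open>Z\<^sub>n\<close> in \<open>gibbs_word_function\<close> may be replaced by \<open>R\<^sup>n\<close> because both have the same order of magnitude.\<close>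

lemma gibbs_measure_exists:
  fixes A :: "nat \<Rightarrow> real^'d^'d"
  assumes irr: "irreducible_tuple M A" and s: "s > 0" and nz: "i \<in> {1..M}" "A i \<noteq> 0"
  obtains m R a K where "m \<in> equilibrium_states M A s" "R > 0" "a > 0" "K > 0"
    "\<And>w. set w \<subseteq> {1..M} \<Longrightarrow>
      a * matrix_norm (word_matrix A w) powr s \<le> measure m (cylinder M w) * R ^ length w"
    "\<And>w. set w \<subseteq> {1..M} \<Longrightarrow>
      measure m (cylinder M w) * R ^ length w \<le> K * matrix_norm (word_matrix A w) powr s"
proof -
  obtain c where c: "c > 0"
    and right: "\<And>B n. c * (norm_sum M A s n * matrix_norm B powr s)
      \<le> (\<Sum>v\<in>words {1..M} n. matrix_norm (word_matrix A v ** B) powr s)"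
    and left: "\<And>B n. c * (norm_sum M A s n * matrix_norm B powr s)
      \<le> (\<Sum>u\<in>words {1..M} n. matrix_norm (B ** word_matrix A u) powr s)"
    using averaged_quasi_multiplicative [OF irr s] by metis
  let ?Z = "norm_sum M A s" and ?F = "\<lambda>w. matrix_norm (word_matrix A w) powr s"
  obtain R where R: "R > 0" "\<And>n. R ^ n \<le> ?Z n" "\<And>n. c * ?Z n \<le> R ^ n"
    using norm_sum_growth [OF s c norm_sum_supermultiplicative [of c M A s, OF right] nz] by blast
  have Zpos: "?Z n > 0" for n
    using R(1) R(2) [of n] by (meson less_le_trans zero_less_power)
  obtain g where g: "stationary {1..M} g"
    and up: "\<And>w. set w \<subseteq> {1..M} \<Longrightarrow> g w \<le> ?F w / (c\<^sup>2 * ?Z (length w))"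
    and low: "\<And>w. set w \<subseteq> {1..M} \<Longrightarrow> c\<^sup>2 * ?F w / ?Z (length w) \<le> g w"
    using gibbs_word_function [OF s c Zpos right left] by blast
  obtain m where m: "m \<in> invariant_measures M" "\<And>w. set w \<subseteq> {1..M} \<Longrightarrow> measure m (cylinder M w) = g w"
    using stationary_extends_to_measure [OF g] by blast
  have upR: "g w * R ^ length w \<le> inverse (c\<^sup>2) * ?F w" if w: "set w \<subseteq> {1..M}" for w
  proof -
    have "g w * R ^ length w \<le> ?F w / (c\<^sup>2 * ?Z (length w)) * ?Z (length w)"
      using up [OF w] R(1,2) Zpos c stationaryD(2) [OF g w] by (intro mult_mono) auto
    then show ?thesis using Zpos [of "length w"] by (simp add: field_simps)
  qed
  have lowR: "c ^ 3 * ?F w \<le> g w * R ^ length w" if w: "set w \<subseteq> {1..M}" for w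
  proof -
    have "c ^ 3 * ?F w = (c\<^sup>2 * ?F w / ?Z (length w)) * (c * ?Z (length w))"
      using Zpos [of "length w"] by (simp add: power2_eq_square power3_eq_cube)
    also have "\<dots> \<le> g w * R ^ length w"
      using low [OF w] R(3) Zpos [of "length w"] c stationaryD(2) [OF g w] by (intro mult_mono) auto
    finally show ?thesis .
  qed
  have M: "M \<ge> 1" using nz(1) by simp
  have "m \<in> equilibrium_states M A s"
  proof (rule gibbs_imp_equilibrium_state [OF M s m(1) R(1)])
    show "inverse c > 0" using c by simp
    show "?Z n \<le> inverse c * R ^ n" for n using R(3) [of n] c by (simp add: field_simps)
    show "measure m (cylinder M w) \<le> inverse (c\<^sup>2) * ?F w / R ^ length w" if w: "set w \<subseteq> {1..M}" for w
      using upR [OF w] R(1) by (simp add: m(2) [OF w] pos_le_divide_eq)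
  qed
  then show thesis
    by (rule that [of m R "c ^ 3" "inverse (c\<^sup>2)"]) (use c R(1) upR lowR m(2) in auto)
qed

lemma le_of_power_le:
  fixes x y C :: real
  assumes "0 \<le> y" "\<And>n. x ^ n \<le> C * y ^ n"
  shows "x \<le> y"
proof (rule ccontr)
  assume "\<not> x \<le> y"
  then have xy: "y < x" by simp
  show False
  proof (cases "y = 0")
    case True
    then show False using assms(2) [of 1] xy by simp
  next
    case False
    then have y: "y > 0" using assms(1) by simp
    obtain n where "C < (x / y) ^ n" using real_arch_pow [of "x / y" C] xy y by auto
    then show False using assms(2) [of n] y by (simp add: power_divide field_simps)
  qed
qed

text \<open>The norm of \<open>B\<^sup>n\<close>, raised to the power \<open>s\<close>, is comparable with \<open>q\<^sup>n\<close>; its exponential growth rate is \<open>\<rho>(B)\<^sup>s\<close>.\<close>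

lemma spectral_radius_of_gibbs_weight:
  fixes B :: "real^'d^'d"
  assumes s: "s > 0" and a: "a > 0" and K: "K > 0" and q: "q \<ge> 0"
    and low: "\<And>n. a * matrix_norm (matrix_power B n) powr s \<le> q ^ n"
    and up: "\<And>n. q ^ n \<le> K * matrix_norm (matrix_power B n) powr s"
  shows "spectral_radius B powr s = q"
proof (rule antisym)
  let ?N = "\<lambda>n. matrix_norm (matrix_power B n)"
  have pow: "(x powr s) ^ n = (x ^ n) powr s" if "x \<ge> 0" for x n
    using that by (induction n) (simp_all add: powr_mult)
  show "spectral_radius B powr s \<le> q"
  proof (rule le_of_power_le [OF q])
    fix n
    have "(spectral_radius B powr s) ^ n = (spectral_radius B ^ n) powr s"
      by (rule pow [OF spectral_radius_nonneg])
    also have "\<dots> \<le> (2 * ?N n) powr s"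
      using s by (intro powr_mono2 spectral_radius_power_le) (auto simp: spectral_radius_nonneg)
    also have "\<dots> = 2 powr s * ?N n powr s" by (simp add: powr_mult matrix_norm_nonneg)
    also have "\<dots> \<le> 2 powr s * (q ^ n / a)"
      using low [of n] a by (intro mult_left_mono) (simp_all add: field_simps)
    finally show "(spectral_radius B powr s) ^ n \<le> 2 powr s / a * q ^ n" by simp
  qed
  have le: "q powr (1 / s) \<le> r" if r: "spectral_radius B < r" for r
  proof -
    have r0: "r > 0" using r spectral_radius_nonneg [of B] by linarith
    obtain C where C: "C > 0" "\<And>n. ?N n \<le> C * r ^ n" using matrix_power_norm_le [OF r] by blast
    have "q \<le> r powr s"
    proof (rule le_of_power_le)
      fix n
      have "q ^ n \<le> K * ?N n powr s" by (rule up)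
      also have "\<dots> \<le> K * (C * r ^ n) powr s"
        using C K s by (intro mult_left_mono powr_mono2) (auto simp: matrix_norm_nonneg)
      also have "\<dots> = K * C powr s * (r powr s) ^ n"
        using r0 C(1) by (simp add: powr_mult pow)
      finally show "q ^ n \<le> K * C powr s * (r powr s) ^ n" .
    qed simp
    then have "q powr (1 / s) \<le> (r powr s) powr (1 / s)" using s q by (intro powr_mono2) auto
    then show ?thesis using s r0 by (simp add: powr_powr)
  qed
  then have "q powr (1 / s) \<le> spectral_radius B" by (rule dense_ge)
  then have "(q powr (1 / s)) powr s \<le> spectral_radius B powr s" using s by (intro powr_mono2) auto
  then show "q \<le> spectral_radius B powr s" using s q by (simp add: powr_powr)
qed

text \<open>If all matrices vanish, every invariant measure has Lyapunov exponent \<open>-\<infinity>\<close> and is an equilibrium state. With at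
  least two symbols there are two different ones, the point masses at constant sequences.\<close>

lemma unique_equilibrium_imp_nonzero:
  fixes A :: "nat \<Rightarrow> real^'d^'d"
  assumes M: "M \<ge> 2" and s: "s > 0" and uniq: "equilibrium_states M A s = {\<mu>}"
  shows "\<exists>i\<in>{1..M}. A i \<noteq> 0"
proof (rule ccontr)
  assume "\<not> ?thesis"
  then have zero: "A i = 0" if "i \<in> {1..M}" for i using that by blast
  have bot: "metric_entropy M \<nu> + ereal s * lyapunov_exponent A \<nu> = -\<infinity>" if \<nu>: "\<nu> \<in> invariant_measures M" for \<nu>
  proof -
    have "\<exists>w\<in>words {1..M} 1. measure \<nu> (cylinder M w) > 0"
    proof (rule ccontr)
      assume "\<not> ?thesis"
      then have "(\<Sum>w\<in>words {1..M} 1. measure \<nu> (cylinder M w)) \<le> 0"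
        by (intro sum_nonpos) (simp add: not_less)
      then show False using stationary_sum_words [OF stationary_cylinder [OF \<nu>], of 1] by simp
    qed
    then obtain w where w: "w \<in> words {1..M} 1" "measure \<nu> (cylinder M w) > 0" by blast
    then obtain i where "w = [i]" "i \<in> {1..M}" by (auto simp: words_def length_Suc_conv)
    then have "word_matrix A w = 0" using zero by simp
    then have "charges_zero M A \<nu> 1" using w by (auto simp: charges_zero_def)
    then have "lyapunov_exponent A \<nu> = -\<infinity>" by (rule lyapunov_exponent_charges_zero [OF \<nu>])
    moreover have "metric_entropy M \<nu> \<le> ereal (ln (real M))"
      using M by (intro metric_entropy_le_ln_card [OF \<nu>]) simp
    ultimately show ?thesis using s by (cases "metric_entropy M \<nu>") auto
  qed
  have eq: "\<nu> = \<mu>" if \<nu>: "\<nu> \<in> invariant_measures M" for \<nu>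
  proof -
    have "(SUP \<nu>\<in>invariant_measures M. metric_entropy M \<nu> + ereal s * lyapunov_exponent A \<nu>) \<le> -\<infinity>"
      by (rule SUP_least) (simp only: bot order_refl)
    then have "\<nu> \<in> equilibrium_states M A s" using bot [OF \<nu>] \<nu> by (simp add: equilibrium_states_def)
    then show ?thesis using uniq by blast
  qed
  have dirac: "\<exists>\<nu>\<in>invariant_measures M. measure \<nu> (cylinder M [1]) = (if j = 1 then 1 else 0)" if j: "j \<in> {1..M}" for j
  proof -
    define q :: "nat \<Rightarrow> real" where "q i = (if i = j then 1 else 0)" for i
    have q: "\<And>i. i \<in> {1..M} \<Longrightarrow> q i \<ge> 0" "(\<Sum>i\<in>{1..M}. q i) = 1" using j by (auto simp: q_def)
    obtain \<nu> where \<nu>: "\<nu> \<in> invariant_measures M"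
      "\<And>w. set w \<subseteq> {1..M} \<Longrightarrow> measure \<nu> (cylinder M w) = (\<Prod>i<length w. q (w ! i))"
      using bernoulli_exists [OF q] by blast
    show ?thesis using \<nu>(1) \<nu>(2) [of "[1]"] M by (intro bexI [of _ \<nu>]) (auto simp: q_def)
  qed
  have "measure \<mu> (cylinder M [1]) = 1" using dirac [of 1] eq M by auto
  moreover have "measure \<mu> (cylinder M [1]) = 0" using dirac [of 2] eq M by auto
  ultimately show False by simp
qed

section \<open>The Bernoulli criterion\<close>

theorem theorem11:
  fixes M :: nat and A :: "nat \<Rightarrow> real^'d^'d" and s :: real and \<mu> :: "(nat \<Rightarrow> nat) measure"
  assumes "M \<ge> 2"
    and "irreducible_tuple M A"
    and "s > 0"
    and "equilibrium_states M A s = {\<mu>}"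
  shows "bernoulli_measure M \<mu> \<longleftrightarrow>
    (\<forall>B1\<in>matrix_semigroup M A. \<forall>B2\<in>matrix_semigroup M A.
       spectral_radius (B1 ** B2) = spectral_radius B1 * spectral_radius B2)"
proof
  note M = assms(1) and irr = assms(2) and s = assms(3) and uniq = assms(4)
  obtain i where nz: "i \<in> {1..M}" "A i \<noteq> 0"
    using unique_equilibrium_imp_nonzero [OF M s uniq] by blast
  show "\<forall>B1\<in>matrix_semigroup M A. \<forall>B2\<in>matrix_semigroup M A.
       spectral_radius (B1 ** B2) = spectral_radius B1 * spectral_radius B2"
    if bern: "bernoulli_measure M \<mu>"
  proof -
    obtain m R a K where m: "m \<in> equilibrium_states M A s" and R: "R > 0" and aK: "a > 0" "K > 0"
      and low: "\<And>w. set w \<subseteq> {1..M} \<Longrightarrow>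
        a * matrix_norm (word_matrix A w) powr s \<le> measure m (cylinder M w) * R ^ length w"
      and up: "\<And>w. set w \<subseteq> {1..M} \<Longrightarrow>
        measure m (cylinder M w) * R ^ length w \<le> K * matrix_norm (word_matrix A w) powr s"
      using gibbs_measure_exists [OF irr s nz] by blast
    have "m = \<mu>" using m uniq by blast
    obtain p where p: "prob_space p" "sets p = Pow {1..M}" "\<mu> = (\<Pi>\<^sub>M n\<in>UNIV. p)"
      using bern unfolding bernoulli_measure_def by blast
    \<comment> \<open>For a Bernoulli measure the normalized cylinder weight is multiplicative under concatenation.\<close>
    define q where "q w = (\<Prod>i<length w. measure p {w ! i}) * R ^ length w" for w
    have mq: "measure m (cylinder M w) * R ^ length w = q w" if "set w \<subseteq> {1..M}" for w
      unfolding q_def \<open>m = \<mu>\<close> p(3) bernoulli_cylinder [OF p(1,2) that] ..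
    have q_nonneg: "q w \<ge> 0" for w
      unfolding q_def using R by (intro mult_nonneg_nonneg prod_nonneg) auto
    have q_append: "q (u @ v) = q u * q v" for u v
    proof -
      have "(\<Prod>i<length (u @ v). measure p {(u @ v) ! i}) = (\<Prod>i<length u. measure p {u ! i}) * (\<Prod>i<length v. measure p {v ! i})"
        by (induction v rule: rev_induct) (simp_all add: nth_append mult_ac flip: append_assoc)
      then show ?thesis by (simp add: q_def power_add)
    qed
    have q_power: "q (concat (replicate n w)) = q w ^ n" for n w
      by (induction n) (simp_all add: q_append, simp add: q_def)
    have rho: "spectral_radius (word_matrix A w) powr s = q w" if w: "set w \<subseteq> {1..M}" for w
    proof (rule spectral_radius_of_gibbs_weight [OF s aK q_nonneg])
      fix n
      have wn: "set (concat (replicate n w)) \<subseteq> {1..M}" using w by (auto simp: in_set_replicate)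
      show "a * matrix_norm (matrix_power (word_matrix A w) n) powr s \<le> q w ^ n"
        using low [OF wn] unfolding mq [OF wn] q_power word_matrix_replicate .
      show "q w ^ n \<le> K * matrix_norm (matrix_power (word_matrix A w) n) powr s"
        using up [OF wn] unfolding mq [OF wn] q_power word_matrix_replicate .
    qed
    have rho': "spectral_radius (word_matrix A w) = q w powr (1 / s)" if w: "set w \<subseteq> {1..M}" for w
      using s spectral_radius_nonneg [of "word_matrix A w"]
      by (simp add: rho [OF w, symmetric] powr_powr)
    show ?thesis
    proof (intro ballI)
      fix B1 B2 assume "B1 \<in> matrix_semigroup M A" "B2 \<in> matrix_semigroup M A"
      then obtain u v where uv: "B1 = word_matrix A u" "B2 = word_matrix A v"
          "set u \<subseteq> {1..M}" "set v \<subseteq> {1..M}"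
        unfolding matrix_semigroup_eq by blast
      have "B1 ** B2 = word_matrix A (v @ u)" by (simp add: uv word_matrix_append)
      then show "spectral_radius (B1 ** B2) = spectral_radius B1 * spectral_radius B2"
        using uv rho' [of "v @ u"] rho' [of u] rho' [of v]
        by (simp add: q_append powr_mult q_nonneg mult.commute)
    qed
  qed
  show "bernoulli_measure M \<mu>"
    if mult: "\<forall>B1\<in>matrix_semigroup M A. \<forall>B2\<in>matrix_semigroup M A.
       spectral_radius (B1 ** B2) = spectral_radius B1 * spectral_radius B2"
  proof -
    let ?\<rho> = "\<lambda>j. spectral_radius (A j)"
    obtain K where K: "K > 0" "\<And>B. B \<in> matrix_semigroup M A \<Longrightarrow> matrix_norm B \<le> K * spectral_radius B"
      using matrix_norm_le_spectral_radius [OF irr nz] mult by blast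
    define R where "R = (\<Sum>j\<in>{1..M}. ?\<rho> j powr s)"
    define q where "q j = ?\<rho> j powr s / R" for j
    \<comment> \<open>Without a matrix of positive spectral radius the weights could not be normalized.\<close>
    have "?\<rho> i > 0"
    proof -
      have "0 < matrix_norm (A i)"
        using nz(2) matrix_norm_nonneg [of "A i"] matrix_norm_eq_0_iff [of "A i"] by simp
      also have "\<dots> \<le> K * ?\<rho> i" using nz(1) by (intro K matrix_semigroup.generator)
      finally show ?thesis using K(1) by (simp add: zero_less_mult_iff)
    qed
    then have "0 < ?\<rho> i powr s" by simp
    also have "\<dots> \<le> R" unfolding R_def using nz(1) by (intro member_le_sum) auto
    finally have R: "R > 0" .
    have q: "\<And>j. j \<in> {1..M} \<Longrightarrow> q j \<ge> 0" "(\<Sum>j\<in>{1..M}. q j) = 1"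
      using R by (auto simp: q_def sum_divide_distrib [symmetric] R_def)
    obtain m where m: "bernoulli_measure M m" "m \<in> invariant_measures M"
      "\<And>w. set w \<subseteq> {1..M} \<Longrightarrow> measure m (cylinder M w) = (\<Prod>j<length w. q (w ! j))"
      using bernoulli_exists [OF q] by blast
    have rho_word: "spectral_radius (word_matrix A w) = (\<Prod>j<length w. ?\<rho> (w ! j))"
      if "set w \<subseteq> {1..M}" "w \<noteq> []" for w
      using that(2,1)
    proof (induction w rule: rev_nonempty_induct)
      case (single j)
      then show ?case by simp
    next
      case (snoc j w)
      have "word_matrix A w \<in> matrix_semigroup M A" "A j \<in> matrix_semigroup M A"
        unfolding matrix_semigroup_eq using snoc
        by (auto intro!: image_eqI [of _ _ w] image_eqI [of _ _ "[j]"])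
      then show ?case using snoc mult by (simp add: word_matrix_append nth_append mult.commute)
    qed
    let ?P = "\<lambda>w. \<Prod>j<length w. ?\<rho> (w ! j)"
    have P_nonneg: "?P w \<ge> 0" for w by (intro prod_nonneg) (simp add: spectral_radius_nonneg)
    \<comment> \<open>The empty word, whose product is the identity, is outside the semigroup; a constant of at least \<open>1\<close>
      covers it.\<close>
    define K' where "K' = max K 1"
    have norm_le: "matrix_norm (word_matrix A w) \<le> K' * ?P w" if w: "set w \<subseteq> {1..M}" for w
    proof (cases "w = []")
      case False
      have "word_matrix A w \<in> matrix_semigroup M A"
        unfolding matrix_semigroup_eq using w False by blast
      then have "matrix_norm (word_matrix A w) \<le> K * ?P w"
        using K(2) rho_word [OF w False] by metis
      also have "\<dots> \<le> K' * ?P w" using P_nonneg by (intro mult_right_mono) (auto simp: K'_def)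
      finally show ?thesis .
    qed (simp add: matrix_norm_mat1 K'_def)
    have le_norm: "?P w \<le> 2 * matrix_norm (word_matrix A w)" if w: "set w \<subseteq> {1..M}" for w
    proof (cases "w = []")
      case False
      then show ?thesis
        using spectral_radius_power_le [of "word_matrix A w" 1] rho_word [OF w] by simp
    qed (simp add: matrix_norm_mat1)
    have prod_powr: "(\<Prod>j<length w. ?\<rho> (w ! j) powr s) = ?P w powr s" for w
      by (simp add: prod_powr_distrib spectral_radius_nonneg)
    have "m \<in> equilibrium_states M A s"
    proof (rule gibbs_imp_equilibrium_state [OF _ s m(2) R])
      show "M \<ge> 1" using M by simp
      show "K' powr s > 0" by (simp add: K'_def)
      fix n
      have "norm_sum M A s n \<le> (\<Sum>w\<in>words {1..M} n. K' powr s * (\<Prod>j<n. ?\<rho> (w ! j) powr s))"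
        unfolding norm_sum_def
      proof (intro sum_mono)
        fix w assume "w \<in> words {1..M} n"
        then have w: "set w \<subseteq> {1..M}" "length w = n" by (auto simp: words_def)
        have "matrix_norm (word_matrix A w) powr s \<le> (K' * ?P w) powr s"
          using s norm_le [OF w(1)] by (intro powr_mono2) (auto simp: matrix_norm_nonneg)
        also have "\<dots> = K' powr s * ?P w powr s" using P_nonneg by (simp add: powr_mult K'_def)
        finally show "matrix_norm (word_matrix A w) powr s \<le> K' powr s * (\<Prod>j<n. ?\<rho> (w ! j) powr s)"
          by (simp only: w(2) [symmetric] prod_powr)
      qed
      also have "\<dots> = K' powr s * R ^ n"
        unfolding sum_distrib_left [symmetric] R_def
        using sum_words_prod [OF finite_atLeastAtMost, of "\<lambda>_ j. ?\<rho> j powr s" n 1 M] by simp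
      finally show "norm_sum M A s n \<le> K' powr s * R ^ n" .
    next
      fix w :: "nat list" assume w: "set w \<subseteq> {1..M}"
      have "measure m (cylinder M w) = ?P w powr s / R ^ length w"
        unfolding m(3) [OF w] q_def by (simp add: prod_dividef prod_powr)
      also have "\<dots> \<le> (2 * matrix_norm (word_matrix A w)) powr s / R ^ length w"
        using R s le_norm [OF w] P_nonneg by (intro divide_right_mono powr_mono2) auto
      also have "\<dots> = 2 powr s * matrix_norm (word_matrix A w) powr s / R ^ length w"
        by (simp add: powr_mult matrix_norm_nonneg)
      finally show "measure m (cylinder M w) \<le> 2 powr s * matrix_norm (word_matrix A w) powr s / R ^ length w" .
    qed
    then have "m = \<mu>" using uniq by blast
    then show ?thesis using m(1) by simp
  qed
qed

end
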